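(* Let $F:(M^m,g)\to(B^n,g')$ be a Clairaut conformal submersion between Riemannian manifolds with $r=e^f$ and dilation $\lambda$, where $f:M\to\mathbb{R}$ is smooth. Then $$K_\nu=\hat K-(m-n)(m-n-1)\,\|\nabla f\|^2,$$ where $K_\nu$ and $\hat K$ denote the scalar curvatures of the vertical distribution and of the fibers, respectively.
   Context: All manifolds, maps and functions are smooth; $\dim M=m$, $\dim B=n$. For a submersion $F:(M,g)\to(B,g')$, the vertical distribution is $\ker F_\ast$ and the horizontal distribution is its $g$-orthogonal complement. $F$ is a conformal submersion with dilation $\lambda:M\to\mathbb{R}^+$ if $g'(F_\ast X,F_\ast Y)=\lambda^2 g(X,Y)$ for all horizontal $X,Y$. A conformal submersion $F$ is a Clairaut conformal submersion with function $r:M\to\mathbb{R}^+$ if for every geodesic $\alpha$ on $(M,g)$ the function $t\mapsto r(\alpha(t))\sin\omega(t)$ is constant, where $\omega(t)\in[0,\pi/2]$ is the angle between $\dot\alpha(t)$ and the horizontal space at $\alpha(t)$. At a point of $M$ let $\{U_1,\dots,U_{m-n}\}$ be a $g$-orthonormal basis of the vertical space. The scalar curvature of the vertical distribution is $K_\nu=\sum_{i}\sum_{j\neq i}\mathrm{sec}(U_i,U_j)$, where $\mathrm{sec}$ is the sectional curvature of $(M,g)$; the scalar curvature of the fibers is $\hat K=\sum_i\sum_{j\ne i}\widehat{\mathrm{sec}}(U_i,U_j)$, where $\widehat{\mathrm{sec}}$ is the sectional curvature of the fiber through the point with the metric induced by $g$. $\nabla f$ and $\|\cdot\|$ are the gradient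 and norm with respect to $g$. *)

theory Defs
  imports "HOL-Analysis.Analysis"
begin

section \<open>Smoothness on relatively open subsets of a linear subspace\<close>

text \<open>
  Manifolds are modelled on linear subspaces \<open>E\<close> of a Euclidean space rather than on a whole
  Euclidean type, so that the fibres of a map, whose dimension is a difference of two dimensions and
  may be 0, are manifolds in the same sense as the total space.
  Only directions in \<open>E\<close> are differentiated, so derivatives never depend on values off \<open>E\<close>.
\<close>

definition dderiv :: "('e::real_normed_vector \<Rightarrow> 'f::real_normed_vector) \<Rightarrow> 'e \<Rightarrow> 'e \<Rightarrow> 'f" where
  "dderiv f x v = vector_derivative (\<lambda>t::real. f (x + t *\<^sub>R v)) (at 0)"

primrec Ck_on :: "nat \<Rightarrow> 'e::real_normed_vector set \<Rightarrow> 'e set \<Rightarrow> ('e \<Rightarrow> 'f::real_normed_vector) \<Rightarrow> bool" where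
  "Ck_on 0 E S f \<longleftrightarrow> continuous_on S f"
| "Ck_on (Suc k) E S f \<longleftrightarrow>
     (\<forall>x\<in>S. f differentiable (at x within S)) \<and> (\<forall>v\<in>E. Ck_on k E S (\<lambda>x. dderiv f x v))"

text \<open>Meant for \<open>S\<close> relatively open in the subspace \<open>E\<close>.\<close>

definition smooth_on :: "'e::real_normed_vector set \<Rightarrow> 'e set \<Rightarrow> ('e \<Rightarrow> 'f::real_normed_vector) \<Rightarrow> bool" where
  "smooth_on E S f \<longleftrightarrow> (\<forall>k. Ck_on k E S f)"


section \<open>Smooth manifolds and maps\<close>

type_synonym ('p, 'e) chart = "'p set \<times> ('p \<Rightarrow> 'e)"

abbreviation chart_dom :: "('p, 'e) chart \<Rightarrow> 'p set" where "chart_dom \<equiv> fst"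
abbreviation chart_map :: "('p, 'e) chart \<Rightarrow> 'p \<Rightarrow> 'e" where "chart_map \<equiv> snd"
abbreviation chart_ran :: "('p, 'e) chart \<Rightarrow> 'e set" where "chart_ran c \<equiv> chart_map c ` chart_dom c"
abbreviation chart_inv :: "('p, 'e) chart \<Rightarrow> 'e \<Rightarrow> 'p" where
  "chart_inv c \<equiv> inv_into (chart_dom c) (chart_map c)"

record ('p, 'e) manifold =
  mtop :: "'p topology"
  model :: "'e set"
  atlas :: "('p, 'e) chart set"

abbreviation points :: "('p, 'e) manifold \<Rightarrow> 'p set" where "points M \<equiv> topspace (mtop M)"

definition mdim :: "('p, 'e::euclidean_space) manifold \<Rightarrow> nat" where
  "mdim M = dim (model M)"

definition charts_at :: "('p, 'e) manifold \<Rightarrow> 'p \<Rightarrow> ('p, 'e) chart set" where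
  "charts_at M p = {c \<in> atlas M. p \<in> chart_dom c}"

definition is_chart :: "'p topology \<Rightarrow> 'e::euclidean_space set \<Rightarrow> ('p, 'e) chart \<Rightarrow> bool" where
  "is_chart T E c \<longleftrightarrow>
     openin T (chart_dom c) \<and> openin (top_of_set E) (chart_ran c) \<and>
     homeomorphic_map (subtopology T (chart_dom c)) (top_of_set (chart_ran c)) (chart_map c)"

definition second_countable_space :: "'p topology \<Rightarrow> bool" where
  "second_countable_space T \<longleftrightarrow>
     (\<exists>\<B>. countable \<B> \<and> (\<forall>V\<in>\<B>. openin T V) \<and>
        (\<forall>U x. openin T U \<and> x \<in> U \<longrightarrow> (\<exists>V\<in>\<B>. x \<in> V \<and> V \<subseteq> U)))"

definition smooth_manifold :: "('p, 'e::euclidean_space) manifold \<Rightarrow> bool" where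
  "smooth_manifold M \<longleftrightarrow>
     Hausdorff_space (mtop M) \<and> second_countable_space (mtop M) \<and> subspace (model M) \<and>
     (\<forall>c\<in>atlas M. is_chart (mtop M) (model M) c) \<and>
     points M = (\<Union>c\<in>atlas M. chart_dom c) \<and>
     (\<forall>c\<in>atlas M. \<forall>d\<in>atlas M.
        smooth_on (model M) (chart_map c ` (chart_dom c \<inter> chart_dom d)) (chart_map d \<circ> chart_inv c))"

definition smooth_fun :: "('p, 'e::euclidean_space) manifold \<Rightarrow> ('p \<Rightarrow> real) \<Rightarrow> bool" where
  "smooth_fun M h \<longleftrightarrow> (\<forall>c\<in>atlas M. smooth_on (model M) (chart_ran c) (h \<circ> chart_inv c))"

definition smooth_at :: "('p, 'e::euclidean_space) manifold \<Rightarrow> 'p \<Rightarrow> ('p \<Rightarrow> real) \<Rightarrow> bool" where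
  "smooth_at M p h \<longleftrightarrow>
     (\<exists>c\<in>charts_at M p. \<exists>W. openin (top_of_set (model M)) W \<and> chart_map c p \<in> W \<and>
        W \<subseteq> chart_ran c \<and> smooth_on (model M) W (h \<circ> chart_inv c))"

definition smooth_map ::
  "('p, 'e::euclidean_space) manifold \<Rightarrow> ('q, 'b::euclidean_space) manifold \<Rightarrow> ('p \<Rightarrow> 'q) \<Rightarrow> bool" where
  "smooth_map M B F \<longleftrightarrow>
     continuous_map (mtop M) (mtop B) F \<and>
     (\<forall>c\<in>atlas M. \<forall>d\<in>atlas B.
        smooth_on (model M) (chart_map c ` {p \<in> chart_dom c. F p \<in> chart_dom d})
          (chart_map d \<circ> F \<circ> chart_inv c))"

text \<open>
  A tangent vector at \<open>p\<close> is the operator taking the derivative at \<open>p\<close>, in one direction, of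
  functions that are smooth near \<open>p\<close>; it is normalised to 0 on all other functions, so that equality
  of operators is equality of tangent vectors. \<open>coord_vec M c p a\<close> is the vector with components \<open>a\<close>
  in the chart \<open>c\<close>, i.e. the sum of the \<open>a\<^sub>i \<partial>/\<partial>x\<^sub>i\<close> at \<open>p\<close>.
\<close>

type_synonym 'p tangent = "('p \<Rightarrow> real) \<Rightarrow> real"

definition coord_vec ::
  "('p, 'e::euclidean_space) manifold \<Rightarrow> ('p, 'e) chart \<Rightarrow> 'p \<Rightarrow> 'e \<Rightarrow> 'p tangent" where
  "coord_vec M c p a =
     (\<lambda>h. if smooth_at M p h then dderiv (h \<circ> chart_inv c) (chart_map c p) a else 0)"

definition tangent_space :: "('p, 'e::euclidean_space) manifold \<Rightarrow> 'p \<Rightarrow> 'p tangent set" where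
  "tangent_space M p = {coord_vec M c p a | c a. c \<in> charts_at M p \<and> a \<in> model M}"

definition components ::
  "('p, 'e::euclidean_space) manifold \<Rightarrow> ('p, 'e) chart \<Rightarrow> 'p \<Rightarrow> 'p tangent \<Rightarrow> 'e" where
  "components M c p v = (THE a. a \<in> model M \<and> coord_vec M c p a = v)"

definition differential ::
  "('q, 'b::euclidean_space) manifold \<Rightarrow> ('p \<Rightarrow> 'q) \<Rightarrow> 'p \<Rightarrow> 'p tangent \<Rightarrow> 'q tangent" where
  "differential B F p v = (\<lambda>h. if smooth_at B (F p) h then v (h \<circ> F) else 0)"

definition smooth_curve ::
  "('p, 'e::euclidean_space) manifold \<Rightarrow> real set \<Rightarrow> (real \<Rightarrow> 'p) \<Rightarrow> bool" where
  "smooth_curve M I \<alpha> \<longleftrightarrow>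
     continuous_map (top_of_set I) (mtop M) \<alpha> \<and>
     (\<forall>c\<in>atlas M. smooth_on UNIV {t \<in> I. \<alpha> t \<in> chart_dom c} (chart_map c \<circ> \<alpha>))"

definition velocity ::
  "('p, 'e::euclidean_space) manifold \<Rightarrow> (real \<Rightarrow> 'p) \<Rightarrow> real \<Rightarrow> 'p tangent" where
  "velocity M \<alpha> t =
     (\<lambda>h. if smooth_at M (\<alpha> t) h then vector_derivative (h \<circ> \<alpha>) (at t) else 0)"


section \<open>Riemannian manifolds\<close>

type_synonym 'p metric_field = "'p \<Rightarrow> 'p tangent \<Rightarrow> 'p tangent \<Rightarrow> real"

definition metric_coord ::
  "('p, 'e::euclidean_space) manifold \<Rightarrow> 'p metric_field \<Rightarrow> ('p, 'e) chart \<Rightarrow> 'e \<Rightarrow> 'e \<Rightarrow> 'e \<Rightarrow> real" where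
  "metric_coord M g c x a b =
     (let p = chart_inv c x in g p (coord_vec M c p a) (coord_vec M c p b))"

definition riemannian_metric ::
  "('p, 'e::euclidean_space) manifold \<Rightarrow> 'p metric_field \<Rightarrow> bool" where
  "riemannian_metric M g \<longleftrightarrow>
     (\<forall>p\<in>points M.
        (\<forall>u\<in>tangent_space M p. \<forall>v\<in>tangent_space M p. g p u v = g p v u) \<and>
        (\<forall>u\<in>tangent_space M p. \<forall>v\<in>tangent_space M p. \<forall>w\<in>tangent_space M p. \<forall>a b.
           g p (\<lambda>h. a * u h + b * v h) w = a * g p u w + b * g p v w) \<and>
        (\<forall>u\<in>tangent_space M p. u \<noteq> (\<lambda>h. 0) \<longrightarrow> g p u u > 0)) \<and>
     (\<forall>c\<in>atlas M. \<forall>a\<in>model M. \<forall>b\<in>model M.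
        smooth_on (model M) (chart_ran c) (\<lambda>x. metric_coord M g c x a b))"

definition riemannian_manifold ::
  "('p, 'e::euclidean_space) manifold \<Rightarrow> 'p metric_field \<Rightarrow> bool" where
  "riemannian_manifold M g \<longleftrightarrow> smooth_manifold M \<and> riemannian_metric M g"

definition gnorm :: "'p metric_field \<Rightarrow> 'p \<Rightarrow> 'p tangent \<Rightarrow> real" where
  "gnorm g p v = sqrt (g p v v)"

definition gradient ::
  "('p, 'e::euclidean_space) manifold \<Rightarrow> 'p metric_field \<Rightarrow> ('p \<Rightarrow> real) \<Rightarrow> 'p \<Rightarrow> 'p tangent" where
  "gradient M g f p = (THE u. u \<in> tangent_space M p \<and> (\<forall>v\<in>tangent_space M p. g p u v = v f))"

text \<open>
  The Levi-Civita connection in a chart. The Christoffel symbols are kept as a vector-valued bilinear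
  map, determined by the Koszul formula for coordinate fields.
\<close>

definition christoffel ::
  "('p, 'e::euclidean_space) manifold \<Rightarrow> 'p metric_field \<Rightarrow> ('p, 'e) chart \<Rightarrow> 'e \<Rightarrow> 'e \<Rightarrow> 'e \<Rightarrow> 'e" where
  "christoffel M g c x a b =
     (THE w. w \<in> model M \<and>
        (\<forall>z\<in>model M. 2 * metric_coord M g c x w z =
             dderiv (\<lambda>y. metric_coord M g c y b z) x a
           + dderiv (\<lambda>y. metric_coord M g c y a z) x b
           - dderiv (\<lambda>y. metric_coord M g c y a b) x z))"

definition cov_deriv ::
  "('p, 'e::euclidean_space) manifold \<Rightarrow> 'p metric_field \<Rightarrow> ('p, 'e) chart
     \<Rightarrow> ('e \<Rightarrow> 'e) \<Rightarrow> ('e \<Rightarrow> 'e) \<Rightarrow> 'e \<Rightarrow> 'e" where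
  "cov_deriv M g c X Y x = dderiv Y x (X x) + christoffel M g c x (X x) (Y x)"

text \<open>
  \<open>R(a,b)d = \<nabla>\<^sub>a\<nabla>\<^sub>b d - \<nabla>\<^sub>b\<nabla>\<^sub>a d\<close>, evaluated on the fields with constant components \<open>a\<close>, \<open>b\<close>, \<open>d\<close>, whose
  Lie brackets vanish.
\<close>

definition curvature ::
  "('p, 'e::euclidean_space) manifold \<Rightarrow> 'p metric_field \<Rightarrow> ('p, 'e) chart
     \<Rightarrow> 'e \<Rightarrow> 'e \<Rightarrow> 'e \<Rightarrow> 'e \<Rightarrow> 'e" where
  "curvature M g c x a b d =
     cov_deriv M g c (\<lambda>_. a) (cov_deriv M g c (\<lambda>_. b) (\<lambda>_. d)) x
   - cov_deriv M g c (\<lambda>_. b) (cov_deriv M g c (\<lambda>_. a) (\<lambda>_. d)) x"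

text \<open>Curvature being a tensor, the chart chosen at \<open>p\<close> does not matter.\<close>

definition sec_curv ::
  "('p, 'e::euclidean_space) manifold \<Rightarrow> 'p metric_field \<Rightarrow> 'p \<Rightarrow> 'p tangent \<Rightarrow> 'p tangent \<Rightarrow> real" where
  "sec_curv M g p u v =
     (let c = (SOME c. c \<in> charts_at M p);
          x = chart_map c p;
          a = components M c p u;
          b = components M c p v
      in metric_coord M g c x (curvature M g c x a b b) a
           / (g p u u * g p v v - (g p u v)\<^sup>2))"

text \<open>
  The geodesic equation \<open>x'' + \<Gamma>(x', x') = 0\<close> is invariant under a change of chart; it is imposed at
  each time in some chart around the current point. Constant curves are geodesics.
\<close>

definition geodesic ::
  "('p, 'e::euclidean_space) manifold \<Rightarrow> 'p metric_field \<Rightarrow> real set \<Rightarrow> (real \<Rightarrow> 'p) \<Rightarrow> bool" where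
  "geodesic M g I \<alpha> \<longleftrightarrow>
     open I \<and> is_interval I \<and> smooth_curve M I \<alpha> \<and>
     (\<forall>t\<in>I. \<exists>c\<in>charts_at M (\<alpha> t).
        let x = chart_map c \<circ> \<alpha>; x' = (\<lambda>s. vector_derivative x (at s))
        in vector_derivative x' (at t) + christoffel M g c (x t) (x' t) (x' t) = 0)"


section \<open>Clairaut conformal submersions\<close>

definition submersion ::
  "('p, 'e::euclidean_space) manifold \<Rightarrow> ('q, 'b::euclidean_space) manifold \<Rightarrow> ('p \<Rightarrow> 'q) \<Rightarrow> bool" where
  "submersion M B F \<longleftrightarrow>
     smooth_map M B F \<and>
     (\<forall>p\<in>points M. differential B F p ` tangent_space M p = tangent_space B (F p))"

definition vertical ::
  "('p, 'e::euclidean_space) manifold \<Rightarrow> ('q, 'b::euclidean_space) manifold \<Rightarrow> ('p \<Rightarrow> 'q)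
     \<Rightarrow> 'p \<Rightarrow> 'p tangent set" where
  "vertical M B F p = {v \<in> tangent_space M p. differential B F p v = (\<lambda>h. 0)}"

definition horizontal ::
  "('p, 'e::euclidean_space) manifold \<Rightarrow> 'p metric_field \<Rightarrow> ('q, 'b::euclidean_space) manifold
     \<Rightarrow> ('p \<Rightarrow> 'q) \<Rightarrow> 'p \<Rightarrow> 'p tangent set" where
  "horizontal M g B F p = {v \<in> tangent_space M p. \<forall>w\<in>vertical M B F p. g p v w = 0}"

definition conformal_submersion ::
  "('p, 'e::euclidean_space) manifold \<Rightarrow> 'p metric_field
     \<Rightarrow> ('q, 'b::euclidean_space) manifold \<Rightarrow> 'q metric_field
     \<Rightarrow> ('p \<Rightarrow> 'q) \<Rightarrow> ('p \<Rightarrow> real) \<Rightarrow> bool" where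
  "conformal_submersion M g B g' F dil \<longleftrightarrow>
     submersion M B F \<and> smooth_fun M dil \<and>
     (\<forall>p\<in>points M. dil p > 0 \<and>
        (\<forall>X\<in>horizontal M g B F p. \<forall>Y\<in>horizontal M g B F p.
           g' (F p) (differential B F p X) (differential B F p Y) = (dil p)\<^sup>2 * g p X Y))"

definition horizontal_part ::
  "('p, 'e::euclidean_space) manifold \<Rightarrow> 'p metric_field \<Rightarrow> ('q, 'b::euclidean_space) manifold
     \<Rightarrow> ('p \<Rightarrow> 'q) \<Rightarrow> 'p \<Rightarrow> 'p tangent \<Rightarrow> 'p tangent" where
  "horizontal_part M g B F p v =
     (THE w. w \<in> horizontal M g B F p \<and> (\<lambda>h. v h - w h) \<in> vertical M B F p)"

text \<open>
  The angle in \<open>[0, \<pi>/2]\<close> between \<open>v\<close> and its orthogonal projection to the horizontal space; for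
  \<open>v = 0\<close> the formula gives \<open>\<pi>/2\<close>, which only concerns constant geodesics.
\<close>

definition horizontal_angle ::
  "('p, 'e::euclidean_space) manifold \<Rightarrow> 'p metric_field \<Rightarrow> ('q, 'b::euclidean_space) manifold
     \<Rightarrow> ('p \<Rightarrow> 'q) \<Rightarrow> 'p \<Rightarrow> 'p tangent \<Rightarrow> real" where
  "horizontal_angle M g B F p v =
     arccos (gnorm g p (horizontal_part M g B F p v) / gnorm g p v)"

definition clairaut_conformal_submersion ::
  "('p, 'e::euclidean_space) manifold \<Rightarrow> 'p metric_field
     \<Rightarrow> ('q, 'b::euclidean_space) manifold \<Rightarrow> 'q metric_field
     \<Rightarrow> ('p \<Rightarrow> 'q) \<Rightarrow> ('p \<Rightarrow> real) \<Rightarrow> ('p \<Rightarrow> real) \<Rightarrow> bool" where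
  "clairaut_conformal_submersion M g B g' F dil r \<longleftrightarrow>
     conformal_submersion M g B g' F dil \<and>
     smooth_fun M r \<and> (\<forall>p\<in>points M. r p > 0) \<and>
     (\<forall>I \<alpha>. geodesic M g I \<alpha> \<longrightarrow>
        (\<exists>k. \<forall>t\<in>I. r (\<alpha> t) * sin (horizontal_angle M g B F (\<alpha> t) (velocity M \<alpha> t)) = k))"


section \<open>Fibres and scalar curvatures\<close>

text \<open>
  The fibre over \<open>b\<close> as an embedded submanifold: its charts are all charts of the subspace topology
  whose inverses are smooth immersions into \<open>M\<close>. Any subspace of the right dimension serves as model.
\<close>

definition fibre_model ::
  "('p, 'e::euclidean_space) manifold \<Rightarrow> ('q, 'b::euclidean_space) manifold \<Rightarrow> 'e set" where
  "fibre_model M B = (SOME K. subspace K \<and> K \<subseteq> model M \<and> dim K = mdim M - mdim B)"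

definition fibre ::
  "('p, 'e::euclidean_space) manifold \<Rightarrow> ('q, 'b::euclidean_space) manifold \<Rightarrow> ('p \<Rightarrow> 'q) \<Rightarrow> 'q
     \<Rightarrow> ('p, 'e) manifold" where
  "fibre M B F b =
     (let T = subtopology (mtop M) {p \<in> points M. F p = b}; K = fibre_model M B in
      \<lparr> mtop = T, model = K,
        atlas = {d. is_chart T K d \<and>
          (\<forall>c\<in>atlas M.
             let S = chart_map d ` (chart_dom d \<inter> chart_dom c); i = chart_map c \<circ> chart_inv d
             in smooth_on K S i \<and> (\<forall>x\<in>S. inj_on (dderiv i x) K))} \<rparr>)"

text \<open>The induced metric is the pullback under the inclusion, whose underlying function is \<open>id\<close>.\<close>

definition fibre_metric :: "('p, 'e::euclidean_space) manifold \<Rightarrow> 'p metric_field \<Rightarrow> 'p metric_field" where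
  "fibre_metric M g p u v = g p (differential M id p u) (differential M id p v)"

definition to_fibre ::
  "('p, 'e::euclidean_space) manifold \<Rightarrow> ('q, 'b::euclidean_space) manifold \<Rightarrow> ('p \<Rightarrow> 'q)
     \<Rightarrow> 'p \<Rightarrow> 'p tangent \<Rightarrow> 'p tangent" where
  "to_fibre M B F p v =
     (THE u. u \<in> tangent_space (fibre M B F (F p)) p \<and> differential M id p u = v)"

definition fibre_sec_curv ::
  "('p, 'e::euclidean_space) manifold \<Rightarrow> 'p metric_field \<Rightarrow> ('q, 'b::euclidean_space) manifold
     \<Rightarrow> ('p \<Rightarrow> 'q) \<Rightarrow> 'p \<Rightarrow> 'p tangent \<Rightarrow> 'p tangent \<Rightarrow> real" where
  "fibre_sec_curv M g B F p u v =
     sec_curv (fibre M B F (F p)) (fibre_metric M g) p (to_fibre M B F p u) (to_fibre M B F p v)"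

definition vertical_orthonormal_basis ::
  "('p, 'e::euclidean_space) manifold \<Rightarrow> 'p metric_field \<Rightarrow> ('q, 'b::euclidean_space) manifold
     \<Rightarrow> ('p \<Rightarrow> 'q) \<Rightarrow> 'p \<Rightarrow> (nat \<Rightarrow> 'p tangent) \<Rightarrow> bool" where
  "vertical_orthonormal_basis M g B F p U \<longleftrightarrow>
     (let k = mdim M - mdim B in
      (\<forall>i<k. U i \<in> vertical M B F p) \<and>
      (\<forall>i<k. \<forall>j<k. g p (U i) (U j) = (if i = j then 1 else 0)) \<and>
      (\<forall>v\<in>vertical M B F p. \<exists>a::nat \<Rightarrow> real. v = (\<lambda>h. \<Sum>i<k. a i * U i h)))"

definition vertical_scalar_curv ::
  "('p, 'e::euclidean_space) manifold \<Rightarrow> 'p metric_field \<Rightarrow> ('q, 'b::euclidean_space) manifold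
     \<Rightarrow> 'p \<Rightarrow> (nat \<Rightarrow> 'p tangent) \<Rightarrow> real" where
  "vertical_scalar_curv M g B p U =
     (let k = mdim M - mdim B in \<Sum>i<k. \<Sum>j\<in>{..<k} - {i}. sec_curv M g p (U i) (U j))"

definition fibre_scalar_curv ::
  "('p, 'e::euclidean_space) manifold \<Rightarrow> 'p metric_field \<Rightarrow> ('q, 'b::euclidean_space) manifold
     \<Rightarrow> ('p \<Rightarrow> 'q) \<Rightarrow> 'p \<Rightarrow> (nat \<Rightarrow> 'p tangent) \<Rightarrow> real" where
  "fibre_scalar_curv M g B F p U =
     (let k = mdim M - mdim B in \<Sum>i<k. \<Sum>j\<in>{..<k} - {i}. fibre_sec_curv M g B F p (U i) (U j))"

end

theory Submission
  imports Defs
begin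

text \<open>
  Write \<open>v = u + x\<close> for the splitting of the velocity of a geodesic into its vertical and horizontal parts.
  As the speed is constant, the Clairaut condition says that \<open>exp (2 f) \<parallel>u\<parallel>\<^sup>2\<close> is constant along every geodesic.
  For a vertical field \<open>W\<close> with \<open>W = u\<close> at time 0, the function \<open>exp (2 f) (2 \<langle>v, W\<rangle> - \<parallel>W\<parallel>\<^sup>2)\<close> is at most this constant,
  with equality at time 0, so its derivative there vanishes:
  \<open>df(v) \<parallel>u\<parallel>\<^sup>2 + \<langle>x, \<nabla>\<^sub>v W\<rangle> = 0\<close>. Replacing \<open>x\<close> by its multiples separates this into \<open>df(u) = 0\<close> and
  \<open>\<langle>x, \<nabla>\<^sub>u W\<rangle> = - df(x) \<parallel>u\<parallel>\<^sup>2\<close>: the gradient of \<open>f\<close> is horizontal and the fibres are totally umbilic with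
  second fundamental form \<open>- \<langle>a, b\<rangle> \<nabla>f\<close>. By the Gauss equation the sectional curvature
  of a vertical plane is then that of the fibre minus \<open>\<parallel>\<nabla>f\<parallel>\<^sup>2\<close>.
\<close>

section \<open>Calculus on relatively open subsets of subspaces\<close>

text \<open>The Clairaut condition only speaks of geodesics, so a geodesic with every prescribed
  initial velocity must be produced; Picard iteration supplies it. The vertical fields
  \<open>W\<close> and the charts of a fibre come from one construction: near a point, a map
  \<theta> with derivative the identity there turns the submersion into an affine map
  (\<open>submersion_straighten\<close>), and constant vertical fields as well as flat fibres are
  pulled back by it. Sectional curvature is defined in a chart picked by \<open>SOME\<close>,
  separately on \<open>M\<close> and on the fibre. Hence the whole argument is run in coordinates,
  with the metrics of \<open>M\<close> and of the fibre as two fields of bilinear forms related by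
  pullback along the inclusion, and the Gauss equation is stated for such a pair. Its second
  fundamental form involves second derivatives of the inclusion, whereas the geodesic argument
  yields derivatives of \<open>W\<close>; \<open>umbilic_fibre\<close> passes from one to the other.
  The model spaces are subspaces whose dimension is not fixed by a type, so standard analysis on
  open sets is reached by composing with the Euclidean projection \<open>proj\<close>.\<close>

definition ropen :: "'e::euclidean_space set \<Rightarrow> 'e set \<Rightarrow> bool" where
  "ropen E S \<longleftrightarrow> subspace E \<and> openin (top_of_set E) S"

lemma ropen_subset: "ropen E S \<Longrightarrow> x \<in> S \<Longrightarrow> x \<in> E"
  by (auto simp: ropen_def dest: openin_imp_subset)

lemma ropen_UNIV [simp]: "ropen UNIV S \<longleftrightarrow> open S"
  by (auto simp: ropen_def)

lemma ropen_preimage: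
  assumes "ropen E S" "continuous_on S f" "f ` S \<subseteq> E'" "ropen E' T"
  shows "ropen E (S \<inter> f -` T)"
proof -
  have "openin (top_of_set S) (S \<inter> f -` T)"
    using assms by (intro continuous_openin_preimage[where T=E']) (auto simp: ropen_def)
  thus ?thesis using assms(1) openin_trans by (auto simp: ropen_def)
qed

lemma ropen_line:
  assumes "ropen E S" "x \<in> S" "v \<in> E"
  shows "\<forall>\<^sub>F t::real in nhds 0. x + t *\<^sub>R v \<in> S"
proof -
  obtain U where U: "open U" "S = E \<inter> U"
    using assms by (auto simp: ropen_def openin_open)
  have "((\<lambda>t. x + t *\<^sub>R v) \<longlongrightarrow> x + 0 *\<^sub>R v) (nhds 0)"
    by (intro tendsto_intros filterlim_ident)
  hence "\<forall>\<^sub>F t in nhds 0. x + t *\<^sub>R v \<in> U"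
    using U assms by (auto intro: topological_tendstoD)
  moreover have "x + t *\<^sub>R v \<in> E" for t
    using assms U by (auto simp: ropen_def intro: subspace_add subspace_scale)
  ultimately show ?thesis using U by (auto elim: eventually_mono)
qed

text \<open>The difference quotients lie in \<open>E\<close>, and a subspace of a Euclidean space is
  closed.\<close>

lemma vector_derivative_in_subspace:
  assumes "subspace (E::'e::euclidean_space set)" "(c has_vector_derivative c') (at t)" "\<forall>\<^sub>F s in nhds t. c s \<in> E"
  shows "c' \<in> E"
proof (rule Lim_in_closed_set)
  show "closed E" using assms closed_subspace by blast
  show "((\<lambda>h. (1/h) *\<^sub>R (c (t + h) - c t)) \<longlongrightarrow> c') (at 0)"
  proof -
    have "((\<lambda>h. (c (t + h) - c t - h *\<^sub>R c') /\<^sub>R norm h) \<longlongrightarrow> 0) (at 0)"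
      using assms(2) by (subst tendsto_norm_zero_iff[symmetric])
        (simp add: has_vector_derivative_def has_derivative_at divide_inverse mult.commute)
    \<comment> \<open>The factor \<open>norm h / h\<close> has absolute value 1; it replaces the
      norm in the denominator by the signed \<open>h\<close>.\<close>
    hence "((\<lambda>h. (norm h / h) *\<^sub>R ((c (t + h) - c t - h *\<^sub>R c') /\<^sub>R norm h)) \<longlongrightarrow> 0) (at 0)"
      by (rule Lim_null_comparison[rotated, OF tendsto_norm_zero]) (simp add: eventually_at_filter)
    hence "((\<lambda>h. (1/h) *\<^sub>R (c (t + h) - c t) - c') \<longlongrightarrow> 0) (at 0)"
      by (rule Lim_transform_eventually)
         (auto simp: eventually_at_filter scaleR_diff_right field_simps)
    thus ?thesis by (simp add: LIM_zero_iff)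
  qed
  have ct: "c t \<in> E" using assms(3) eventually_nhds_x_imp_x by blast
  have "((\<lambda>h. t + h) \<longlongrightarrow> t + 0) (at 0)" by (intro tendsto_intros)
  hence "filterlim (\<lambda>h. t + h) (nhds t) (at 0)" by simp
  hence "\<forall>\<^sub>F h in at 0. c (t + h) \<in> E"
    using assms(3) unfolding filterlim_iff by blast
  thus "\<forall>\<^sub>F h in at 0. (1/h) *\<^sub>R (c (t + h) - c t) \<in> E"
    by eventually_elim (use ct assms(1) in \<open>auto intro!: subspace_scale subspace_diff\<close>)
qed simp

text \<open>Orthonormal for the ambient Euclidean inner product and unrelated to any Riemannian
  metric; it only supplies coordinates in \<open>E\<close>.\<close>

definition obasis :: "'e::euclidean_space set \<Rightarrow> 'e set" where
  "obasis E = (SOME B. B \<subseteq> E \<and> pairwise orthogonal B \<and> (\<forall>x\<in>B. norm x = 1) \<and>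
     independent B \<and> card B = dim E \<and> span B = E)"

lemma obasis:
  assumes "subspace E"
  shows "obasis E \<subseteq> E" "pairwise orthogonal (obasis E)" "\<And>x. x \<in> obasis E \<Longrightarrow> norm x = 1"
    "independent (obasis E)" "card (obasis E) = dim E" "span (obasis E) = E" "finite (obasis E)"
proof -
  have "\<exists>B. B \<subseteq> E \<and> pairwise orthogonal B \<and> (\<forall>x\<in>B. norm x = 1) \<and>
     independent B \<and> card B = dim E \<and> span B = E"
    using orthonormal_basis_subspace[OF assms] by metis
  from someI_ex[OF this] show "obasis E \<subseteq> E" "pairwise orthogonal (obasis E)"
    "\<And>x. x \<in> obasis E \<Longrightarrow> norm x = 1"
    "independent (obasis E)" "card (obasis E) = dim E" "span (obasis E) = E"
    unfolding obasis_def by blast+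
  thus "finite (obasis E)" using independent_imp_finite by blast
qed

text \<open>The Euclidean orthogonal projection onto \<open>E\<close>. Precomposing with it extends
  maps and functionals from \<open>E\<close> to the whole space.\<close>

definition proj :: "'e::euclidean_space set \<Rightarrow> 'e \<Rightarrow> 'e" where
  "proj E v = (\<Sum>b\<in>obasis E. (v \<bullet> b) *\<^sub>R b)"

lemma linear_proj: "linear (proj E)"
  unfolding proj_def
  by (rule linearI) (simp_all add: inner_left_distrib scaleR_left_distrib sum.distrib scaleR_sum_right)

lemma bounded_linear_proj: "bounded_linear (proj E)"
  by (simp add: linear_proj linear_conv_bounded_linear[symmetric])

lemma proj_in: "subspace E \<Longrightarrow> proj E v \<in> E"
  unfolding proj_def using obasis(1) by (blast intro: subspace_sum subspace_scale)

lemma proj_id: "subspace E \<Longrightarrow> v \<in> E \<Longrightarrow> proj E v = v"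
  unfolding proj_def
  by (rule orthonormal_basis_expand) (use obasis[of E] in auto)

lemma subspace_expand: "subspace E \<Longrightarrow> v \<in> E \<Longrightarrow> (\<Sum>b\<in>obasis E. (v \<bullet> b) *\<^sub>R b) = v"
  using proj_id unfolding proj_def .

lemma obasis_in: "subspace E \<Longrightarrow> b \<in> obasis E \<Longrightarrow> b \<in> E"
  using obasis(1) by blast

subsection \<open>Directional derivatives\<close>

text \<open>As the curve stays in \<open>S\<close> near \<open>t\<close>, a derivative of
  \<open>f\<close> within \<open>S\<close> is enough for a two-sided derivative in \<open>t\<close>,
  although \<open>S\<close> may have empty interior.\<close>

lemma has_vector_derivative_along:
  assumes "(f has_derivative f') (at (c t) within S)"
    "(c has_vector_derivative c') (at t)" "\<forall>\<^sub>F s in nhds t. c s \<in> S"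
  shows "((\<lambda>s. f (c s)) has_vector_derivative f' c') (at t)"
proof -
  obtain U where U: "open U" "t \<in> U" "\<And>s. s \<in> U \<Longrightarrow> c s \<in> S"
    using assms(3) by (auto simp: eventually_nhds)
  have "(c has_derivative (\<lambda>h. h *\<^sub>R c')) (at t within U)"
    using assms(2) by (simp add: has_vector_derivative_def has_derivative_at_withinI)
  moreover have "(f has_derivative f') (at (c t) within (c ` U))"
    using assms(1) U by (auto intro: has_derivative_subset)
  ultimately have "((f \<circ> c) has_derivative f' \<circ> (\<lambda>h. h *\<^sub>R c')) (at t within U)"
    by (rule diff_chain_within)
  moreover have "f' \<circ> (\<lambda>h. h *\<^sub>R c') = (\<lambda>h. h *\<^sub>R f' c')"
    using assms(1) by (auto simp: has_derivative_def bounded_linear.linear linear_scale)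
  ultimately show ?thesis
    using at_within_open[OF U(2,1)] by (simp add: has_vector_derivative_def comp_def)
qed

lemma line_has_vector_derivative:
  "((\<lambda>t::real. x + t *\<^sub>R v) has_vector_derivative v) (at t)"
  unfolding has_vector_derivative_def by (rule derivative_eq_intros | simp)+

text \<open>A derivative within \<open>S\<close> is not unique off \<open>E\<close>, but lines in
  directions of \<open>E\<close> remain in \<open>S\<close> for small times, which determines it on
  \<open>E\<close>.\<close>

lemma has_derivative_dderiv:
  assumes "ropen E S" "x \<in> S" "v \<in> E" "(f has_derivative f') (at x within S)"
  shows "((\<lambda>t. f (x + t *\<^sub>R v)) has_vector_derivative f' v) (at 0)" "dderiv f x v = f' v"
proof -
  show "((\<lambda>t. f (x + t *\<^sub>R v)) has_vector_derivative f' v) (at 0)"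
    by (rule has_vector_derivative_along[where S=S, OF _ line_has_vector_derivative])
       (use assms ropen_line[OF assms(1-3)] in auto)
  thus "dderiv f x v = f' v" unfolding dderiv_def by (rule vector_derivative_at)
qed

lemma dderiv_line:
  assumes "ropen E S" "x \<in> S" "v \<in> E" "f differentiable (at x within S)"
  shows "((\<lambda>t. f (x + t *\<^sub>R v)) has_vector_derivative dderiv f x v) (at 0)"
  using assms has_derivative_dderiv by (metis differentiable_def)

text \<open>Differences of points of \<open>S\<close> lie in \<open>E\<close>, so a derivative
  within \<open>S\<close> may be changed off \<open>E\<close> at will. Composition with
  \<open>proj E\<close> selects a canonical one that is expressed by \<open>dderiv\<close>.\<close>

lemma differentiable_dderiv:
  assumes "ropen E S" "x \<in> S" "f differentiable (at x within S)"
  shows "(f has_derivative (\<lambda>v. dderiv f x (proj E v))) (at x within S)"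
proof -
  obtain f' where f': "(f has_derivative f') (at x within S)"
    using assms(3) by (auto simp: differentiable_def)
  have E: "subspace E" using assms(1) by (simp add: ropen_def)
  have eq: "(\<lambda>v. dderiv f x (proj E v)) = f' \<circ> proj E"
    using has_derivative_dderiv(2)[OF assms(1,2) _ f'] proj_in[OF E] by auto
  have "bounded_linear (f' \<circ> proj E)"
    using f' bounded_linear_proj by (auto simp: has_derivative_def comp_def intro: bounded_linear_compose)
  moreover have "((\<lambda>y. (1 / norm (y - x)) *\<^sub>R (f y - (f x + (f' \<circ> proj E) (y - x)))) \<longlongrightarrow> 0) (at x within S)"
  proof (rule Lim_transform_eventually)
    show "((\<lambda>y. (1 / norm (y - x)) *\<^sub>R (f y - (f x + f' (y - x)))) \<longlongrightarrow> 0) (at x within S)"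
      using f' by (simp add: has_derivative_within)
    have "proj E (y - x) = y - x" if "y \<in> S" for y
      using that assms E by (auto intro!: proj_id subspace_diff dest: ropen_subset)
    thus "\<forall>\<^sub>F y in at x within S. (1 / norm (y - x)) *\<^sub>R (f y - (f x + f' (y - x))) =
        (1 / norm (y - x)) *\<^sub>R (f y - (f x + (f' \<circ> proj E) (y - x)))"
      by (auto simp: eventually_at_filter)
  qed
  ultimately show ?thesis unfolding eq has_derivative_within by blast
qed

text \<open>The form in which linearity of \<open>dderiv f x\<close> on \<open>E\<close> is used
  below: rewrite with \<open>L\<close>, then use linearity of \<open>L\<close> on the whole
  type.\<close>

lemma dderiv_linear:
  assumes "ropen E S" "x \<in> S" "f differentiable (at x within S)"
  obtains L where "bounded_linear L" "(f has_derivative L) (at x within S)" "\<And>v. v \<in> E \<Longrightarrow> dderiv f x v = L v"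
    "\<And>v. L v = dderiv f x (proj E v)"
proof -
  have E: "subspace E" using assms(1) by (simp add: ropen_def)
  show ?thesis
    using that[OF _ differentiable_dderiv[OF assms]] differentiable_dderiv[OF assms] proj_id[OF E]
    by (simp add: has_derivative_def)
qed

lemma dderiv_chain:
  assumes "ropen E S" "f differentiable (at (c t) within S)"
    "(c has_vector_derivative c') (at t)" "\<forall>\<^sub>F s in nhds t. c s \<in> S"
  shows "((\<lambda>s. f (c s)) has_vector_derivative dderiv f (c t) c') (at t)"
proof -
  have E: "subspace E" using assms(1) by (simp add: ropen_def)
  have x: "c t \<in> S" using assms(4) by (rule eventually_nhds_x_imp_x)
  have "c' \<in> E"
    by (rule vector_derivative_in_subspace[OF E assms(3)])
      (use assms(4) ropen_subset[OF assms(1)] in \<open>auto elim: eventually_mono\<close>)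
  thus ?thesis
    using has_vector_derivative_along[OF differentiable_dderiv[OF assms(1) x assms(2)] assms(3,4)] proj_id[OF E]
    by simp
qed

lemma dderiv_in_subspace:
  fixes f :: "'e::euclidean_space \<Rightarrow> 'f::euclidean_space"
  assumes "ropen E S" "x \<in> S" "v \<in> E" "f differentiable (at x within S)" "subspace E'" "\<And>y. y \<in> S \<Longrightarrow> f y \<in> E'"
  shows "dderiv f x v \<in> E'"
  by (rule vector_derivative_in_subspace[OF assms(5) dderiv_line[OF assms(1-4)]])
     (use ropen_line[OF assms(1-3)] assms(6) in \<open>auto elim: eventually_mono\<close>)

lemma dderiv_compose:
  assumes "ropen E S" "x \<in> S" "v \<in> E" "f differentiable (at x within S)" "ropen E' T" "f ` S \<subseteq> T"
    "g differentiable (at (f x) within T)"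
  shows "dderiv (\<lambda>y. g (f y)) x v = dderiv g (f x) (dderiv f x v)"
    "(\<lambda>y. g (f y)) differentiable (at x within S)"
proof -
  have "((\<lambda>t. g (f (x + t *\<^sub>R v))) has_vector_derivative dderiv g (f (x + 0 *\<^sub>R v)) (dderiv f x v)) (at 0)"
    by (rule dderiv_chain[OF assms(5), where c="\<lambda>t. f (x + t *\<^sub>R v)"])
       (use assms dderiv_line[OF assms(1-4)] in
         \<open>auto intro: eventually_mono[OF ropen_line[OF assms(1-3)]]\<close>)
  thus "dderiv (\<lambda>y. g (f y)) x v = dderiv g (f x) (dderiv f x v)"
    unfolding dderiv_def by (simp add: vector_derivative_at)
  show "(\<lambda>y. g (f y)) differentiable (at x within S)"
    using differentiable_chain_within[OF assms(4) differentiable_within_subset[OF assms(7,6)]] by (simp add: comp_def)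
qed

lemma dderiv_cong:
  assumes "ropen E S" "x \<in> S" "v \<in> E" "\<And>y. y \<in> S \<Longrightarrow> f y = g y"
  shows "dderiv f x v = dderiv g x v"
  unfolding dderiv_def
  by (rule vector_derivative_cong_eq)
     (use ropen_line[OF assms(1-3)] assms(4) in \<open>auto elim: eventually_mono\<close>)

lemma dderiv_bilinear:
  assumes "bounded_bilinear prd" "ropen E S" "x \<in> S" "v \<in> E"
    "f differentiable (at x within S)" "g differentiable (at x within S)"
  shows "dderiv (\<lambda>y. prd (f y) (g y)) x v = prd (f x) (dderiv g x v) + prd (dderiv f x v) (g x)"
    "(\<lambda>y. prd (f y) (g y)) differentiable (at x within S)"
  using has_derivative_dderiv(2)[OF assms(2-4) bounded_bilinear.FDERIV[OF assms(1)
        differentiable_dderiv[OF assms(2,3,5)] differentiable_dderiv[OF assms(2,3,6)]]]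
    bounded_bilinear.FDERIV[OF assms(1)
        differentiable_dderiv[OF assms(2,3,5)] differentiable_dderiv[OF assms(2,3,6)]] assms(2,4)
  by (auto simp: ropen_def proj_id differentiable_def)

lemma dderiv_add:
  assumes "ropen E S" "x \<in> S" "v \<in> E" "f differentiable (at x within S)" "g differentiable (at x within S)"
  shows "dderiv (\<lambda>y. f y + g y) x v = dderiv f x v + dderiv g x v"
  using has_derivative_dderiv(2)[OF assms(1-3) has_derivative_add[OF
        differentiable_dderiv[OF assms(1,2,4)] differentiable_dderiv[OF assms(1,2,5)]]] assms(1,3)
  by (auto simp: ropen_def proj_id)

lemma dderiv_bounded_linear:
  assumes "bounded_linear L" "ropen E S" "x \<in> S" "v \<in> E" "f differentiable (at x within S)"
  shows "dderiv (\<lambda>y. L (f y)) x v = L (dderiv f x v)"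
  using has_derivative_dderiv(2)[OF assms(2-4) bounded_linear.has_derivative[OF assms(1)
        differentiable_dderiv[OF assms(2,3,5)]]] assms(2,4)
  by (auto simp: ropen_def proj_id)

lemma dderiv_const [simp]: "dderiv (\<lambda>_. c) x v = 0"
  unfolding dderiv_def by simp

lemma dderiv_id [simp]: "dderiv (\<lambda>y. y) x v = v"
  unfolding dderiv_def by (rule vector_derivative_at[OF line_has_vector_derivative])

subsection \<open>Smooth functions\<close>

lemma Ck_on_cong:
  assumes "ropen E S" "\<And>x. x \<in> S \<Longrightarrow> f x = g x"
  shows "Ck_on k E S f \<longleftrightarrow> Ck_on k E S g"
  using assms(2)
proof (induction k arbitrary: f g)
  case 0
  then show ?case by (auto cong: continuous_on_cong)
next
  case (Suc k)
  have "f differentiable (at x within S) \<longleftrightarrow> g differentiable (at x within S)" if "x \<in> S" for x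
    using that Suc.prems unfolding differentiable_def
    by (metis has_derivative_transform)
  moreover have "Ck_on k E S (\<lambda>x. dderiv f x v) = Ck_on k E S (\<lambda>x. dderiv g x v)" if "v \<in> E" for v
    by (rule Suc.IH) (rule dderiv_cong[OF assms(1)], use that Suc.prems in auto)
  ultimately show ?case by auto
qed

lemma smooth_on_cong:
  assumes "ropen E S" "\<And>x. x \<in> S \<Longrightarrow> f x = g x"
  shows "smooth_on E S f \<longleftrightarrow> smooth_on E S g"
  unfolding smooth_on_def using Ck_on_cong[OF assms] by auto

lemma Ck_on_Suc_imp: "Ck_on (Suc k) E S f \<Longrightarrow> Ck_on k E S f"
proof (induction k arbitrary: f)
  case 0
  then show ?case
    by (auto simp: continuous_on_eq_continuous_within intro: differentiable_imp_continuous_within)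
next
  case (Suc k)
  then show ?case by (metis Ck_on.simps(2))
qed

lemma Ck_on_subset: "Ck_on k E S f \<Longrightarrow> T \<subseteq> S \<Longrightarrow> Ck_on k E T f"
  by (induction k arbitrary: f) (auto intro: continuous_on_subset differentiable_within_subset)

lemma smooth_on_subset: "smooth_on E S f \<Longrightarrow> T \<subseteq> S \<Longrightarrow> smooth_on E T f"
  by (auto simp: smooth_on_def intro: Ck_on_subset)

lemma smooth_on_dderiv: "smooth_on E S f \<Longrightarrow> v \<in> E \<Longrightarrow> smooth_on E S (\<lambda>x. dderiv f x v)"
  unfolding smooth_on_def by (metis Ck_on.simps(2))

lemma smooth_on_differentiable: "smooth_on E S f \<Longrightarrow> x \<in> S \<Longrightarrow> f differentiable (at x within S)"
  unfolding smooth_on_def by (metis Ck_on.simps(2))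

lemma smooth_on_continuous: "smooth_on E S f \<Longrightarrow> continuous_on S f"
  unfolding smooth_on_def by (metis Ck_on.simps(1))

lemma Ck_on_const [simp]: "Ck_on k E S (\<lambda>_. c)"
  by (induction k arbitrary: c) auto

lemma Ck_on_bounded_linear:
  assumes "bounded_linear L" "ropen E S" "Ck_on k E S f"
  shows "Ck_on k E S (\<lambda>x. L (f x))"
  using assms(3)
proof (induction k arbitrary: f)
  case 0
  then show ?case using assms(1) by (auto intro: bounded_linear.continuous_on)
next
  case (Suc k)
  have "(\<lambda>x. L (f x)) differentiable at x within S" if "x \<in> S" for x
    using that Suc.prems bounded_linear.has_derivative[OF assms(1)] unfolding differentiable_def by (metis Ck_on.simps(2) differentiable_def)
  moreover have "Ck_on k E S (\<lambda>x. dderiv (\<lambda>x. L (f x)) x v)" if "v \<in> E" for v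
    using Suc.IH[of "\<lambda>x. dderiv f x v"] Suc.prems that
    by (subst Ck_on_cong[OF assms(2)]) (auto simp: dderiv_bounded_linear[OF assms(1,2) _ that])
  ultimately show ?case by auto
qed

lemma Ck_on_id: "Ck_on k E S (\<lambda>x. x)"
  by (cases k) (auto intro: continuous_on_id)

lemma Ck_on_add:
  assumes "ropen E S" "Ck_on k E S f" "Ck_on k E S g"
  shows "Ck_on k E S (\<lambda>x. f x + g x)"
  using assms(2,3)
proof (induction k arbitrary: f g)
  case 0
  then show ?case by (auto intro: continuous_on_add)
next
  case (Suc k)
  have "Ck_on k E S (\<lambda>x. dderiv (\<lambda>x. f x + g x) x v)" if "v \<in> E" for v
    using Suc.IH[of "\<lambda>x. dderiv f x v" "\<lambda>x. dderiv g x v"] Suc.prems that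
    by (subst Ck_on_cong[OF assms(1)]) (auto simp: dderiv_add[OF assms(1) _ that])
  thus ?case using Suc.prems by auto
qed

lemma Ck_on_sum:
  assumes "ropen E S" "\<And>i. i \<in> I \<Longrightarrow> Ck_on k E S (f i)"
  shows "Ck_on k E S (\<lambda>x. \<Sum>i\<in>I. f i x)"
  using assms(2)
  by (induction I rule: infinite_finite_induct) (auto intro: Ck_on_add[OF assms(1)])

lemma Ck_on_bilinear:
  assumes "bounded_bilinear prd" "ropen E S" "Ck_on k E S f" "Ck_on k E S g"
  shows "Ck_on k E S (\<lambda>x. prd (f x) (g x))"
  using assms(3,4)
proof (induction k arbitrary: f g)
  case 0
  then show ?case using assms(1) by (auto intro: bounded_bilinear.continuous_on)
next
  case (Suc k)
  note D = dderiv_bilinear[OF assms(1,2)]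
  have "Ck_on k E S (\<lambda>x. dderiv (\<lambda>x. prd (f x) (g x)) x v)" if "v \<in> E" for v
  proof -
    have "Ck_on k E S (\<lambda>x. prd (f x) (dderiv g x v) + prd (dderiv f x v) (g x))"
      using Suc.prems that by (intro Ck_on_add[OF assms(2)] Suc.IH) (auto intro: Ck_on_Suc_imp)
    thus ?thesis
      using D(1)[OF _ that] Suc.prems by (subst Ck_on_cong[OF assms(2)]) auto
  qed
  moreover have "(\<lambda>x. prd (f x) (g x)) differentiable at x within S" if "x \<in> S" for x
    by (rule dderiv_bilinear(2)[OF assms(1,2) that subspace_0]) (use Suc.prems that assms(2) in \<open>auto simp: ropen_def\<close>)
  ultimately show ?case by auto
qed

text \<open>The chain rule gives \<open>dderiv g (f x) (dderiv f x v)\<close>, whose direction moves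
  with \<open>x\<close>, while \<open>Ck_on\<close> controls derivatives of \<open>g\<close> in
  fixed directions only. Expanding the moving direction in \<open>obasis E'\<close> leaves products
  of functions to which the induction hypothesis applies.\<close>

lemma Ck_on_compose:
  fixes f :: "'e::euclidean_space \<Rightarrow> 'f::euclidean_space"
  assumes "ropen E S" "ropen E' T" "f ` S \<subseteq> T" "Ck_on k E S f" "Ck_on k E' T g"
  shows "Ck_on k E S (\<lambda>x. g (f x))"
  using assms(4,5)
proof (induction k arbitrary: g)
  case 0
  then show ?case using assms(3) by (auto intro: continuous_on_compose2)
next
  case (Suc k)
  have E': "subspace E'" using assms(2) by (simp add: ropen_def)
  have "(\<lambda>x. g (f x)) differentiable at x within S" if "x \<in> S" for x
    using differentiable_chain_within[of f x S g] differentiable_within_subset[of g "f x" T "f ` S"] Suc.prems that assms(3)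
    by (auto simp: comp_def)
  moreover have "Ck_on k E S (\<lambda>x. dderiv (\<lambda>x. g (f x)) x v)" if v: "v \<in> E" for v
  proof -
    have "dderiv (\<lambda>x. g (f x)) x v = (\<Sum>b\<in>obasis E'. (dderiv f x v \<bullet> b) *\<^sub>R dderiv g (f x) b)" if x: "x \<in> S" for x
    proof -
      have df: "f differentiable (at x within S)" and dg: "g differentiable (at (f x) within T)"
        using Suc.prems x assms(3) by auto
      obtain L where L: "bounded_linear L" "\<And>v. v \<in> E' \<Longrightarrow> dderiv g (f x) v = L v"
        by (rule dderiv_linear[OF assms(2) _ dg]) (use x assms(3) in auto)
      have 1: "dderiv f x v \<in> E'"
        by (rule dderiv_in_subspace[OF assms(1) x v df E'])
           (use assms(3) ropen_subset[OF assms(2)] in auto)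
      have "dderiv (\<lambda>x. g (f x)) x v = L (dderiv f x v)"
        using dderiv_compose(1)[OF assms(1) x v df assms(2,3) dg] L(2)[OF 1] by simp
      also have "\<dots> = L (\<Sum>b\<in>obasis E'. (dderiv f x v \<bullet> b) *\<^sub>R b)"
        using subspace_expand[OF E' 1] by simp
      also have "\<dots> = (\<Sum>b\<in>obasis E'. (dderiv f x v \<bullet> b) *\<^sub>R L b)"
        using L(1) by (simp add: linear_sum linear_scale bounded_linear.linear)
      finally show ?thesis using L(2) obasis_in[OF E'] by simp
    qed
    moreover have "Ck_on k E S (\<lambda>x. \<Sum>b\<in>obasis E'. (dderiv f x v \<bullet> b) *\<^sub>R dderiv g (f x) b)"
    proof (intro Ck_on_sum[OF assms(1)] Ck_on_bilinear[OF bounded_bilinear_scaleR assms(1)]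
          Ck_on_bilinear[OF bounded_bilinear_inner assms(1)] Ck_on_const)
      show "Ck_on k E S (\<lambda>x. dderiv f x v)" using Suc.prems v by auto
      fix b assume "b \<in> obasis E'"
      thus "Ck_on k E S (\<lambda>x. dderiv g (f x) b)"
        using Suc.prems(2) obasis_in[OF E'] Ck_on_Suc_imp[OF Suc.prems(1)]
        by (intro Suc.IH[where g="\<lambda>y. dderiv g y b"]) auto
    qed
    ultimately show ?thesis by (subst Ck_on_cong[OF assms(1)]) auto
  qed
  ultimately show ?case by auto
qed

lemma smooth_on_const: "smooth_on E S (\<lambda>_. c)"
  by (simp add: smooth_on_def)

lemma smooth_on_id: "smooth_on E S (\<lambda>x. x)"
  by (simp add: smooth_on_def Ck_on_id)

lemma smooth_on_bounded_linear:
  "bounded_linear L \<Longrightarrow> ropen E S \<Longrightarrow> smooth_on E S f \<Longrightarrow> smooth_on E S (\<lambda>x. L (f x))"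
  by (simp add: smooth_on_def Ck_on_bounded_linear)

lemma smooth_on_add: "ropen E S \<Longrightarrow> smooth_on E S f \<Longrightarrow> smooth_on E S g \<Longrightarrow> smooth_on E S (\<lambda>x. f x + g x)"
  by (simp add: smooth_on_def Ck_on_add)

lemma smooth_on_minus: "ropen E S \<Longrightarrow> smooth_on E S f \<Longrightarrow> smooth_on E S (\<lambda>x. - f x)"
  by (rule smooth_on_bounded_linear[OF bounded_linear_minus[OF bounded_linear_ident]])

lemma smooth_on_diff: "ropen E S \<Longrightarrow> smooth_on E S f \<Longrightarrow> smooth_on E S g \<Longrightarrow> smooth_on E S (\<lambda>x. f x - g x)"
  using smooth_on_add[OF _ _ smooth_on_minus, of E S f g] by simp

lemma smooth_on_sum:
  "ropen E S \<Longrightarrow> (\<And>i. i \<in> I \<Longrightarrow> smooth_on E S (f i)) \<Longrightarrow> smooth_on E S (\<lambda>x. \<Sum>i\<in>I. f i x)"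
  by (simp add: smooth_on_def Ck_on_sum)

lemma smooth_on_bilinear:
  "bounded_bilinear prd \<Longrightarrow> ropen E S \<Longrightarrow> smooth_on E S f \<Longrightarrow> smooth_on E S g
     \<Longrightarrow> smooth_on E S (\<lambda>x. prd (f x) (g x))"
  by (simp add: smooth_on_def Ck_on_bilinear)

lemma smooth_on_compose:
  fixes f :: "'e::euclidean_space \<Rightarrow> 'f::euclidean_space"
  shows "ropen E S \<Longrightarrow> ropen E' T \<Longrightarrow> f ` S \<subseteq> T \<Longrightarrow> smooth_on E S f \<Longrightarrow> smooth_on E' T g
     \<Longrightarrow> smooth_on E S (\<lambda>x. g (f x))"
  by (auto simp: smooth_on_def intro: Ck_on_compose)

lemma smooth_on_Pair:
  fixes f :: "'e::euclidean_space \<Rightarrow> 'f::real_normed_vector" and g :: "'e \<Rightarrow> 'g::real_normed_vector"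
  assumes "ropen E S" "smooth_on E S f" "smooth_on E S g"
  shows "smooth_on E S (\<lambda>x. (f x, g x))"
proof -
  have "smooth_on E S (\<lambda>x. (f x, 0) + (0, g x))"
    using assms by (intro smooth_on_add smooth_on_bounded_linear[of "\<lambda>x. (x, 0)"]
        smooth_on_bounded_linear[of "\<lambda>x. (0, x)"] bounded_linear_Pair) auto
  thus ?thesis by simp
qed

subsection \<open>Solutions of smooth linear systems and inverses of smooth maps\<close>

text \<open>The second factor is of order \<open>norm (y - x)\<close> and the first tends to 0, so
  the product is of smaller order than \<open>norm (y - x)\<close>. For \<phi> continuity at
  \<open>x\<close> is all that is asked, which is what is known of a solution before it is shown
  differentiable.\<close>

lemma has_derivative_zero_scaleR:
  fixes \<phi> :: "'e::real_normed_vector \<Rightarrow> real" and \<psi> :: "'e \<Rightarrow> 'f::real_normed_vector"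
  assumes "(\<phi> \<longlongrightarrow> 0) (at x within S)" "(\<psi> has_derivative \<psi>') (at x within S)" "\<phi> x = 0" "\<psi> x = 0"
  shows "((\<lambda>y. \<phi> y *\<^sub>R \<psi> y) has_derivative (\<lambda>_. 0)) (at x within S)"
proof -
  obtain K where K: "\<And>v. norm (\<psi>' v) \<le> norm v * K"
    using assms(2) bounded_linear.bounded unfolding has_derivative_def by blast
  let ?err = "\<lambda>y. norm (\<psi> y - \<psi> x - \<psi>' (y - x)) / norm (y - x)"
  have "(?err \<longlongrightarrow> 0) (at x within S)"
    using assms(2) by (simp add: has_derivative_iff_norm)
  hence "((\<lambda>y. \<bar>\<phi> y\<bar> * (?err y + K)) \<longlongrightarrow> \<bar>0\<bar> * (0 + K)) (at x within S)"
    using assms(1) by (intro tendsto_intros)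
  hence lim: "((\<lambda>y. \<bar>\<phi> y\<bar> * (?err y + K)) \<longlongrightarrow> 0) (at x within S)" by simp
  have "norm (norm (\<phi> y *\<^sub>R \<psi> y) / norm (y - x)) \<le> \<bar>\<phi> y\<bar> * (?err y + K)" if "y \<noteq> x" for y
  proof -
    have "norm (\<psi> y) \<le> norm (\<psi> y - \<psi> x - \<psi>' (y - x)) + norm (\<psi>' (y - x))"
      using norm_triangle_ineq[of "\<psi> y - \<psi> x - \<psi>' (y - x)" "\<psi>' (y - x)"] assms(4) by simp
    also have "\<dots> \<le> norm (\<psi> y - \<psi> x - \<psi>' (y - x)) + norm (y - x) * K" using K by simp
    finally have "norm (\<psi> y) / norm (y - x) \<le> ?err y + K"
      using that by (simp add: field_simps)
    thus ?thesis using mult_left_mono[of _ _ "\<bar>\<phi> y\<bar>"] by fastforce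
  qed
  hence "\<forall>\<^sub>F y in at x within S. norm (norm (\<phi> y *\<^sub>R \<psi> y) / norm (y - x)) \<le> \<bar>\<phi> y\<bar> * (?err y + K)"
    by (simp add: eventually_at_filter)
  from Lim_null_comparison[OF this lim] show ?thesis
    using assms(3) by (simp add: has_derivative_iff_norm)
qed

text \<open>A left inverse of \<open>A x0\<close> on \<open>V\<close> bounds \<open>norm a\<close>
  by a multiple of \<open>norm (A x0 a)\<close>. The bound survives, with twice the constant, for
  \<open>x\<close> near \<open>x0\<close>, because \<open>A x\<close> is close to
  \<open>A x0\<close> on the finitely many basis vectors. It is applied to
  \<open>w x - w x0\<close>, whose image under \<open>A x\<close> is
  \<open>r x - A x (w x0)\<close>.\<close>

lemma linear_solve_continuous:
  fixes A :: "'e::euclidean_space \<Rightarrow> 'f::euclidean_space \<Rightarrow> 'g::euclidean_space"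
  assumes V: "subspace V" and lin: "\<And>x. x \<in> S \<Longrightarrow> linear (A x)"
    and inj: "\<And>x a. x \<in> S \<Longrightarrow> a \<in> V \<Longrightarrow> A x a = 0 \<Longrightarrow> a = 0"
    and contA: "\<And>a. a \<in> V \<Longrightarrow> continuous_on S (\<lambda>x. A x a)" and contr: "continuous_on S r"
    and w: "\<And>x. x \<in> S \<Longrightarrow> w x \<in> V" "\<And>x. x \<in> S \<Longrightarrow> A x (w x) = r x"
  shows "continuous_on S w"
  unfolding continuous_on_def
proof
  fix x0 assume x0: "x0 \<in> S"
  have "inj_on (A x0) V"
    using linear_inj_on_iff_eq_0[OF lin[OF x0] V] inj[OF x0] by auto
  then obtain L where L: "linear L" "\<And>a. a \<in> V \<Longrightarrow> L (A x0 a) = a"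
    using linear_exists_left_inverse_on[OF lin[OF x0] V] by blast
  obtain K where K: "K > 0" "\<And>z. norm (L z) \<le> norm z * K"
    using L(1) by (metis linear_conv_bounded_linear bounded_linear.pos_bounded)
  define d where "d x = (\<Sum>b\<in>obasis V. norm (A x0 b - A x b))" for x
  have "(d \<longlongrightarrow> (\<Sum>b\<in>obasis V. norm (A x0 b - A x0 b))) (at x0 within S)"
    unfolding d_def using contA obasis_in[OF V] x0
    by (intro tendsto_intros) (auto simp: continuous_on_def)
  hence "(d \<longlongrightarrow> 0) (at x0 within S)" by simp
  \<comment> \<open>\<open>d x\<close> bounds the distance of \<open>A x\<close> and
    \<open>A x0\<close> as operators on \<open>V\<close>; below this threshold the perturbation
    costs at most half of \<open>norm a\<close>, which is absorbed on the left.\<close>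
  hence d: "\<forall>\<^sub>F x in at x0 within S. d x < 1 / (2 * K)"
    using K(1) by (auto intro: order_tendstoD)
  have bound: "norm a \<le> 2 * K * norm (A x a)" if "x \<in> S" "a \<in> V" "d x < 1 / (2 * K)" for x a
  proof -
    have "A x0 a - A x a = (\<Sum>b\<in>obasis V. (a \<bullet> b) *\<^sub>R (A x0 b - A x b))"
    proof -
      have "A y a = (\<Sum>b\<in>obasis V. (a \<bullet> b) *\<^sub>R A y b)" if "y \<in> S" for y
        using linear_sum[OF lin[OF that], of "\<lambda>b. (a \<bullet> b) *\<^sub>R b" "obasis V"] subspace_expand[OF V \<open>a \<in> V\<close>]
          linear_scale[OF lin[OF that]] by simp
      thus ?thesis using that x0 by (simp add: sum_subtractf scaleR_diff_right)
    qed
    also have "norm \<dots> \<le> (\<Sum>b\<in>obasis V. norm a * norm (A x0 b - A x b))"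
    proof (rule sum_norm_le)
      fix b assume "b \<in> obasis V"
      hence "\<bar>a \<bullet> b\<bar> \<le> norm a" using Cauchy_Schwarz_ineq2[of a b] obasis(3)[OF V] by simp
      thus "norm ((a \<bullet> b) *\<^sub>R (A x0 b - A x b)) \<le> norm a * norm (A x0 b - A x b)"
        by (simp add: mult_right_mono)
    qed
    also have "\<dots> = norm a * d x" by (simp add: d_def sum_distrib_left)
    finally have 1: "norm (A x0 a - A x a) \<le> norm a * d x" .
    have "norm a = norm (L (A x0 a))" using L that by simp
    also have "\<dots> \<le> norm (A x0 a) * K" by (rule K)
    also have "\<dots> \<le> (norm (A x a) + norm a * d x) * K"
      using 1 norm_triangle_ineq[of "A x0 a - A x a" "A x a"] K(1) by (intro mult_right_mono) auto
    also have "\<dots> \<le> (norm (A x a) + norm a * (1 / (2 * K))) * K"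
      using that K(1) by (intro mult_right_mono add_left_mono mult_left_mono) auto
    also have "\<dots> = K * norm (A x a) + norm a / 2" using K(1) by (simp add: field_simps)
    finally show ?thesis by simp
  qed
  have "((\<lambda>x. 2 * K * norm (r x - A x (w x0))) \<longlongrightarrow> 2 * K * norm (r x0 - A x0 (w x0))) (at x0 within S)"
    using contA[OF w(1)[OF x0]] contr x0
    by (intro tendsto_intros) (auto simp: continuous_on_def)
  hence "((\<lambda>x. 2 * K * norm (r x - A x (w x0))) \<longlongrightarrow> 0) (at x0 within S)" using w x0 by simp
  moreover have "\<forall>\<^sub>F x in at x0 within S. x \<in> S" by (simp add: eventually_at_filter)
  with d have "\<forall>\<^sub>F x in at x0 within S. norm (w x - w x0) \<le> 2 * K * norm (r x - A x (w x0))"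
  proof eventually_elim
    case (elim x)
    have "norm (w x - w x0) \<le> 2 * K * norm (A x (w x - w x0))"
      by (rule bound) (use elim w x0 V in \<open>auto intro: subspace_diff\<close>)
    thus ?case using linear_diff[OF lin[OF elim(2)]] w elim by simp
  qed
  ultimately have "((\<lambda>x. w x - w x0) \<longlongrightarrow> 0) (at x0 within S)"
    by (rule Lim_null_comparison[rotated])
  thus "(w \<longlongrightarrow> w x0) (at x0 within S)" by (simp add: LIM_zero_iff)
qed

text \<open>With \<open>h x\<close> equal to \<open>A x - A x0\<close> applied to
  \<open>w x - w x0\<close>, the system reads
  \<open>A x0 (w x - w x0) = r x - A x (w x0) - h x\<close>. By continuity of \<open>w\<close> alone
  \<open>h\<close> has derivative 0 at \<open>x0\<close>, and a left inverse of \<open>A x0\<close>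
  gives \<open>w\<close>.\<close>

lemma linear_solve_differentiable:
  fixes A :: "'e::euclidean_space \<Rightarrow> 'f::euclidean_space \<Rightarrow> 'g::euclidean_space"
  assumes V: "subspace V" and lin: "\<And>x. x \<in> S \<Longrightarrow> linear (A x)"
    and inj: "\<And>x a. x \<in> S \<Longrightarrow> a \<in> V \<Longrightarrow> A x a = 0 \<Longrightarrow> a = 0"
    and dA: "\<And>a x. a \<in> V \<Longrightarrow> x \<in> S \<Longrightarrow> (\<lambda>x. A x a) differentiable (at x within S)"
    and dr: "\<And>x. x \<in> S \<Longrightarrow> r differentiable (at x within S)"
    and w: "\<And>x. x \<in> S \<Longrightarrow> w x \<in> V" "\<And>x. x \<in> S \<Longrightarrow> A x (w x) = r x"
    and x0: "x0 \<in> S"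
  shows "w differentiable (at x0 within S)"
proof -
  have "continuous_on S w"
    by (rule linear_solve_continuous[where r=r, OF V lin inj])
       (use w dA dr in \<open>auto simp: continuous_on_eq_continuous_within intro: differentiable_imp_continuous_within\<close>)
  hence cw: "(w \<longlongrightarrow> w x0) (at x0 within S)" using x0 by (simp add: continuous_on_def)
  have "inj_on (A x0) V"
    using linear_inj_on_iff_eq_0[OF lin[OF x0] V] inj[OF x0] by auto
  then obtain L where L: "linear L" "\<And>a. a \<in> V \<Longrightarrow> L (A x0 a) = a"
    using linear_exists_left_inverse_on[OF lin[OF x0] V] by blast
  have "bounded_linear L" using L(1) by (simp add: linear_conv_bounded_linear)
  define h where "h x = (\<Sum>b\<in>obasis V. ((w x - w x0) \<bullet> b) *\<^sub>R (A x b - A x0 b))" for x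
  have "h differentiable (at x0 within S)"
  proof -
    have "((\<lambda>x. ((w x - w x0) \<bullet> b) *\<^sub>R (A x b - A x0 b)) has_derivative (\<lambda>_. 0)) (at x0 within S)"
      if b: "b \<in> obasis V" for b
    proof -
      obtain D where "((\<lambda>x. A x b) has_derivative D) (at x0 within S)"
        using dA[OF obasis_in[OF V b] x0] by (auto simp: differentiable_def)
      hence "((\<lambda>x. A x b - A x0 b) has_derivative (\<lambda>v. D v - 0)) (at x0 within S)"
        by (intro has_derivative_diff has_derivative_const)
      moreover have "((\<lambda>x. (w x - w x0) \<bullet> b) \<longlongrightarrow> (w x0 - w x0) \<bullet> b) (at x0 within S)"
        by (intro tendsto_intros cw)
      ultimately show ?thesis by (intro has_derivative_zero_scaleR) auto
    qed
    from has_derivative_sum[OF this] show ?thesis unfolding h_def by (rule differentiableI)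
  qed
  moreover have "(\<lambda>x. r x - A x (w x0)) differentiable (at x0 within S)"
    using dr dA w x0 by (intro differentiable_diff) auto
  ultimately have "(\<lambda>x. r x - A x (w x0) - h x) differentiable (at x0 within S)"
    by (rule differentiable_diff[rotated])
  hence "(\<lambda>x. w x0 + L (r x - A x (w x0) - h x)) differentiable (at x0 within S)"
    using bounded_linear.has_derivative[OF \<open>bounded_linear L\<close>]
    by (intro differentiable_add differentiable_const) (auto simp: differentiable_def)
  then obtain D where D: "((\<lambda>x. w x0 + L (r x - A x (w x0) - h x)) has_derivative D) (at x0 within S)"
    by (auto simp: differentiable_def)
  have "w x0 + L (r x - A x (w x0) - h x) = w x" if "x \<in> S" for x
  proof -
    have wV: "w x - w x0 \<in> V" using w that x0 V by (auto intro: subspace_diff)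
    have exp: "A y (w x - w x0) = (\<Sum>b\<in>obasis V. ((w x - w x0) \<bullet> b) *\<^sub>R A y b)" if "y \<in> S" for y
      using linear_sum[OF lin[OF that], of "\<lambda>b. ((w x - w x0) \<bullet> b) *\<^sub>R b" "obasis V"] subspace_expand[OF V wV]
          linear_scale[OF lin[OF that]] by simp
    have "h x = A x (w x - w x0) - A x0 (w x - w x0)"
      unfolding h_def exp[OF that] exp[OF x0] by (simp add: scaleR_diff_right sum_subtractf)
    hence "r x - A x (w x0) - h x = A x0 (w x - w x0)"
      using linear_diff[OF lin[OF that]] w(2)[OF that] by simp
    thus ?thesis using L(2)[OF wV] by simp
  qed
  hence "(w has_derivative D) (at x0 within S)"
    by (intro has_derivative_transform[OF x0 _ D]) simp
  thus ?thesis by (rule differentiableI)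
qed

text \<open>Differentiating the system in a fixed direction shows that \<open>dderiv w\<close>
  solves a system with the same \<open>A\<close> and another right-hand side, so the induction is
  over \<open>r\<close> and \<open>w\<close>.\<close>

lemma linear_solve_Ck:
  fixes A :: "'e::euclidean_space \<Rightarrow> 'f::euclidean_space \<Rightarrow> 'g::euclidean_space"
  assumes S: "ropen E S" and V: "subspace V" and lin: "\<And>x. x \<in> S \<Longrightarrow> linear (A x)"
    and inj: "\<And>x a. x \<in> S \<Longrightarrow> a \<in> V \<Longrightarrow> A x a = 0 \<Longrightarrow> a = 0"
    and A: "\<And>a. a \<in> V \<Longrightarrow> Ck_on k E S (\<lambda>x. A x a)" and r: "Ck_on k E S r"
    and w: "\<And>x. x \<in> S \<Longrightarrow> w x \<in> V" "\<And>x. x \<in> S \<Longrightarrow> A x (w x) = r x"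
  shows "Ck_on k E S w"
  using A r w
proof (induction k arbitrary: r w)
  case 0
  show ?case unfolding Ck_on.simps
    by (rule linear_solve_continuous[where A=A and r=r, OF V lin inj]) (use 0 in auto)
next
  case (Suc k)
  have dA: "(\<lambda>x. A x a) differentiable (at x within S)" if "a \<in> V" "x \<in> S" for a x
    using Suc.prems(1) that by auto
  have dr: "r differentiable (at x within S)" if "x \<in> S" for x using Suc.prems(2) that by auto
  have dw: "w differentiable (at x within S)" if "x \<in> S" for x
    by (rule linear_solve_differentiable[OF V lin inj dA dr Suc.prems(3,4) that])
  have "Ck_on k E S w" by (rule Suc.IH) (use Suc.prems in \<open>auto intro: Ck_on_Suc_imp\<close>)
  have "Ck_on k E S (\<lambda>x. dderiv w x v)" if v: "v \<in> E" for v
  proof (rule Suc.IH)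
    \<comment> \<open>The derivative of \<open>r\<close> minus the derivative of \<open>A\<close>
      applied to \<open>w\<close>; the latter is expanded in the basis, since smoothness of
      \<open>A\<close> is assumed for constant arguments only.\<close>
    define r' where "r' x = dderiv r x v + (\<Sum>b\<in>obasis V. (w x \<bullet> b) *\<^sub>R - dderiv (\<lambda>x. A x b) x v)" for x
    show "Ck_on k E S r'" unfolding r'_def
      using Suc.prems(1,2) v obasis_in[OF V] \<open>Ck_on k E S w\<close>
      by (intro Ck_on_add[OF S] Ck_on_sum[OF S] Ck_on_bilinear[OF bounded_bilinear_scaleR S]
        Ck_on_bilinear[OF bounded_bilinear_inner S] Ck_on_const
        Ck_on_bounded_linear[OF bounded_linear_minus[OF bounded_linear_ident] S]) auto
    show "dderiv w x v \<in> V" if "x \<in> S" for x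
      by (rule dderiv_in_subspace[OF S that v dw[OF that] V Suc.prems(3)])
    show "A x (dderiv w x v) = r' x" if x: "x \<in> S" for x
    proof -
      have exp: "A y a = (\<Sum>b\<in>obasis V. (a \<bullet> b) *\<^sub>R A y b)" if "y \<in> S" "a \<in> V" for y a
        using linear_sum[OF lin[OF that(1)], of "\<lambda>b. (a \<bullet> b) *\<^sub>R b" "obasis V"] subspace_expand[OF V that(2)]
          linear_scale[OF lin[OF that(1)]] by simp
      have sub: "subspace E" using S by (simp add: ropen_def)
      have "((\<lambda>y. \<Sum>b\<in>obasis V. (w y \<bullet> b) *\<^sub>R A y b) has_derivative
         (\<lambda>u. \<Sum>b\<in>obasis V. (w x \<bullet> b) *\<^sub>R dderiv (\<lambda>x. A x b) x (proj E u) + (dderiv w x (proj E u) \<bullet> b) *\<^sub>R A x b))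
         (at x within S)"
        using differentiable_dderiv[OF S x dw[OF x]] differentiable_dderiv[OF S x dA[OF _ x]] obasis_in[OF V]
        by (intro has_derivative_sum has_derivative_scaleR has_derivative_inner_left) auto
      from has_derivative_dderiv(2)[OF S x v this]
      have "dderiv (\<lambda>y. \<Sum>b\<in>obasis V. (w y \<bullet> b) *\<^sub>R A y b) x v =
        (\<Sum>b\<in>obasis V. (w x \<bullet> b) *\<^sub>R dderiv (\<lambda>x. A x b) x v) + (\<Sum>b\<in>obasis V. (dderiv w x v \<bullet> b) *\<^sub>R A x b)"
        using proj_id[OF sub v] by (simp add: sum.distrib)
      moreover have "dderiv (\<lambda>y. \<Sum>b\<in>obasis V. (w y \<bullet> b) *\<^sub>R A y b) x v = dderiv r x v"
        by (rule dderiv_cong[OF S x v]) (use exp Suc.prems(3,4) in auto)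
      moreover have "(\<Sum>b\<in>obasis V. (dderiv w x v \<bullet> b) *\<^sub>R A x b) = A x (dderiv w x v)"
        by (rule exp[OF x, symmetric]) (rule dderiv_in_subspace[OF S x v dw[OF x] V Suc.prems(3)])
      ultimately show ?thesis by (simp add: r'_def sum_negf algebra_simps)
    qed
  qed (use Suc.prems(1) in \<open>auto intro: Ck_on_Suc_imp\<close>)
  thus ?case using dw by auto
qed

lemma linear_solve_smooth:
  fixes A :: "'e::euclidean_space \<Rightarrow> 'f::euclidean_space \<Rightarrow> 'g::euclidean_space"
  assumes "ropen E S" "subspace V" "\<And>x. x \<in> S \<Longrightarrow> linear (A x)"
    and "\<And>x a. x \<in> S \<Longrightarrow> a \<in> V \<Longrightarrow> A x a = 0 \<Longrightarrow> a = 0"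
    and "\<And>a. a \<in> V \<Longrightarrow> smooth_on E S (\<lambda>x. A x a)" "smooth_on E S r"
    and "\<And>x. x \<in> S \<Longrightarrow> w x \<in> V" "\<And>x. x \<in> S \<Longrightarrow> A x (w x) = r x"
  shows "smooth_on E S w"
  unfolding smooth_on_def
proof
  fix k show "Ck_on k E S w"
    by (rule linear_solve_Ck[where A=A and r=r, OF assms(1-4)]) (use assms(5-8) in \<open>auto simp: smooth_on_def\<close>)
qed

text \<open>A continuous right inverse is given, so only its smoothness is at stake. Differentiating
  \<open>\<theta> (\<Psi> y) = y\<close> shows that \<open>dderiv \<Psi> y u\<close> solves the
  linear system with matrix \<open>dderiv \<theta> (\<Psi> y)\<close> and right-hand side
  \<open>u\<close>. If \<Psi> has k continuous derivatives, so have the coefficients, hence the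
  solution by \<open>linear_solve_Ck\<close>.\<close>

lemma smooth_inverse:
  fixes \<theta> :: "'e::euclidean_space \<Rightarrow> 'f::euclidean_space"
  assumes S: "ropen E S" and T: "ropen E' T" and \<theta>: "smooth_on E S \<theta>" "\<theta> ` S \<subseteq> E'"
    and inj: "\<And>x v. x \<in> S \<Longrightarrow> v \<in> E \<Longrightarrow> dderiv \<theta> x v = 0 \<Longrightarrow> v = 0"
    and \<Psi>: "continuous_on T \<Psi>" "\<Psi> ` T \<subseteq> S" "\<And>y. y \<in> T \<Longrightarrow> \<theta> (\<Psi> y) = y"
  shows "smooth_on E' T \<Psi>"
proof -
  have E: "subspace E" and E': "subspace E'" using S T by (simp_all add: ropen_def)
  have d\<theta>: "\<theta> differentiable (at x within S)" if "x \<in> S" for x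
    using \<theta>(1) that by (rule smooth_on_differentiable)
  have lin: "linear (\<lambda>a. dderiv \<theta> x (proj E a))" if "x \<in> S" for x
    using differentiable_dderiv[OF S that d\<theta>[OF that]] has_derivative_linear by blast
  have d\<Psi>: "\<Psi> differentiable (at y0 within T)" if y0: "y0 \<in> T" for y0
  proof -
    define x0 where "x0 = \<Psi> y0"
    have x0: "x0 \<in> S" "\<theta> x0 = y0" using y0 \<Psi> by (auto simp: x0_def)
    define D where "D = (\<lambda>v. dderiv \<theta> x0 (proj E v))"
    have D: "(\<theta> has_derivative D) (at x0 within S)"
      unfolding D_def by (rule differentiable_dderiv[OF S x0(1) d\<theta>[OF x0(1)]])
    have linD: "linear D" unfolding D_def by (rule lin[OF x0(1)])
    have "inj_on D E"
      using linear_inj_on_iff_eq_0[OF linD E] inj[OF x0(1)] proj_id[OF E] by (auto simp: D_def)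
    then obtain L where L: "linear L" "\<And>a. a \<in> E \<Longrightarrow> L (D a) = a"
      using linear_exists_left_inverse_on[OF linD E] by blast
    obtain K where K: "K > 0" "\<And>z. norm (L z) \<le> norm z * K"
      using L(1) by (metis linear_conv_bounded_linear bounded_linear.pos_bounded)
    have "(\<Psi> has_derivative L) (at y0 within T)"
      unfolding has_derivative_within_alt
    proof (intro conjI allI impI)
      show "bounded_linear L" using L(1) by (simp add: linear_conv_bounded_linear)
      fix e :: real assume e: "0 < e"
      \<comment> \<open>The first bound yields
        \<open>norm (x - x0) \<le> 2 * K * norm (y - y0)\<close> by absorbing half of the left side;
        the second then brings the total error below \<open>e * norm (y - y0)\<close>.\<close>
      define \<epsilon> where "\<epsilon> = min (1 / (2 * K)) (e / (2 * K * K))"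
      have \<epsilon>: "\<epsilon> > 0" "K * \<epsilon> \<le> 1 / 2" "K * \<epsilon> * (2 * K) \<le> e"
        using K(1) e by (auto simp: \<epsilon>_def min_def field_simps)
      obtain d where d: "d > 0" "\<And>x. x \<in> S \<Longrightarrow> norm (x - x0) < d \<Longrightarrow>
          norm (\<theta> x - \<theta> x0 - D (x - x0)) \<le> \<epsilon> * norm (x - x0)"
        using D \<epsilon>(1) unfolding has_derivative_within_alt by meson
      obtain d' where d': "d' > 0" "\<And>y. y \<in> T \<Longrightarrow> dist y y0 < d' \<Longrightarrow> dist (\<Psi> y) (\<Psi> y0) < d"
        using \<Psi>(1) y0 d(1) unfolding continuous_on_iff by metis
      show "\<exists>d>0. \<forall>y\<in>T. norm (y - y0) < d \<longrightarrow> norm (\<Psi> y - \<Psi> y0 - L (y - y0)) \<le> e * norm (y - y0)"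
      proof (intro exI conjI ballI impI)
        show "d' > 0" by fact
        fix y assume y: "y \<in> T" "norm (y - y0) < d'"
        define x where "x = \<Psi> y"
        have x: "x \<in> S" "\<theta> x = y" using y \<Psi> by (auto simp: x_def)
        have "norm (x - x0) < d" using d'(2)[OF y(1)] y(2) by (simp add: dist_norm x_def x0_def)
        from d(2)[OF x(1) this] have 1: "norm (y - y0 - D (x - x0)) \<le> \<epsilon> * norm (x - x0)"
          using x x0 by simp
        have xE: "x - x0 \<in> E" using x x0 S E by (auto intro: subspace_diff dest: ropen_subset)
        have "L (y - y0 - D (x - x0)) = L (y - y0) - (x - x0)"
          using linear_diff[OF L(1)] L(2)[OF xE] by simp
        moreover have "norm (L (y - y0 - D (x - x0))) \<le> (\<epsilon> * norm (x - x0)) * K"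
          using mult_right_mono[OF 1, of K] K(1) by (intro order_trans[OF K(2)]) simp
        ultimately have 2: "norm (x - x0 - L (y - y0)) \<le> K * \<epsilon> * norm (x - x0)"
          by (simp add: norm_minus_commute[of "x - x0"] mult_ac)
        have "norm (x - x0) \<le> norm (x - x0 - L (y - y0)) + norm (L (y - y0))"
          by (metis diff_add_cancel norm_triangle_ineq)
        also have "\<dots> \<le> 1 / 2 * norm (x - x0) + norm (y - y0) * K"
          using 2 K(2)[of "y - y0"] mult_right_mono[OF \<epsilon>(2), of "norm (x - x0)"] by simp
        finally have "norm (x - x0) \<le> 2 * K * norm (y - y0)" by (simp add: algebra_simps)
        with 2 have "norm (x - x0 - L (y - y0)) \<le> K * \<epsilon> * (2 * K * norm (y - y0))"
          using K(1) \<epsilon>(1) by (smt (verit) mult_left_mono mult_nonneg_nonneg)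
        also have "\<dots> \<le> e * norm (y - y0)"
          using mult_right_mono[OF \<epsilon>(3), of "norm (y - y0)"] by (simp add: mult.assoc)
        finally show "norm (\<Psi> y - \<Psi> y0 - L (y - y0)) \<le> e * norm (y - y0)"
          by (simp add: x_def x0_def)
      qed
    qed
    thus ?thesis by (auto simp: differentiable_def)
  qed
  have "Ck_on k E' T \<Psi>" for k
  proof (induction k)
    case 0
    then show ?case using \<Psi>(1) by simp
  next
    case (Suc k)
    have "Ck_on k E' T (\<lambda>y. dderiv \<Psi> y u)" if u: "u \<in> E'" for u
    proof (rule linear_solve_Ck[where A="\<lambda>y a. dderiv \<theta> (\<Psi> y) (proj E a)" and r="\<lambda>_. u", OF T E])
      show "Ck_on k E' T (\<lambda>_. u)" by simp
      show "linear (\<lambda>a. dderiv \<theta> (\<Psi> y) (proj E a))" if "y \<in> T" for y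
        by (rule lin) (use that \<Psi>(2) in auto)
      show "a = 0" if "y \<in> T" "a \<in> E" "dderiv \<theta> (\<Psi> y) (proj E a) = 0" for y a
        by (rule inj[of "\<Psi> y"]) (use that \<Psi>(2) proj_id[OF E] in auto)
      show "Ck_on k E' T (\<lambda>y. dderiv \<theta> (\<Psi> y) (proj E a))" if "a \<in> E" for a
        using smooth_on_dderiv[OF \<theta>(1) proj_in[OF E]]
        by (intro Ck_on_compose[OF T S \<Psi>(2) Suc.IH]) (auto simp: smooth_on_def)
      fix y assume y: "y \<in> T"
      have \<Psi>y: "\<Psi> y \<in> S" using y \<Psi>(2) by auto
      show 1: "dderiv \<Psi> y u \<in> E"
        by (rule dderiv_in_subspace[OF T y u d\<Psi>[OF y] E]) (use \<Psi>(2) ropen_subset[OF S] in auto)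
      have "dderiv \<theta> (\<Psi> y) (dderiv \<Psi> y u) = dderiv (\<lambda>y. \<theta> (\<Psi> y)) y u"
        by (rule dderiv_compose(1)[OF T y u d\<Psi>[OF y] S \<Psi>(2) d\<theta>[OF \<Psi>y], symmetric])
      also have "\<dots> = dderiv (\<lambda>y. y) y u" by (rule dderiv_cong[OF T y u]) (rule \<Psi>(3))
      finally show "dderiv \<theta> (\<Psi> y) (proj E (dderiv \<Psi> y u)) = u" using proj_id[OF E 1] by simp
    qed
    thus ?case using d\<Psi> by auto
  qed
  thus ?thesis by (simp add: smooth_on_def)
qed

subsection \<open>Symmetry of second derivatives\<close>

text \<open>Mean value theorem twice: along \<open>a\<close> for the increment in direction
  \<open>b\<close>, then along \<open>b\<close> for the derivative in direction \<open>a\<close>.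
  The left side of the equation is symmetric in \<open>a\<close> and \<open>b\<close>, which is the
  point.\<close>

lemma second_difference:
  fixes f :: "'e::euclidean_space \<Rightarrow> real"
  assumes S: "ropen E S" and ab: "a \<in> E" "b \<in> E" and f: "Ck_on 2 E S f" and s: "0 < s"
    and box: "\<And>\<xi> \<eta>. 0 \<le> \<xi> \<Longrightarrow> \<xi> \<le> s \<Longrightarrow> 0 \<le> \<eta> \<Longrightarrow> \<eta> \<le> s \<Longrightarrow> x + \<xi> *\<^sub>R a + \<eta> *\<^sub>R b \<in> S"
  shows "\<exists>\<xi> \<eta>. 0 < \<xi> \<and> \<xi> < s \<and> 0 < \<eta> \<and> \<eta> < s \<and>
    f (x + s *\<^sub>R a + s *\<^sub>R b) - f (x + s *\<^sub>R a) - f (x + s *\<^sub>R b) + f x =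
    s * s * dderiv (\<lambda>y. dderiv f y a) (x + \<xi> *\<^sub>R a + \<eta> *\<^sub>R b) b"
proof -
  have f2: "Ck_on (Suc (Suc 0)) E S f" using f by (simp add: numeral_2_eq_2)
  have df: "f differentiable (at y within S)" "(\<lambda>y. dderiv f y a) differentiable (at y within S)" if "y \<in> S" for y
    using f2 that ab by auto
  have line: "((\<lambda>u. h (z + u *\<^sub>R v)) has_real_derivative dderiv h (z + u *\<^sub>R v) v) (at u)"
    if "v \<in> E" "z + u *\<^sub>R v \<in> S" "h differentiable (at (z + u *\<^sub>R v) within S)" for h :: "'e \<Rightarrow> real" and z u v
  proof -
    have *: "((\<lambda>t. h (z + u *\<^sub>R v + t *\<^sub>R v)) has_vector_derivative dderiv h (z + u *\<^sub>R v) v) (at 0)"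
      by (rule dderiv_line[OF S that(2,1,3)])
    have "((\<lambda>t. h (z + (0 + u) *\<^sub>R v + (t - u) *\<^sub>R v)) has_vector_derivative 1 *\<^sub>R dderiv h (z + u *\<^sub>R v) v) (at u)"
      using vector_diff_chain_at[of "\<lambda>t. t - u" 1 u "\<lambda>t. h (z + u *\<^sub>R v + t *\<^sub>R v)"] *
      by (auto simp: comp_def has_vector_derivative_diff_const intro!: derivative_eq_intros)
    thus ?thesis by (simp add: has_real_derivative_iff_has_vector_derivative algebra_simps)
  qed
  define \<phi> where "\<phi> u = f (x + s *\<^sub>R b + u *\<^sub>R a) - f (x + u *\<^sub>R a)" for u
  have "\<exists>\<xi>. 0 < \<xi> \<and> \<xi> < s \<and> \<phi> s - \<phi> 0 = (s - 0) * (dderiv f (x + s *\<^sub>R b + \<xi> *\<^sub>R a) a - dderiv f (x + \<xi> *\<^sub>R a) a)"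
  proof (rule MVT2[OF s])
    fix u assume u: "0 \<le> u" "u \<le> s"
    have "x + s *\<^sub>R b + u *\<^sub>R a \<in> S" "x + u *\<^sub>R a \<in> S"
      using box[of u s] box[of u 0] u s by (auto simp: algebra_simps)
    thus "(\<phi> has_real_derivative (dderiv f (x + s *\<^sub>R b + u *\<^sub>R a) a - dderiv f (x + u *\<^sub>R a) a)) (at u)"
      unfolding \<phi>_def by (intro DERIV_diff line ab df)
  qed
  then obtain \<xi> where \<xi>: "0 < \<xi>" "\<xi> < s"
    "\<phi> s - \<phi> 0 = s * (dderiv f (x + s *\<^sub>R b + \<xi> *\<^sub>R a) a - dderiv f (x + \<xi> *\<^sub>R a) a)" by auto
  have "\<exists>\<eta>. 0 < \<eta> \<and> \<eta> < s \<and> dderiv f (x + \<xi> *\<^sub>R a + s *\<^sub>R b) a - dderiv f (x + \<xi> *\<^sub>R a + 0 *\<^sub>R b) a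
      = (s - 0) * dderiv (\<lambda>y. dderiv f y a) (x + \<xi> *\<^sub>R a + \<eta> *\<^sub>R b) b"
    by (rule MVT2[OF s, of "\<lambda>\<eta>. dderiv f (x + \<xi> *\<^sub>R a + \<eta> *\<^sub>R b) a"])
       (use box \<xi> ab df in \<open>auto intro!: line[where h="\<lambda>y. dderiv f y a"]\<close>)
  then obtain \<eta> where \<eta>: "0 < \<eta>" "\<eta> < s" "dderiv f (x + \<xi> *\<^sub>R a + s *\<^sub>R b) a - dderiv f (x + \<xi> *\<^sub>R a) a
      = s * dderiv (\<lambda>y. dderiv f y a) (x + \<xi> *\<^sub>R a + \<eta> *\<^sub>R b) b" by auto
  show ?thesis
    using \<xi> \<eta> by (intro exI[of _ \<xi>] exI[of _ \<eta>]) (auto simp: \<phi>_def algebra_simps)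
qed

text \<open>Evaluating the symmetric second difference in both orders shows that the two mixed
  derivatives agree at two points arbitrarily close to \<open>x\<close>; continuity carries this to
  \<open>x\<close>.\<close>

lemma dderiv_commute_real:
  fixes f :: "'e::euclidean_space \<Rightarrow> real"
  assumes S: "ropen E S" and ab: "a \<in> E" "b \<in> E" and f: "Ck_on 2 E S f" and x: "x \<in> S"
  shows "dderiv (\<lambda>y. dderiv f y a) x b = dderiv (\<lambda>y. dderiv f y b) x a"
proof -
  have f2: "Ck_on (Suc (Suc 0)) E S f" using f by (simp add: numeral_2_eq_2)
  let ?g = "\<lambda>y. dderiv (\<lambda>y. dderiv f y a) y b" and ?h = "\<lambda>y. dderiv (\<lambda>y. dderiv f y b) y a"
  have cont: "continuous_on S ?g" "continuous_on S ?h" using f2 ab by auto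
  have "\<bar>?g x - ?h x\<bar> \<le> e" if e: "e > 0" for e
  proof -
    obtain d1 where d1: "d1 > 0" "\<And>y. y \<in> S \<Longrightarrow> dist y x < d1 \<Longrightarrow> dist (?g y) (?g x) < e / 2"
      using cont(1) x e unfolding continuous_on_iff by (metis half_gt_zero)
    obtain d2 where d2: "d2 > 0" "\<And>y. y \<in> S \<Longrightarrow> dist y x < d2 \<Longrightarrow> dist (?h y) (?h x) < e / 2"
      using cont(2) x e unfolding continuous_on_iff by (metis half_gt_zero)
    obtain U where U: "open U" "S = E \<inter> U" using S by (auto simp: ropen_def openin_open)
    obtain d3 where d3: "d3 > 0" "ball x d3 \<subseteq> U" using U x by (auto elim: openE)
    define d where "d = min d1 (min d2 d3)"
    \<comment> \<open>Keeps the parallelogram with sides \<open>s *\<^sub>R a\<close> and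
      \<open>s *\<^sub>R b\<close> within distance \<open>d\<close> of \<open>x\<close>; the summand
      1 covers \<open>a = b = 0\<close>.\<close>
    define s where "s = d / (2 * (norm a + norm b + 1))"
    have "0 < norm a + norm b + 1" by (smt (verit) norm_ge_zero)
    hence s: "s > 0"
      and "d > 0" using d1 d2 d3 by (auto simp: s_def d_def)
    have "s * (norm a + norm b) < s * (norm a + norm b + 1) * 2" using s by (simp add: algebra_simps add_strict_increasing2 add_nonneg_pos)
    also have "\<dots> = d" using \<open>0 < norm a + norm b + 1\<close> by (simp add: s_def field_simps)
    finally have s2: "s * (norm a + norm b) < d" .
    have near: "dist (x + \<xi> *\<^sub>R a + \<eta> *\<^sub>R b) x < d" if "0 \<le> \<xi>" "\<xi> \<le> s" "0 \<le> \<eta>" "\<eta> \<le> s" for \<xi> \<eta>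
    proof -
      have "dist (x + \<xi> *\<^sub>R a + \<eta> *\<^sub>R b) x = norm (\<xi> *\<^sub>R a + \<eta> *\<^sub>R b)" by (simp add: dist_norm)
      also have "\<dots> \<le> \<xi> * norm a + \<eta> * norm b"
        using norm_triangle_ineq[of "\<xi> *\<^sub>R a" "\<eta> *\<^sub>R b"] that by simp
      also have "\<dots> \<le> s * norm a + s * norm b" using that by (intro add_mono mult_right_mono) auto
      also have "\<dots> < d" using s2 by (simp add: distrib_left)
      finally show ?thesis .
    qed
    have inS: "x + \<xi> *\<^sub>R a + \<eta> *\<^sub>R b \<in> S" if "0 \<le> \<xi>" "\<xi> \<le> s" "0 \<le> \<eta>" "\<eta> \<le> s" for \<xi> \<eta>
    proof -
      have "x + \<xi> *\<^sub>R a + \<eta> *\<^sub>R b \<in> E"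
        using S x ab ropen_subset[OF S x] by (auto simp: ropen_def intro!: subspace_add subspace_scale)
      moreover have "x + \<xi> *\<^sub>R a + \<eta> *\<^sub>R b \<in> U"
        using near[OF that] d3(2) by (auto simp: d_def dist_commute)
      ultimately show ?thesis using U by simp
    qed
    obtain \<xi> \<eta> where 1: "0 < \<xi>" "\<xi> < s" "0 < \<eta>" "\<eta> < s"
      "f (x + s *\<^sub>R a + s *\<^sub>R b) - f (x + s *\<^sub>R a) - f (x + s *\<^sub>R b) + f x = s * s * ?g (x + \<xi> *\<^sub>R a + \<eta> *\<^sub>R b)"
      using second_difference[OF S ab f s(1) inS] by blast
    have inS': "x + \<eta> *\<^sub>R b + \<xi> *\<^sub>R a \<in> S" if "0 \<le> \<xi>" "\<xi> \<le> s" "0 \<le> \<eta>" "\<eta> \<le> s" for \<xi> \<eta>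
      using inS[OF that] by (simp add: algebra_simps)
    obtain \<eta>' \<xi>' where 2: "0 < \<eta>'" "\<eta>' < s" "0 < \<xi>'" "\<xi>' < s"
      "f (x + s *\<^sub>R b + s *\<^sub>R a) - f (x + s *\<^sub>R b) - f (x + s *\<^sub>R a) + f x = s * s * ?h (x + \<eta>' *\<^sub>R b + \<xi>' *\<^sub>R a)"
      using second_difference[OF S ab(2,1) f s(1) inS'] by blast
    have 3: "x + \<eta>' *\<^sub>R b + \<xi>' *\<^sub>R a = x + \<xi>' *\<^sub>R a + \<eta>' *\<^sub>R b" by simp
    have "f (x + s *\<^sub>R b + s *\<^sub>R a) = f (x + s *\<^sub>R a + s *\<^sub>R b)" by (simp add: algebra_simps)
    with 1(5) 2(5) have "s * s * ?g (x + \<xi> *\<^sub>R a + \<eta> *\<^sub>R b) = s * s * ?h (x + \<xi>' *\<^sub>R a + \<eta>' *\<^sub>R b)"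
      unfolding 3 by linarith
    hence eq: "?g (x + \<xi> *\<^sub>R a + \<eta> *\<^sub>R b) = ?h (x + \<xi>' *\<^sub>R a + \<eta>' *\<^sub>R b)" using s(1) by simp
    have "dist (?g (x + \<xi> *\<^sub>R a + \<eta> *\<^sub>R b)) (?g x) < e / 2"
      using near[of \<xi> \<eta>] 1(1-4) by (intro d1 inS) (auto simp: d_def)
    moreover have "dist (?h (x + \<xi>' *\<^sub>R a + \<eta>' *\<^sub>R b)) (?h x) < e / 2"
      using near[of \<xi>' \<eta>'] 2(1-4) by (intro d2 inS) (auto simp: d_def)
    ultimately show ?thesis unfolding eq dist_real_def by (smt (verit) field_sum_of_halves)
  qed
  thus ?thesis using dense_ge[of 0 "\<bar>?g x - ?h x\<bar>"] by fastforce
qed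

lemma dderiv_commute:
  fixes f :: "'e::euclidean_space \<Rightarrow> 'f::euclidean_space"
  assumes S: "ropen E S" and ab: "a \<in> E" "b \<in> E" and f: "smooth_on E S f" and x: "x \<in> S"
  shows "dderiv (\<lambda>y. dderiv f y a) x b = dderiv (\<lambda>y. dderiv f y b) x a"
proof (rule euclidean_eqI)
  fix i :: 'f assume "i \<in> Basis"
  have L: "bounded_linear (\<lambda>z::'f. z \<bullet> i)" by (rule bounded_linear_inner_left)
  have 1: "dderiv (\<lambda>y. f y \<bullet> i) y c = dderiv f y c \<bullet> i" if "y \<in> S" "c \<in> E" for y c
    using dderiv_bounded_linear[OF L S that smooth_on_differentiable[OF f that(1)]] .
  have 2: "dderiv (\<lambda>y. dderiv (\<lambda>y. f y \<bullet> i) y c) x d = dderiv (\<lambda>y. dderiv f y c) x d \<bullet> i" if "c \<in> E" "d \<in> E" for c d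
    using dderiv_cong[OF S x that(2) 1[OF _ that(1)]]
      dderiv_bounded_linear[OF L S x that(2) smooth_on_differentiable[OF smooth_on_dderiv[OF f that(1)] x]] by simp
  have "Ck_on 2 E S (\<lambda>y. f y \<bullet> i)"
    using smooth_on_bounded_linear[OF L S f] by (simp add: smooth_on_def)
  from dderiv_commute_real[OF S ab this x] 2[OF ab] 2[OF ab(2,1)]
  show "dderiv (\<lambda>y. dderiv f y a) x b \<bullet> i = dderiv (\<lambda>y. dderiv f y b) x a \<bullet> i" by simp
qed

subsection \<open>Local inverses\<close>

text \<open>The inverse function theorem wants an open subset of the whole space. The map
  \<open>t\<close> extends \<theta> by the identity in the directions orthogonal to
  \<open>E\<close>, so its derivative at \<open>x0\<close> is the identity, and its local inverse is
  restricted to \<open>E\<close> again. Smoothness of that inverse comes from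
  \<open>smooth_inverse\<close>.\<close>

lemma local_inverse:
  fixes \<theta> :: "'e::euclidean_space \<Rightarrow> 'e"
  assumes S: "ropen E S" and x0: "x0 \<in> S" and \<theta>: "smooth_on E S \<theta>" "\<theta> ` S \<subseteq> E"
    and id: "\<And>v. v \<in> E \<Longrightarrow> dderiv \<theta> x0 v = v"
  obtains U V \<Psi> where "ropen E U" "U \<subseteq> S" "x0 \<in> U" "ropen E V" "homeomorphism U V \<theta> \<Psi>"
    "smooth_on E V \<Psi>" "\<And>x v. x \<in> U \<Longrightarrow> v \<in> E \<Longrightarrow> dderiv \<theta> x v = 0 \<Longrightarrow> v = 0"
proof -
  have E: "subspace E" using S by (simp add: ropen_def)
  have pE [simp]: "proj E v \<in> E" for v by (rule proj_in[OF E])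
  have pid [simp]: "v \<in> E \<Longrightarrow> proj E v = v" for v by (rule proj_id[OF E])
  have lp: "bounded_linear (proj E)" by (rule bounded_linear_proj)
  define S' where "S' = proj E -` S"
  have cp: "continuous_on X (proj E)" for X
    by (rule bounded_linear.continuous_on[OF lp continuous_on_id])
  have "open S'"
    using ropen_preimage[of UNIV UNIV "proj E" E S] S cp pE by (simp add: S'_def image_subset_iff)
  define t where "t x = \<theta> (proj E x) + (x - proj E x)" for x
  define D where "D x v = dderiv \<theta> (proj E x) (proj E v) + (v - proj E v)" for x v
  have tD: "(t has_derivative D x) (at x)" if "x \<in> S'" for x
  proof -
    have px: "proj E x \<in> S" using that by (simp add: S'_def)
    have "(\<theta> has_derivative (\<lambda>v. dderiv \<theta> (proj E x) (proj E v))) (at (proj E x) within S)"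
      by (rule differentiable_dderiv[OF S px smooth_on_differentiable[OF \<theta>(1) px]])
    hence "(\<theta> has_derivative (\<lambda>v. dderiv \<theta> (proj E x) (proj E v))) (at (proj E x) within proj E ` S')"
      by (rule has_derivative_subset) (auto simp: S'_def)
    moreover have "(proj E has_derivative proj E) (at x within S')"
      using lp by (rule bounded_linear_imp_has_derivative)
    ultimately have "(\<theta> \<circ> proj E has_derivative (\<lambda>v. dderiv \<theta> (proj E x) (proj E v)) \<circ> proj E) (at x within S')"
      by (rule diff_chain_within[rotated])
    hence "(\<theta> \<circ> proj E has_derivative (\<lambda>v. dderiv \<theta> (proj E x) (proj E v))) (at x)"
      using at_within_open[OF that \<open>open S'\<close>] by (simp add: comp_def)
    thus ?thesis unfolding t_def D_def comp_def
      by (intro has_derivative_add has_derivative_diff has_derivative_ident bounded_linear_imp_has_derivative lp)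
  qed
  define f' where "f' x = Blinfun (D x)" for x
  have f': "blinfun_apply (f' x) = D x" if "x \<in> S'" for x
    unfolding f'_def using tD[OF that] by (intro bounded_linear_Blinfun_apply) (auto simp: has_derivative_def)
  have contf': "continuous_on S' f'"
  proof (rule continuous_on_blinfun_componentwise)
    fix i :: 'e
    have "continuous_on S' (\<lambda>x. D x i)" unfolding D_def
      by (intro continuous_on_add continuous_on_const continuous_on_compose2[OF smooth_on_continuous[OF smooth_on_dderiv[OF \<theta>(1)]] cp])
         (auto simp: S'_def)
    thus "continuous_on S' (\<lambda>x. f' x i)" using f' by (simp cong: continuous_on_cong)
  qed
  have x0': "x0 \<in> S'" using x0 ropen_subset[OF S x0] by (simp add: S'_def)
  have "f' x0 = id_blinfun"
    by (rule blinfun_eqI) (use f'[OF x0'] id ropen_subset[OF S x0] in \<open>simp add: D_def\<close>)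
  hence inv: "id_blinfun o\<^sub>L f' x0 = id_blinfun" by (auto intro: blinfun_eqI)
  obtain U' V' g g' where g: "open U'" "U' \<subseteq> S'" "x0 \<in> U'" "open V'" "t x0 \<in> V'" "homeomorphism U' V' t g"
    "\<And>y. y \<in> V' \<Longrightarrow> (g has_derivative (g' y)) (at y)"
    "\<And>y. y \<in> V' \<Longrightarrow> bij (blinfun_apply (f' (g y)))"
    using inverse_function_theorem[OF \<open>open S'\<close> _ contf' x0' inv, of t] tD f' by (metis (no_types, lifting))
  define U where "U = E \<inter> U'"
  define V where "V = E \<inter> V'"
  have U: "ropen E U" and V: "ropen E V" using g E by (auto simp: U_def V_def ropen_def openin_open)
  have US: "U \<subseteq> S" using g(2) by (auto simp: U_def S'_def)
  have teq: "t x = \<theta> x" if "x \<in> E" for x using that by (simp add: t_def)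
  \<comment> \<open>Ensures that the inverse of \<open>t\<close> maps \<open>E\<close> into
    \<open>E\<close>: since \<theta> takes values in \<open>E\<close>, the component of
    \<open>x\<close> orthogonal to \<open>E\<close> lies in \<open>E\<close> once \<open>t x\<close>
    does.\<close>
  have tE: "x \<in> E" if "x \<in> U'" "t x \<in> E" for x
  proof -
    have "\<theta> (proj E x) \<in> E" using that g(2) \<theta>(2) by (auto simp: S'_def)
    hence "x - proj E x \<in> E"
      using that(2) subspace_diff[OF E that(2)] by (force simp: t_def)
    thus ?thesis using subspace_add[OF E _ pE, of "x - proj E x" x] by simp
  qed
  have homeo: "homeomorphism U V \<theta> g"
  proof -
    have H: "\<And>x. x \<in> U' \<Longrightarrow> g (t x) = x" "\<And>y. y \<in> V' \<Longrightarrow> t (g y) = y" "t ` U' = V'" "g ` V' = U'"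
      using g(6) by (auto simp: homeomorphism_def)
    have 1: "t x \<in> V" if "x \<in> U" for x
    proof -
      have "t x \<in> V'" using that H(3) by (auto simp: U_def)
      thus ?thesis using that teq[of x] \<theta>(2) US by (auto simp: U_def V_def)
    qed
    have 2: "g y \<in> U" if "y \<in> V" for y
      using that H tE[of "g y"] by (auto simp: U_def V_def)
    show ?thesis
    proof (rule homeomorphismI)
      show "continuous_on U \<theta>" using smooth_on_continuous[OF \<theta>(1)] US continuous_on_subset by blast
      show "continuous_on V g" using g(6) by (auto simp: homeomorphism_def V_def intro: continuous_on_subset)
      show "\<theta> ` U \<subseteq> V" "g ` V \<subseteq> U" using 1 2 teq by (auto simp: U_def)
      show "g (\<theta> x) = x" if "x \<in> U" for x using that H(1)[of x] teq[of x] by (simp add: U_def)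
      show "\<theta> (g y) = y" if "y \<in> V" for y using 2[OF that] that H(2)[of y] teq[of "g y"] by (simp add: U_def V_def)
    qed
  qed
  have inj: "v = 0" if "x \<in> U" "v \<in> E" "dderiv \<theta> x v = 0" for x v
  proof -
    have "x \<in> U'" "x \<in> E" "x \<in> S'" using that g(2) by (auto simp: U_def)
    moreover have "x = g (t x)" "t x \<in> V'" using g(6) \<open>x \<in> U'\<close> by (auto simp: homeomorphism_def)
    ultimately have "inj (D x)" using g(8)[of "t x"] f' by (metis bij_is_inj)
    moreover have "D x v = 0" using that \<open>x \<in> E\<close> by (simp add: D_def)
    moreover have "D x 0 = 0" by (rule linear_0[OF has_derivative_linear[OF tD[OF \<open>x \<in> S'\<close>]]])
    ultimately show ?thesis by (metis injD)
  qed
  have "smooth_on E V g"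
    by (rule smooth_inverse[OF U V smooth_on_subset[OF \<theta>(1) US]])
       (use homeo inj order_trans[OF image_mono[OF US] \<theta>(2)] in \<open>auto simp: homeomorphism_def\<close>)
  moreover have "x0 \<in> U" using g(3) ropen_subset[OF S x0] by (simp add: U_def)
  ultimately show ?thesis using that U V US homeo inj by blast
qed

subsection \<open>Ordinary differential equations\<close>

text \<open>On a closed ball compactness bounds the derivatives in the finitely many basis
  directions, hence the operator norm. The ball also contains points off \<open>E\<close>, therefore
  the composition with \<open>proj E\<close>.\<close>

lemma C1_lipschitz_near:
  fixes \<Phi> :: "'a::euclidean_space \<Rightarrow> 'a"
  assumes S: "ropen E S" and \<Phi>: "Ck_on 1 E S \<Phi>" and z0: "z0 \<in> S"
  obtains r L where "r > 0" "L > 0" "L-lipschitz_on (cball z0 r) (\<lambda>x. \<Phi> (proj E x))" "proj E ` cball z0 r \<subseteq> S"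
proof -
  have E: "subspace E" using S by (simp add: ropen_def)
  have \<Phi>1: "\<And>x. x \<in> S \<Longrightarrow> \<Phi> differentiable (at x within S)" "\<And>v. v \<in> E \<Longrightarrow> continuous_on S (\<lambda>x. dderiv \<Phi> x v)"
    using \<Phi> by auto
  have lp: "bounded_linear (proj E)" by (rule bounded_linear_proj)
  have cp: "continuous_on X (proj E)" for X
    by (rule bounded_linear.continuous_on[OF lp continuous_on_id])
  have "open (proj E -` S)"
    using ropen_preimage[of UNIV UNIV "proj E" E S] S cp proj_in[OF E] by (simp add: image_subset_iff)
  moreover have "z0 \<in> proj E -` S" using z0 ropen_subset[OF S z0] proj_id[OF E] by simp
  ultimately obtain r where r: "r > 0" "cball z0 r \<subseteq> proj E -` S" by (metis open_contains_cball)
  have "\<exists>C. \<forall>x\<in>cball z0 r. norm (dderiv \<Phi> (proj E x) b) \<le> C" if b: "b \<in> obasis E" for b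
  proof -
    have "continuous_on (cball z0 r) (\<lambda>x. dderiv \<Phi> (proj E x) b)"
      by (rule continuous_on_compose2[OF \<Phi>1(2)[OF obasis_in[OF E b]] cp]) (use r in auto)
    hence "compact ((\<lambda>x. dderiv \<Phi> (proj E x) b) ` cball z0 r)"
      by (intro compact_continuous_image compact_cball)
    thus ?thesis by (meson bounded_iff compact_imp_bounded image_eqI)
  qed
  then obtain C where C: "\<And>b x. b \<in> obasis E \<Longrightarrow> x \<in> cball z0 r \<Longrightarrow> norm (dderiv \<Phi> (proj E x) b) \<le> C b"
    by metis
  define L where "L = (\<Sum>b\<in>obasis E. \<bar>C b\<bar>) + 1"
  have L: "L > 0" unfolding L_def by (simp add: add_nonneg_pos sum_nonneg)
  have "L-lipschitz_on (cball z0 r) (\<lambda>x. \<Phi> (proj E x))"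
  proof (rule bounded_derivative_imp_lipschitz)
    fix x assume x: "x \<in> cball z0 r"
    have px: "proj E x \<in> S" using x r by auto
    define D where "D = (\<lambda>v. dderiv \<Phi> (proj E x) (proj E v))"
    have D: "(\<Phi> has_derivative D) (at (proj E x) within S)"
      unfolding D_def by (rule differentiable_dderiv[OF S px \<Phi>1(1)[OF px]])
    have linD: "linear D" using D has_derivative_linear by blast
    have Dp: "D (proj E v) = D v" for v by (simp add: D_def proj_id[OF E proj_in[OF E]])
    have "(\<Phi> has_derivative D) (at (proj E x) within proj E ` cball z0 r)"
      using D by (rule has_derivative_subset) (use r in auto)
    from diff_chain_within[OF bounded_linear_imp_has_derivative[OF lp] this]
    show "((\<lambda>x. \<Phi> (proj E x)) has_derivative D) (at x within cball z0 r)"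
      by (simp add: comp_def Dp)
    show "onorm D \<le> L"
    proof (rule onorm_le)
      fix v
      have "D v = (\<Sum>b\<in>obasis E. (v \<bullet> b) *\<^sub>R D b)"
        using Dp[of v] linear_sum[OF linD, of "\<lambda>b. (v \<bullet> b) *\<^sub>R b" "obasis E"] linear_scale[OF linD]
        by (simp add: proj_def)
      also have "norm \<dots> \<le> (\<Sum>b\<in>obasis E. \<bar>C b\<bar> * norm v)"
      proof (rule sum_norm_le)
        fix b assume b: "b \<in> obasis E"
        have "\<bar>v \<bullet> b\<bar> \<le> norm v" using Cauchy_Schwarz_ineq2[of v b] obasis(3)[OF E b] by simp
        moreover have "norm (D b) \<le> \<bar>C b\<bar>"
          using C[OF b x] proj_id[OF E obasis_in[OF E b]] by (simp add: D_def)
        ultimately show "norm ((v \<bullet> b) *\<^sub>R D b) \<le> \<bar>C b\<bar> * norm v"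
          using mult_mono[of "\<bar>v \<bullet> b\<bar>" "norm v" "norm (D b)" "\<bar>C b\<bar>"] by (simp add: mult.commute)
      qed
      also have "\<dots> \<le> L * norm v" by (simp add: L_def sum_distrib_right[symmetric] mult_right_mono)
      finally show "norm (D v) \<le> L * norm v" .
    qed
  qed (use L in auto)
  thus ?thesis using that r L by blast
qed

text \<open>With a bounded and globally Lipschitz right-hand side the Picard operator acts on all
  bounded continuous functions of a real variable, so Banach's theorem applies to that type and no
  invariant ball has to be found.\<close>

lemma picard_bounded_lipschitz:
  fixes \<Phi> :: "'a::euclidean_space \<Rightarrow> 'a"
  assumes lip: "L-lipschitz_on UNIV \<Phi>" and L: "L > 0" and bd: "\<And>x. norm (\<Phi> x) \<le> C"
  obtains \<epsilon> \<phi> where "\<epsilon> > 0" "\<phi> 0 = z0" "\<And>t. t \<in> {-\<epsilon><..<\<epsilon>} \<Longrightarrow> (\<phi> has_vector_derivative \<Phi> (\<phi> t)) (at t)"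
proof -
  \<comment> \<open>\<open>T\<close> contains two integrals over intervals of length at most
    \<open>2 * \<epsilon>\<close>, so its Lipschitz constant is \<open>4 * \<epsilon> * L\<close>,
    made equal to 1/2.\<close>
  define \<epsilon> where "\<epsilon> = 1 / (8 * L)"
  have \<epsilon>: "\<epsilon> > 0" "4 * \<epsilon> * L = 1 / 2" using L by (auto simp: \<epsilon>_def)
  have cont\<Phi>: "continuous_on X \<Phi>" for X
    using lipschitz_on_continuous_on[OF lip] continuous_on_subset by blast
  \<comment> \<open>Clamping the time makes the integrals functions on the whole real line, as the
    type of bounded continuous functions requires.\<close>
  define cl where "cl t = max (-\<epsilon>) (min \<epsilon> t)" for t :: real
  have cl: "cl t \<in> {-\<epsilon>..\<epsilon>}" "t \<in> {-\<epsilon>..\<epsilon>} \<Longrightarrow> cl t = t" for t using \<epsilon>(1) by (auto simp: cl_def)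
  have contcl: "continuous_on UNIV cl" unfolding cl_def by (intro continuous_intros)
  define I where "I \<phi> t = integral {-\<epsilon>..cl t} (\<lambda>s. \<Phi> (\<phi> s))" for \<phi> :: "real \<Rightarrow> 'a" and t
  \<comment> \<open>All integrals start at \<open>-\<epsilon>\<close>, which avoids oriented
    integrals for negative times; subtracting \<open>I \<phi> 0\<close> moves the initial condition
    to time 0.\<close>
  define T where "T \<phi> t = z0 + (I \<phi> t - I \<phi> 0)" for \<phi> :: "real \<Rightarrow> 'a" and t
  have int: "(\<lambda>s. \<Phi> (\<phi> s)) integrable_on {-\<epsilon>..cl t}" if "continuous_on UNIV \<phi>" for \<phi> :: "real \<Rightarrow> 'a" and t
    by (intro integrable_continuous_interval continuous_on_compose2[OF cont\<Phi>[of UNIV]])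
       (auto intro: continuous_on_subset[OF that])
  have nI: "norm (I \<phi> t) \<le> C * (2 * \<epsilon>)" if "continuous_on UNIV \<phi>" for \<phi> t
  proof -
    have "norm (I \<phi> t) \<le> C * (cl t - -\<epsilon>)" unfolding I_def
      by (rule integral_bound) (use cl(1)[of t] bd in \<open>auto intro!: continuous_on_compose2[OF cont\<Phi>[of UNIV]] continuous_on_subset[OF that]\<close>)
    also have "\<dots> \<le> C * (2 * \<epsilon>)"
      using cl(1)[of t] order_trans[OF norm_ge_zero bd[of 0]] by (intro mult_left_mono) auto
    finally show ?thesis .
  qed
  have contI: "continuous_on UNIV (I \<phi>)" if "continuous_on UNIV \<phi>" for \<phi>
  proof -
    have "continuous_on {-\<epsilon>..\<epsilon>} (\<lambda>t. integral {-\<epsilon>..t} (\<lambda>s. \<Phi> (\<phi> s)))"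
      by (intro indefinite_integral_continuous_1) (use int[OF that, of \<epsilon>] cl(2)[of \<epsilon>] \<epsilon>(1) in auto)
    from continuous_on_compose2[OF this contcl] show ?thesis using cl(1) unfolding I_def[abs_def] by (simp add: image_subset_iff)
  qed
  have Tb: "T \<phi> \<in> bcontfun" if "continuous_on UNIV \<phi>" for \<phi>
  proof (rule bcontfun_normI)
    show "continuous_on UNIV (T \<phi>)" unfolding T_def[abs_def] by (intro continuous_intros contI that)
    show "norm (T \<phi> t) \<le> norm z0 + (C * (2 * \<epsilon>) + C * (2 * \<epsilon>))" for t
      unfolding T_def
      by (intro norm_triangle_le add_left_mono order_trans[OF norm_triangle_ineq4] add_mono nI that order_refl)
  qed
  define TT where "TT f = Bcontfun (T (apply_bcontfun f))" for f :: "real \<Rightarrow>\<^sub>C 'a"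
  have TT: "apply_bcontfun (TT f) = T (apply_bcontfun f)" for f
    unfolding TT_def by (rule Bcontfun_inverse) (rule Tb, simp)
  have "\<exists>!f. TT f = f"
  proof (rule banach_fix_type)
    show "0 \<le> (1/2::real)" "(1/2::real) < 1" by auto
    show "\<forall>f g. dist (TT f) (TT g) \<le> 1 / 2 * dist f g"
    proof (intro allI dist_bound)
      fix f g :: "real \<Rightarrow>\<^sub>C 'a" and t
      have dI: "norm (I f t - I g t) \<le> (L * dist f g) * (2 * \<epsilon>)" for t
      proof -
        have "I f t - I g t = integral {-\<epsilon>..cl t} (\<lambda>s. \<Phi> (f s) - \<Phi> (g s))"
          unfolding I_def by (rule integral_diff[symmetric]) (intro int, simp)+
        also have "norm \<dots> \<le> (L * dist f g) * (cl t - -\<epsilon>)"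
        proof (rule integral_bound)
          show "continuous_on {-\<epsilon>..cl t} (\<lambda>s. \<Phi> (f s) - \<Phi> (g s))"
            by (intro continuous_intros continuous_on_compose2[OF cont\<Phi>[of UNIV]]) auto
          show "norm (\<Phi> (f s) - \<Phi> (g s)) \<le> L * dist f g" for s
          proof -
            have "norm (\<Phi> (f s) - \<Phi> (g s)) \<le> L * dist (f s) (g s)"
              using lipschitz_onD[OF lip, of "f s" "g s"] by (simp add: dist_norm)
            also have "\<dots> \<le> L * dist f g" using dist_bounded[of f s g] L by (intro mult_left_mono) auto
            finally show ?thesis .
          qed
        qed (use cl(1)[of t] in auto)
        also have "\<dots> \<le> (L * dist f g) * (2 * \<epsilon>)"
          using cl(1)[of t] L by (intro mult_left_mono) auto
        finally show ?thesis .
      qed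
      have "dist (TT f t) (TT g t) = norm ((I f t - I g t) - (I f 0 - I g 0))"
        by (simp add: TT T_def dist_norm algebra_simps)
      also have "\<dots> \<le> (L * dist f g) * (2 * \<epsilon>) + (L * dist f g) * (2 * \<epsilon>)"
        by (intro order_trans[OF norm_triangle_ineq4] add_mono dI)
      also have "\<dots> = (4 * \<epsilon> * L) * dist f g" by (simp add: algebra_simps)
      finally show "dist (TT f t) (TT g t) \<le> 1 / 2 * dist f g" unfolding \<epsilon>(2) .
    qed
  qed
  then obtain f where f: "TT f = f" by blast
  define \<phi> where "\<phi> = apply_bcontfun f"
  have c\<phi>: "continuous_on UNIV \<phi>" by (simp add: \<phi>_def)
  have fixpt: "\<phi> t = z0 + (I \<phi> t - I \<phi> 0)" for t using TT[of f] unfolding f \<phi>_def[symmetric] by (metis T_def)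
  show ?thesis
  proof (rule that[OF \<epsilon>(1)])
    show "\<phi> 0 = z0" using fixpt[of 0] by simp
    fix t assume t: "t \<in> {-\<epsilon><..<\<epsilon>}"
    have "((\<lambda>u. integral {-\<epsilon>..u} (\<lambda>s. \<Phi> (\<phi> s))) has_vector_derivative \<Phi> (\<phi> t)) (at t within {-\<epsilon>..\<epsilon>})"
    proof (rule integral_has_vector_derivative)
      show "continuous_on {-\<epsilon>..\<epsilon>} (\<lambda>s. \<Phi> (\<phi> s))"
        by (rule continuous_on_compose2[OF cont\<Phi>[of UNIV] continuous_on_subset[OF c\<phi>]]) auto
    qed (use t in auto)
    hence "((\<lambda>u. integral {-\<epsilon>..u} (\<lambda>s. \<Phi> (\<phi> s))) has_vector_derivative \<Phi> (\<phi> t)) (at t)"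
      using t at_within_interior[of t "{-\<epsilon>..\<epsilon>}"] by (simp add: interior_atLeastAtMost_real)
    hence "((\<lambda>u. z0 + (integral {-\<epsilon>..u} (\<lambda>s. \<Phi> (\<phi> s)) - I \<phi> 0)) has_vector_derivative 0 + (\<Phi> (\<phi> t) - 0)) (at t)"
      by (intro has_vector_derivative_add has_vector_derivative_diff has_vector_derivative_const)
    hence D: "((\<lambda>u. z0 + (integral {-\<epsilon>..u} (\<lambda>s. \<Phi> (\<phi> s)) - I \<phi> 0)) has_vector_derivative \<Phi> (\<phi> t)) (at t)" by simp
    show "(\<phi> has_vector_derivative \<Phi> (\<phi> t)) (at t)"
    proof (rule has_vector_derivative_transform_within_open[OF D, of "{-\<epsilon><..<\<epsilon>}"])
      fix u assume "u \<in> {-\<epsilon><..<\<epsilon>}"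
      hence "cl u = u" by (intro cl(2)) auto
      thus "z0 + (integral {-\<epsilon>..u} (\<lambda>s. \<Phi> (\<phi> s)) - I \<phi> 0) = \<phi> u"
        using fixpt[of u] I_def[of \<phi> u] by simp
    qed (use t in auto)
  qed
qed

text \<open>Composing with the nearest point of a ball and with \<open>proj E\<close> makes the
  right-hand side bounded and Lipschitz everywhere. For small times the solution stays in the ball,
  where the first composition changes nothing; its projection to \<open>E\<close> is then a solution
  in \<open>S\<close>.\<close>

lemma ode_local_solution:
  fixes \<Phi> :: "'a::euclidean_space \<Rightarrow> 'a"
  assumes S: "ropen E S" and \<Phi>: "Ck_on 1 E S \<Phi>" "\<Phi> ` S \<subseteq> E" and z0: "z0 \<in> S"
  obtains \<epsilon> z where "\<epsilon> > 0" "z 0 = z0"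
    "\<And>t. t \<in> {-\<epsilon><..<\<epsilon>} \<Longrightarrow> z t \<in> S \<and> (z has_vector_derivative \<Phi> (z t)) (at t)"
proof -
  have E: "subspace E" using S by (simp add: ropen_def)
  obtain r L where r: "r > 0" "L > 0" "L-lipschitz_on (cball z0 r) (\<lambda>x. \<Phi> (proj E x))" "proj E ` cball z0 r \<subseteq> S"
    by (rule C1_lipschitz_near[OF S \<Phi>(1) z0])
  define cp where "cp = closest_point (cball z0 r)"
  have cp: "cp x \<in> cball z0 r" "x \<in> cball z0 r \<Longrightarrow> cp x = x" "dist (cp x) (cp y) \<le> dist x y" for x y
    unfolding cp_def using r(1)
    by (auto intro!: closest_point_lipschitz closest_point_self simp del: mem_cball intro: closest_point_in_set)
  define \<Psi> where "\<Psi> x = \<Phi> (proj E (cp x))" for x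
  have lip: "L-lipschitz_on UNIV \<Psi>"
  proof (rule lipschitz_onI)
    fix x y
    have "dist (\<Psi> x) (\<Psi> y) \<le> L * dist (cp x) (cp y)"
      unfolding \<Psi>_def by (rule lipschitz_onD[OF r(3) cp(1) cp(1)])
    also have "\<dots> \<le> L * dist x y" using r cp(3) by (intro mult_left_mono) auto
    finally show "dist (\<Psi> x) (\<Psi> y) \<le> L * dist x y" .
  qed (use r in auto)
  have "bounded ((\<lambda>x. \<Phi> (proj E x)) ` cball z0 r)"
    by (intro compact_imp_bounded compact_continuous_image lipschitz_on_continuous_on[OF r(3)] compact_cball)
  then obtain C where "\<forall>x\<in>cball z0 r. norm (\<Phi> (proj E x)) \<le> C" by (auto simp: bounded_iff simp del: mem_cball)
  hence bd: "norm (\<Psi> x) \<le> C" for x using cp(1) by (simp add: \<Psi>_def del: mem_cball)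
  obtain e \<phi> where \<phi>: "e > 0" "\<phi> 0 = z0" "\<And>t. t \<in> {-e<..<e} \<Longrightarrow> (\<phi> has_vector_derivative \<Psi> (\<phi> t)) (at t)"
    by (rule picard_bounded_lipschitz[OF lip r(2) bd, of z0]) blast
  have "continuous (at 0) \<phi>" using has_vector_derivative_continuous[OF \<phi>(3)[of 0]] \<phi>(1) by simp
  then obtain d where d: "d > 0" "\<And>t. dist t 0 < d \<Longrightarrow> dist (\<phi> t) (\<phi> 0) < r"
    using r(1) unfolding continuous_at_eps_delta by (auto simp: dist_norm)
  define \<epsilon> where "\<epsilon> = min d e"
  show ?thesis
  proof (rule that)
    show "\<epsilon> > 0" using d \<phi> by (simp add: \<epsilon>_def)
    show "proj E (\<phi> 0) = z0" using \<phi>(2) proj_id[OF E ropen_subset[OF S z0]] by simp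
    fix t assume t: "t \<in> {-\<epsilon><..<\<epsilon>}"
    have "\<bar>t\<bar> < d" using t by (auto simp: \<epsilon>_def min_def split: if_splits)
    hence ball: "\<phi> t \<in> cball z0 r" using d(2)[of t] \<phi>(2) by (auto simp: dist_commute)
    hence S': "proj E (\<phi> t) \<in> S" using r(4) by auto
    have "(\<phi> has_vector_derivative \<Psi> (\<phi> t)) (at t)" using t by (intro \<phi>(3)) (auto simp: \<epsilon>_def)
    hence "((\<lambda>t. proj E (\<phi> t)) has_vector_derivative proj E (\<Psi> (\<phi> t))) (at t)"
      by (rule bounded_linear.has_vector_derivative[OF bounded_linear_proj])
    moreover have "proj E (\<Psi> (\<phi> t)) = \<Phi> (proj E (\<phi> t))"
      using proj_id[OF E] \<Phi>(2) S' cp(2)[OF ball] by (auto simp: \<Psi>_def)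
    ultimately show "proj E (\<phi> t) \<in> S \<and> ((\<lambda>t. proj E (\<phi> t)) has_vector_derivative \<Phi> (proj E (\<phi> t))) (at t)"
      using S' by simp
  qed
qed

lemma dderiv_real_curve:
  assumes "(z has_vector_derivative z') (at t)"
  shows "dderiv z t v = v *\<^sub>R z'"
proof -
  have "((\<lambda>s. t + s *\<^sub>R v) has_vector_derivative v) (at 0)" by (rule line_has_vector_derivative)
  moreover have "(z has_vector_derivative z') (at (t + 0 *\<^sub>R v))" using assms by simp
  ultimately have "(z \<circ> (\<lambda>s. t + s *\<^sub>R v) has_vector_derivative v *\<^sub>R z') (at 0)"
    by (rule vector_diff_chain_at)
  thus ?thesis unfolding dderiv_def by (simp add: vector_derivative_at comp_def)
qed

text \<open>Bootstrapping: the derivative of \<open>z\<close> is \<Phi> along \<open>z\<close>,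
  hence as smooth as \<open>z\<close> itself.\<close>

lemma ode_solution_smooth:
  fixes \<Phi> :: "'a::euclidean_space \<Rightarrow> 'a"
  assumes S: "ropen E S" and \<Phi>: "smooth_on E S \<Phi>" and J: "open J"
    and z: "\<And>t. t \<in> J \<Longrightarrow> z t \<in> S \<and> (z has_vector_derivative \<Phi> (z t)) (at t)"
  shows "smooth_on UNIV J z"
proof -
  have J': "ropen UNIV J" using J by simp
  have dz: "z differentiable (at t within J)" if "t \<in> J" for t
    using z[OF that] by (auto simp: has_vector_derivative_def differentiable_def intro: has_derivative_at_withinI)
  have "Ck_on k UNIV J z" for k
  proof (induction k)
    case 0
    show ?case using dz by (auto simp: continuous_on_eq_continuous_within intro: differentiable_imp_continuous_within)
  next
    case (Suc k)
    have "Ck_on k UNIV J (\<lambda>t. dderiv z t v)" for v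
    proof -
      have "Ck_on k UNIV J (\<lambda>t. \<Phi> (z t))"
        by (rule Ck_on_compose[OF J' S _ Suc.IH]) (use z \<Phi> in \<open>auto simp: smooth_on_def\<close>)
      hence "Ck_on k UNIV J (\<lambda>t. v *\<^sub>R \<Phi> (z t))"
        by (intro Ck_on_bilinear[OF bounded_bilinear_scaleR J'] Ck_on_const)
      thus ?thesis by (subst Ck_on_cong[OF J']) (use z in \<open>auto intro: dderiv_real_curve\<close>)
    qed
    thus ?case using dz by auto
  qed
  thus ?thesis by (simp add: smooth_on_def)
qed

section \<open>Local Riemannian geometry\<close>

lemma has_vector_derivative_eventually_eq:
  assumes "(f has_vector_derivative f') (at t)" "\<forall>\<^sub>F s in nhds t. f s = g s"
  shows "(g has_vector_derivative f') (at t)"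
proof -
  obtain U where "open U" "t \<in> U" "\<And>s. s \<in> U \<Longrightarrow> f s = g s"
    using assms(2) by (auto simp: eventually_nhds)
  thus ?thesis using has_vector_derivative_transform_within_open[OF assms(1)] by blast
qed

text \<open>Covers a metric, its directional derivatives and the Christoffel symbols at once. All
  conditions are restricted to \<open>S\<close> and \<open>E\<close>, because coordinate expressions
  such as \<open>metric_coord\<close> are meaningless elsewhere.\<close>

locale bilinear_field =
  fixes E S :: "'e::euclidean_space set" and B :: "'e \<Rightarrow> 'e \<Rightarrow> 'e \<Rightarrow> 'h::euclidean_space"
  assumes ropen: "ropen E S"
    and left: "\<And>x a b c s t. x \<in> S \<Longrightarrow> a \<in> E \<Longrightarrow> b \<in> E \<Longrightarrow> c \<in> E \<Longrightarrow>
      B x (s *\<^sub>R a + t *\<^sub>R b) c = s *\<^sub>R B x a c + t *\<^sub>R B x b c"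
    and right: "\<And>x a b c s t. x \<in> S \<Longrightarrow> a \<in> E \<Longrightarrow> b \<in> E \<Longrightarrow> c \<in> E \<Longrightarrow>
      B x c (s *\<^sub>R a + t *\<^sub>R b) = s *\<^sub>R B x c a + t *\<^sub>R B x c b"
    and smooth: "\<And>a b. a \<in> E \<Longrightarrow> b \<in> E \<Longrightarrow> smooth_on E S (\<lambda>x. B x a b)"
begin

lemma subspace: "subspace E"
  using ropen by (simp add: ropen_def)

lemma in_E [simp, intro]:
  "a \<in> E \<Longrightarrow> b \<in> E \<Longrightarrow> a + b \<in> E" "a \<in> E \<Longrightarrow> b \<in> E \<Longrightarrow> a - b \<in> E"
  "a \<in> E \<Longrightarrow> s *\<^sub>R a \<in> E" "0 \<in> E" "a \<in> E \<Longrightarrow> - a \<in> E"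
  using subspace by (auto intro: subspace_add subspace_diff subspace_scale subspace_0 subspace_neg)

lemma
  assumes "x \<in> S" "a \<in> E" "b \<in> E" "c \<in> E"
  shows add_left: "B x (a + b) c = B x a c + B x b c" and add_right: "B x c (a + b) = B x c a + B x c b"
    and diff_left: "B x (a - b) c = B x a c - B x b c" and diff_right: "B x c (a - b) = B x c a - B x c b"
  using left[OF assms, of 1 1] right[OF assms, of 1 1] left[OF assms, of 1 "-1"] right[OF assms, of 1 "-1"]
  by simp_all

lemma
  assumes "x \<in> S" "a \<in> E" "c \<in> E"
  shows scale_left: "B x (s *\<^sub>R a) c = s *\<^sub>R B x a c" and scale_right: "B x c (s *\<^sub>R a) = s *\<^sub>R B x c a"
  using left[OF assms(1,2,2,3), of s 0] right[OF assms(1,2,2,3), of s 0] by simp_all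

lemma
  assumes "x \<in> S" "c \<in> E"
  shows zero_left: "B x 0 c = 0" and zero_right: "B x c 0 = 0"
  using scale_left[OF assms(1,2,2), of 0] scale_right[OF assms(1,2,2), of 0] by simp_all

lemma sum_left:
  assumes "x \<in> S" "c \<in> E" "\<And>i. i \<in> I \<Longrightarrow> a i \<in> E"
  shows "B x (\<Sum>i\<in>I. s i *\<^sub>R a i) c = (\<Sum>i\<in>I. s i *\<^sub>R B x (a i) c)"
  using assms(3)
proof (induction I rule: infinite_finite_induct)
  case (insert i I)
  have "(\<Sum>i\<in>I. s i *\<^sub>R a i) \<in> E"
    using insert.prems subspace by (auto intro!: subspace_sum subspace_scale)
  thus ?case using insert assms(1,2) by (simp add: add_left scale_left)
qed (use zero_left[OF assms(1,2)] in auto)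

lemma sum_right:
  assumes "x \<in> S" "c \<in> E" "\<And>i. i \<in> I \<Longrightarrow> a i \<in> E"
  shows "B x c (\<Sum>i\<in>I. s i *\<^sub>R a i) = (\<Sum>i\<in>I. s i *\<^sub>R B x c (a i))"
  using assms(3)
proof (induction I rule: infinite_finite_induct)
  case (insert i I)
  have "(\<Sum>i\<in>I. s i *\<^sub>R a i) \<in> E"
    using insert.prems subspace by (auto intro!: subspace_sum subspace_scale)
  thus ?case using insert assms(1,2) by (simp add: add_right scale_right)
qed (use zero_right[OF assms(1,2)] in auto)

lemma expand:
  assumes "x \<in> S" "a \<in> E" "c \<in> E"
  shows "B x a c = (\<Sum>i\<in>obasis E. \<Sum>j\<in>obasis E. ((a \<bullet> i) * (c \<bullet> j)) *\<^sub>R B x i j)"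
proof -
  have "B x a c = B x (\<Sum>i\<in>obasis E. (a \<bullet> i) *\<^sub>R i) (\<Sum>j\<in>obasis E. (c \<bullet> j) *\<^sub>R j)"
    using subspace_expand[OF subspace] assms by simp
  also have "\<dots> = (\<Sum>i\<in>obasis E. (a \<bullet> i) *\<^sub>R B x i (\<Sum>j\<in>obasis E. (c \<bullet> j) *\<^sub>R j))"
    by (rule sum_left) (use assms obasis_in[OF subspace] subspace_expand[OF subspace assms(3)] in auto)
  also have "\<dots> = (\<Sum>i\<in>obasis E. (a \<bullet> i) *\<^sub>R (\<Sum>j\<in>obasis E. (c \<bullet> j) *\<^sub>R B x i j))"
    by (rule sum.cong[OF refl], subst sum_right) (use assms obasis_in[OF subspace] in auto)
  finally show ?thesis by (simp add: scaleR_sum_right)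
qed

lemma differentiable: "x \<in> S \<Longrightarrow> a \<in> E \<Longrightarrow> b \<in> E \<Longrightarrow> (\<lambda>x. B x a b) differentiable (at x within S)"
  using smooth smooth_on_differentiable by blast

text \<open>Smoothness of \<open>B\<close> is assumed for constant arguments, so moving arguments
  are expanded in the fixed basis.\<close>

lemma smooth_compose:
  fixes \<phi> :: "'d::euclidean_space \<Rightarrow> 'e"
  assumes T: "ropen E' T" and \<phi>: "\<phi> ` T \<subseteq> S" "smooth_on E' T \<phi>"
    and u: "u ` T \<subseteq> E" "smooth_on E' T u" and v: "v ` T \<subseteq> E" "smooth_on E' T v"
  shows "smooth_on E' T (\<lambda>y. B (\<phi> y) (u y) (v y))"
proof -
  have "smooth_on E' T (\<lambda>y. \<Sum>i\<in>obasis E. \<Sum>j\<in>obasis E. ((u y \<bullet> i) * (v y \<bullet> j)) *\<^sub>R B (\<phi> y) i j)"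
    using obasis_in[OF subspace]
    by (intro smooth_on_sum[OF T] smooth_on_bilinear[OF bounded_bilinear_scaleR T]
        smooth_on_bilinear[OF bounded_bilinear_mult T] smooth_on_bilinear[OF bounded_bilinear_inner T]
        smooth_on_const u(2) v(2) smooth_on_compose[OF T ropen \<phi>] smooth)
  thus ?thesis
    using expand \<phi>(1) u(1) v(1) by (subst smooth_on_cong[OF T]) (auto simp: image_subset_iff)
qed

text \<open>In the fixed basis this is the product rule for scalar coefficients times the fields
  \<open>B x i j\<close>.\<close>

lemma curve_derivative:
  assumes c: "(c has_vector_derivative c') (at t)" "\<forall>\<^sub>F s in nhds t. c s \<in> S"
    and u: "(u has_vector_derivative u') (at t)" "\<forall>\<^sub>F s in nhds t. u s \<in> E"
    and v: "(v has_vector_derivative v') (at t)" "\<forall>\<^sub>F s in nhds t. v s \<in> E"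
  shows "((\<lambda>s. B (c s) (u s) (v s)) has_vector_derivative
     dderiv (\<lambda>x. B x (u t) (v t)) (c t) c' + B (c t) u' (v t) + B (c t) (u t) v') (at t)"
proof -
  have at: "c t \<in> S" "u t \<in> E" "v t \<in> E"
    using c(2) u(2) v(2) eventually_nhds_x_imp_x by blast+
  have E: "u' \<in> E" "v' \<in> E"
    using vector_derivative_in_subspace[OF subspace] u v by blast+
  let ?O = "obasis E"
  note O = obasis_in[OF subspace]
  have D: "((\<lambda>s. B (c s) i j) has_vector_derivative dderiv (\<lambda>x. B x i j) (c t) c') (at t)"
    if "i \<in> E" "j \<in> E" for i j
    by (rule dderiv_chain[OF ropen differentiable c]) (use that at in auto)
  have lin: "((\<lambda>s. u s \<bullet> i) has_vector_derivative u' \<bullet> i) (at t)" "((\<lambda>s. v s \<bullet> i) has_vector_derivative v' \<bullet> i) (at t)" for i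
    using bounded_linear.has_vector_derivative[OF bounded_linear_inner_left] u(1) v(1) by blast+
  have coef: "((\<lambda>s. (u s \<bullet> i) * (v s \<bullet> j)) has_vector_derivative (u t \<bullet> i) * (v' \<bullet> j) + (u' \<bullet> i) * (v t \<bullet> j)) (at t)" for i j
    by (rule has_vector_derivative_mult[OF lin(1) lin(2)])
  have main: "((\<lambda>s. \<Sum>i\<in>?O. \<Sum>j\<in>?O. ((u s \<bullet> i) * (v s \<bullet> j)) *\<^sub>R B (c s) i j) has_vector_derivative
     (\<Sum>i\<in>?O. \<Sum>j\<in>?O. ((u t \<bullet> i) * (v t \<bullet> j)) *\<^sub>R dderiv (\<lambda>x. B x i j) (c t) c'
       + ((u t \<bullet> i) * (v' \<bullet> j) + (u' \<bullet> i) * (v t \<bullet> j)) *\<^sub>R B (c t) i j)) (at t)"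
    by (intro has_vector_derivative_sum bounded_bilinear.has_vector_derivative[OF bounded_bilinear_scaleR] coef D O)
  \<comment> \<open>The same expansion with both arguments frozen at time \<open>t\<close>
    identifies one group of terms as the derivative of \<open>B\<close> in its base point.\<close>
  have "((\<lambda>s. \<Sum>i\<in>?O. \<Sum>j\<in>?O. ((u t \<bullet> i) * (v t \<bullet> j)) *\<^sub>R B (c s) i j) has_vector_derivative
     (\<Sum>i\<in>?O. \<Sum>j\<in>?O. ((u t \<bullet> i) * (v t \<bullet> j)) *\<^sub>R dderiv (\<lambda>x. B x i j) (c t) c' + 0 *\<^sub>R B (c t) i j)) (at t)"
    by (intro has_vector_derivative_sum bounded_bilinear.has_vector_derivative[OF bounded_bilinear_scaleR]
        has_vector_derivative_const D O)
  moreover have "((\<lambda>s. B (c s) (u t) (v t)) has_vector_derivative dderiv (\<lambda>x. B x (u t) (v t)) (c t) c') (at t)"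
    by (rule D) (use at in auto)
  moreover have "\<forall>\<^sub>F s in nhds t. B (c s) (u t) (v t) = (\<Sum>i\<in>?O. \<Sum>j\<in>?O. ((u t \<bullet> i) * (v t \<bullet> j)) *\<^sub>R B (c s) i j)"
    using c(2) by eventually_elim (rule expand[OF _ at(2,3)])
  ultimately have 1: "dderiv (\<lambda>x. B x (u t) (v t)) (c t) c' =
     (\<Sum>i\<in>?O. \<Sum>j\<in>?O. ((u t \<bullet> i) * (v t \<bullet> j)) *\<^sub>R dderiv (\<lambda>x. B x i j) (c t) c')"
    using vector_derivative_unique_at[OF has_vector_derivative_eventually_eq] by fastforce
  have "((\<lambda>s. B (c s) (u s) (v s)) has_vector_derivative
     (\<Sum>i\<in>?O. \<Sum>j\<in>?O. ((u t \<bullet> i) * (v t \<bullet> j)) *\<^sub>R dderiv (\<lambda>x. B x i j) (c t) c'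
       + ((u t \<bullet> i) * (v' \<bullet> j) + (u' \<bullet> i) * (v t \<bullet> j)) *\<^sub>R B (c t) i j)) (at t)"
  proof -
    have ev: "\<forall>\<^sub>F s in nhds t. B (c s) (u s) (v s) = (\<Sum>i\<in>?O. \<Sum>j\<in>?O. ((u s \<bullet> i) * (v s \<bullet> j)) *\<^sub>R B (c s) i j)"
      using c(2) u(2) v(2) by eventually_elim (rule expand)
    show ?thesis
      by (rule has_vector_derivative_eventually_eq[OF main]) (use ev in \<open>auto elim!: eventually_mono\<close>)
  qed
  moreover have "(\<Sum>i\<in>?O. \<Sum>j\<in>?O. ((u t \<bullet> i) * (v t \<bullet> j)) *\<^sub>R dderiv (\<lambda>x. B x i j) (c t) c'
       + ((u t \<bullet> i) * (v' \<bullet> j) + (u' \<bullet> i) * (v t \<bullet> j)) *\<^sub>R B (c t) i j)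
      = dderiv (\<lambda>x. B x (u t) (v t)) (c t) c' + B (c t) u' (v t) + B (c t) (u t) v'"
    unfolding 1 expand[OF at(1) E(1) at(3)] expand[OF at(1,2) E(2)]
    by (simp add: sum.distrib scaleR_add_left)
  ultimately show ?thesis by simp
qed

text \<open>Gives the terms of the Koszul formula their linearity in each argument.\<close>

lemma derivative_field:
  assumes d: "d \<in> E"
  shows "bilinear_field E S (\<lambda>x a b. dderiv (\<lambda>y. B y a b) x d)"
proof
  have *: "dderiv (\<lambda>y. s *\<^sub>R f y + t *\<^sub>R g y) x d = s *\<^sub>R dderiv f x d + t *\<^sub>R dderiv g x d"
    if "x \<in> S" "f differentiable (at x within S)" "g differentiable (at x within S)" for f g :: "'e \<Rightarrow> 'h" and s t x
    using has_derivative_dderiv(2)[OF ropen that(1) d has_derivative_add[OF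
        has_derivative_scaleR_right[OF differentiable_dderiv[OF ropen that(1,2)], of s]
        has_derivative_scaleR_right[OF differentiable_dderiv[OF ropen that(1,3)], of t]]] proj_id[OF subspace d]
    by simp
  show "dderiv (\<lambda>y. B y (s *\<^sub>R a + t *\<^sub>R b) c) x d = s *\<^sub>R dderiv (\<lambda>y. B y a c) x d + t *\<^sub>R dderiv (\<lambda>y. B y b c) x d"
    if "x \<in> S" "a \<in> E" "b \<in> E" "c \<in> E" for x a b c s t
    using dderiv_cong[OF ropen that(1) d left[OF _ that(2-4)]] * that differentiable by simp
  show "dderiv (\<lambda>y. B y c (s *\<^sub>R a + t *\<^sub>R b)) x d = s *\<^sub>R dderiv (\<lambda>y. B y c a) x d + t *\<^sub>R dderiv (\<lambda>y. B y c b) x d"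
    if "x \<in> S" "a \<in> E" "b \<in> E" "c \<in> E" for x a b c s t
    using dderiv_cong[OF ropen that(1) d right[OF _ that(2-4)]] * that differentiable by simp
  show "smooth_on E S (\<lambda>x. dderiv (\<lambda>y. B y a b) x d)" if "a \<in> E" "b \<in> E" for a b
    using smooth_on_dderiv[OF smooth[OF that] d] .
qed (rule ropen)

end

text \<open>The Christoffel symbols and the curvature of \<open>christoffel\<close> and \<open>curvature\<close>, with the metric as
  an arbitrary field of bilinear forms.\<close>

definition chris :: "'e::euclidean_space set \<Rightarrow> ('e \<Rightarrow> 'e \<Rightarrow> 'e \<Rightarrow> real) \<Rightarrow> 'e \<Rightarrow> 'e \<Rightarrow> 'e \<Rightarrow> 'e" where
  "chris E G x a b = (THE w. w \<in> E \<and> (\<forall>z\<in>E. 2 * G x w z =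
     dderiv (\<lambda>y. G y b z) x a + dderiv (\<lambda>y. G y a z) x b - dderiv (\<lambda>y. G y a b) x z))"

definition curv :: "'e::euclidean_space set \<Rightarrow> ('e \<Rightarrow> 'e \<Rightarrow> 'e \<Rightarrow> real) \<Rightarrow> 'e \<Rightarrow> 'e \<Rightarrow> 'e \<Rightarrow> 'e \<Rightarrow> 'e" where
  "curv E G x a b d =
     (dderiv (\<lambda>y. chris E G y b d) x a + chris E G x a (chris E G x b d))
   - (dderiv (\<lambda>y. chris E G y a d) x b + chris E G x b (chris E G x a d))"

lemma christoffel_eq_chris: "christoffel M g c = chris (model M) (metric_coord M g c)"
  by (intro ext) (simp add: christoffel_def chris_def)

lemma curvature_eq_curv: "curvature M g c = curv (model M) (metric_coord M g c)"
  by (intro ext) (simp add: curvature_def curv_def cov_deriv_def[abs_def] christoffel_eq_chris)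

section \<open>Riemannian metrics in coordinates and Riesz representation\<close>

locale local_metric = bilinear_field E S G for E S :: "'e::euclidean_space set" and G :: "'e \<Rightarrow> 'e \<Rightarrow> 'e \<Rightarrow> real" +
  assumes sym: "\<And>x a b. x \<in> S \<Longrightarrow> a \<in> E \<Longrightarrow> b \<in> E \<Longrightarrow> G x a b = G x b a"
    and pos: "\<And>x a. x \<in> S \<Longrightarrow> a \<in> E \<Longrightarrow> a \<noteq> 0 \<Longrightarrow> G x a a > 0"
begin

lemma nondegenerate: "x \<in> S \<Longrightarrow> w \<in> E \<Longrightarrow> (\<And>z. z \<in> E \<Longrightarrow> G x w z = 0) \<Longrightarrow> w = 0"
  using pos[of x w] by force

lemma eq_by_metric:
  assumes "x \<in> S" "v \<in> E" "w \<in> E" "\<And>z. z \<in> E \<Longrightarrow> G x v z = G x w z"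
  shows "v = w"
  using nondegenerate[of x "v - w"] assms by (simp add: diff_left)

text \<open>Lowering an index, with covectors represented by the Euclidean inner product. It turns
  the conditions \<open>G x w z = l z\<close> for all \<open>z\<close> into a single linear equation
  for \<open>w\<close>, to which the results on smooth linear systems apply; \<open>proj E\<close>
  makes it linear on the whole type.\<close>

definition lower :: "'e \<Rightarrow> 'e \<Rightarrow> 'e" where
  "lower x a = (\<Sum>b\<in>obasis E. G x (proj E a) b *\<^sub>R b)"

lemma linear_lower: "x \<in> S \<Longrightarrow> linear (lower x)"
  unfolding lower_def using linear_proj[of E] proj_in[OF subspace] obasis_in[OF subspace]
  by (intro linearI) (simp_all add: linear_add linear_scale add_left scale_left scaleR_add_left sum.distrib scaleR_sum_right)

lemma inner_obasis: "b \<in> obasis E \<Longrightarrow> b' \<in> obasis E \<Longrightarrow> b \<bullet> b' = (if b = b' then 1 else 0)"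
  using obasis(2,3)[OF subspace] by (auto simp: pairwise_def orthogonal_def norm_eq_1)

lemma lower_inner: "x \<in> S \<Longrightarrow> a \<in> E \<Longrightarrow> b \<in> obasis E \<Longrightarrow> lower x a \<bullet> b = G x a b"
  using obasis(7)[OF subspace]
  by (simp add: lower_def proj_id[OF subspace] inner_sum_left inner_obasis if_distrib cong: if_cong)

lemma metric_expand:
  assumes "x \<in> S" "a \<in> E" "z \<in> E"
  shows "G x a z = (\<Sum>b\<in>obasis E. (z \<bullet> b) * G x a b)"
  using sum_right[OF assms(1,2) obasis_in[OF subspace], of "obasis E" "\<lambda>b. b" "\<lambda>b. z \<bullet> b"]
    subspace_expand[OF subspace assms(3)] by simp

lemma lower_inj: "x \<in> S \<Longrightarrow> a \<in> E \<Longrightarrow> lower x a = 0 \<Longrightarrow> a = 0"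
  using metric_expand lower_inner[of x a] by (intro nondegenerate[of x]) simp_all

text \<open>\<open>lower x\<close> is injective on \<open>E\<close> by positivity, hence onto
  \<open>E\<close> by dimension. This is what resolves the definite descriptions in
  \<open>chris\<close> and \<open>gradient\<close>.\<close>

lemma riesz:
  assumes x: "x \<in> S" and l: "linear l"
  shows "\<exists>!w. w \<in> E \<and> (\<forall>z\<in>E. G x w z = l z)"
proof -
  have inj: "inj_on (lower x) E"
    using linear_inj_on_iff_eq_0[OF linear_lower[OF x] subspace] lower_inj[OF x] by auto
  have "lower x ` E \<subseteq> E"
    unfolding lower_def using obasis_in[OF subspace] subspace by (auto intro!: subspace_sum subspace_scale)
  hence "lower x ` E = E"
  proof (intro subspace_dim_equal)
    show "dim E \<le> dim (lower x ` E)"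
      using dim_image_eq[OF linear_lower[OF x], of E] inj subspace by (simp add: span_eq_iff[THEN iffD2])
  qed (use subspace linear_subspace_image[OF linear_lower[OF x] subspace] in auto)
  moreover have "(\<Sum>b\<in>obasis E. l b *\<^sub>R b) \<in> E"
    using obasis_in[OF subspace] subspace by (auto intro!: subspace_sum subspace_scale)
  ultimately have "(\<Sum>b\<in>obasis E. l b *\<^sub>R b) \<in> lower x ` E" by simp
  then obtain w where w: "w \<in> E" "lower x w = (\<Sum>b\<in>obasis E. l b *\<^sub>R b)" by auto
  have Gb: "G x w b = l b" if "b \<in> obasis E" for b
    using lower_inner[OF x w(1) that] w(2) that obasis(7)[OF subspace]
    by (simp add: inner_sum_left inner_obasis if_distrib cong: if_cong)
  have "G x w z = l z" if "z \<in> E" for z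
  proof -
    have "l z = l (\<Sum>b\<in>obasis E. (z \<bullet> b) *\<^sub>R b)" using subspace_expand[OF subspace that] by simp
    also have "\<dots> = (\<Sum>b\<in>obasis E. (z \<bullet> b) * l b)" by (simp add: linear_sum[OF l] linear_scale[OF l])
    finally show ?thesis using metric_expand[OF x w(1) that] Gb by simp
  qed
  thus ?thesis using w(1) eq_by_metric[OF x] by (metis (no_types, lifting))
qed

lemma riesz_smooth:
  assumes w: "\<And>x. x \<in> S \<Longrightarrow> w x \<in> E" "\<And>x z. x \<in> S \<Longrightarrow> z \<in> E \<Longrightarrow> G x (w x) z = l x z"
    and l: "\<And>z. z \<in> E \<Longrightarrow> smooth_on E S (\<lambda>x. l x z)"
  shows "smooth_on E S w"
proof (rule linear_solve_smooth[where A=lower and r="\<lambda>x. \<Sum>b\<in>obasis E. l x b *\<^sub>R b", OF ropen subspace])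
  show "smooth_on E S (\<lambda>x. lower x a)" if "a \<in> E" for a
    unfolding lower_def using obasis_in[OF subspace] proj_id[OF subspace that] that
    by (intro smooth_on_sum[OF ropen] smooth_on_bilinear[OF bounded_bilinear_scaleR ropen] smooth_on_const) (simp add: smooth)
  show "smooth_on E S (\<lambda>x. \<Sum>b\<in>obasis E. l x b *\<^sub>R b)"
    using obasis_in[OF subspace] l
    by (intro smooth_on_sum[OF ropen] smooth_on_bilinear[OF bounded_bilinear_scaleR ropen] smooth_on_const) simp
  show "lower x (w x) = (\<Sum>b\<in>obasis E. l x b *\<^sub>R b)" if "x \<in> S" for x
    unfolding lower_def using w[OF that] obasis_in[OF subspace] proj_id[OF subspace] by simp
qed (use linear_lower lower_inj w in auto)

section \<open>The Levi-Civita connection in coordinates\<close>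

abbreviation "\<Gamma> \<equiv> chris E G"

lemma
  assumes x: "x \<in> S" and ab: "a \<in> E" "b \<in> E"
  shows \<Gamma>_in [simp]: "\<Gamma> x a b \<in> E"
    and koszul: "z \<in> E \<Longrightarrow> 2 * G x (\<Gamma> x a b) z =
      dderiv (\<lambda>y. G y b z) x a + dderiv (\<lambda>y. G y a z) x b - dderiv (\<lambda>y. G y a b) x z"
proof -
  define k where "k z = dderiv (\<lambda>y. G y b z) x a + dderiv (\<lambda>y. G y a z) x b - dderiv (\<lambda>y. G y a b) x z" for z
  interpret a: bilinear_field E S "\<lambda>x b z. dderiv (\<lambda>y. G y b z) x a" by (rule derivative_field[OF ab(1)])
  interpret b: bilinear_field E S "\<lambda>x a z. dderiv (\<lambda>y. G y a z) x b" by (rule derivative_field[OF ab(2)])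
  obtain L where L: "bounded_linear L" "\<And>v. v \<in> E \<Longrightarrow> dderiv (\<lambda>y. G y a b) x v = L v"
    by (rule dderiv_linear[OF ropen x differentiable[OF x ab]]) auto
  note lL = bounded_linear.linear[OF L(1)]
  \<comment> \<open>\<open>riesz\<close> expects a functional that is linear on the whole type, but
    \<open>k\<close> is known to be linear on \<open>E\<close> only.\<close>
  have "linear (\<lambda>z. k (proj E z) / 2)"
    using linear_proj[of E] proj_in[OF subspace] x ab unfolding k_def
    by (intro linearI) (simp_all add: linear_add linear_scale L(2) linear_add[OF lL] linear_scale[OF lL]
      a.add_right b.add_right a.scale_right b.scale_right field_simps)
  from riesz[OF x this] have "\<exists>!w. w \<in> E \<and> (\<forall>z\<in>E. 2 * G x w z = k z)"
    using proj_id[OF subspace] by (simp add: mult.commute)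
  from theI'[OF this] have "\<Gamma> x a b \<in> E \<and> (\<forall>z\<in>E. 2 * G x (\<Gamma> x a b) z = k z)"
    unfolding chris_def k_def .
  thus "\<Gamma> x a b \<in> E" "z \<in> E \<Longrightarrow> 2 * G x (\<Gamma> x a b) z =
      dderiv (\<lambda>y. G y b z) x a + dderiv (\<lambda>y. G y a z) x b - dderiv (\<lambda>y. G y a b) x z"
    by (auto simp: k_def)
qed

lemma \<Gamma>_unique:
  assumes "x \<in> S" "a \<in> E" "b \<in> E" "w \<in> E" "\<And>z. z \<in> E \<Longrightarrow> G x w z = G x (\<Gamma> x a b) z"
  shows "\<Gamma> x a b = w"
  using eq_by_metric[of x w "\<Gamma> x a b"] assms by simp

lemma dderiv_sym:
  assumes "x \<in> S" "a \<in> E" "b \<in> E" "c \<in> E"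
  shows "dderiv (\<lambda>y. G y a b) x c = dderiv (\<lambda>y. G y b a) x c"
  by (rule dderiv_cong[OF ropen assms(1,4)]) (use sym assms in auto)

lemma \<Gamma>_sym:
  assumes "x \<in> S" "a \<in> E" "b \<in> E"
  shows "\<Gamma> x a b = \<Gamma> x b a"
proof (rule \<Gamma>_unique)
  fix z assume z: "z \<in> E"
  show "G x (\<Gamma> x b a) z = G x (\<Gamma> x a b) z"
    using koszul[OF assms z] koszul[OF assms(1,3,2) z] dderiv_sym[OF assms z] by simp
qed (use assms in auto)

lemma \<Gamma>_left:
  assumes x: "x \<in> S" and ab: "a \<in> E" "b \<in> E" "c \<in> E"
  shows "\<Gamma> x (s *\<^sub>R a + t *\<^sub>R b) c = s *\<^sub>R \<Gamma> x a c + t *\<^sub>R \<Gamma> x b c"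
proof (rule \<Gamma>_unique)
  fix z assume z: "z \<in> E"
  interpret c: bilinear_field E S "\<lambda>x b z. dderiv (\<lambda>y. G y b z) x c" by (rule derivative_field[OF ab(3)])
  interpret z: bilinear_field E S "\<lambda>x a b. dderiv (\<lambda>y. G y a b) x z" by (rule derivative_field[OF z])
  obtain L where L: "bounded_linear L" "\<And>v. v \<in> E \<Longrightarrow> dderiv (\<lambda>y. G y c z) x v = L v"
    by (rule dderiv_linear[OF ropen x differentiable[OF x ab(3) z]]) auto
  note lL = bounded_linear.linear[OF L(1)]
  have sab: "s *\<^sub>R a + t *\<^sub>R b \<in> E" using ab by simp
  have "2 * G x (s *\<^sub>R \<Gamma> x a c + t *\<^sub>R \<Gamma> x b c) z = s * (2 * G x (\<Gamma> x a c) z) + t * (2 * G x (\<Gamma> x b c) z)"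
    using x ab z by (simp add: left)
  also have "\<dots> = 2 * G x (\<Gamma> x (s *\<^sub>R a + t *\<^sub>R b) c) z"
    unfolding koszul[OF x ab(1,3) z] koszul[OF x ab(2,3) z] koszul[OF x sab ab(3) z]
    using x ab z sab by (simp add: c.left z.left L(2) linear_add[OF lL] linear_scale[OF lL] algebra_simps)
  finally have "2 * G x (s *\<^sub>R \<Gamma> x a c + t *\<^sub>R \<Gamma> x b c) z = 2 * G x (\<Gamma> x (s *\<^sub>R a + t *\<^sub>R b) c) z" .
  thus "G x (s *\<^sub>R \<Gamma> x a c + t *\<^sub>R \<Gamma> x b c) z = G x (\<Gamma> x (s *\<^sub>R a + t *\<^sub>R b) c) z" by simp
qed (use x ab in auto)

lemma bilinear_field_\<Gamma>: "bilinear_field E S \<Gamma>"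
proof
  show "\<Gamma> x c (s *\<^sub>R a + t *\<^sub>R b) = s *\<^sub>R \<Gamma> x c a + t *\<^sub>R \<Gamma> x c b" if "x \<in> S" "a \<in> E" "b \<in> E" "c \<in> E" for x a b c s t
    using \<Gamma>_left[OF that] \<Gamma>_sym[OF that(1,4)] that by simp
  show "smooth_on E S (\<lambda>x. \<Gamma> x a b)" if ab: "a \<in> E" "b \<in> E" for a b
  proof (rule riesz_smooth[where l="\<lambda>x z. (dderiv (\<lambda>y. G y b z) x a + dderiv (\<lambda>y. G y a z) x b - dderiv (\<lambda>y. G y a b) x z) *\<^sub>R (1/2)"])
    show "G x (\<Gamma> x a b) z = (dderiv (\<lambda>y. G y b z) x a + dderiv (\<lambda>y. G y a z) x b - dderiv (\<lambda>y. G y a b) x z) *\<^sub>R (1/2)"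
      if "x \<in> S" "z \<in> E" for x z using koszul[OF that(1) ab that(2)] by simp
    show "smooth_on E S (\<lambda>x. (dderiv (\<lambda>y. G y b z) x a + dderiv (\<lambda>y. G y a z) x b - dderiv (\<lambda>y. G y a b) x z) *\<^sub>R (1/2))"
      if "z \<in> E" for z
      using ab that by (intro smooth_on_bilinear[OF bounded_bilinear_scaleR ropen] smooth_on_const smooth_on_diff[OF ropen] smooth_on_add[OF ropen]
          smooth_on_dderiv smooth)
  qed (use ab in auto)
qed (use ropen \<Gamma>_left in auto)

sublocale \<Gamma>: bilinear_field E S \<Gamma>
  by (rule bilinear_field_\<Gamma>)

text \<open>Add the Koszul formulas for the pairs \<open>c, a\<close> tested on \<open>b\<close> and
  \<open>c, b\<close> tested on \<open>a\<close>: the derivatives in directions \<open>a\<close> and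
  \<open>b\<close> cancel.\<close>

lemma metric_compatible:
  assumes "x \<in> S" "a \<in> E" "b \<in> E" "c \<in> E"
  shows "dderiv (\<lambda>y. G y a b) x c = G x (\<Gamma> x c a) b + G x a (\<Gamma> x c b)"
  using koszul[OF assms(1,4,2,3)] koszul[OF assms(1,4,3,2)] dderiv_sym[OF assms]
    sym[OF assms(1,2), of "\<Gamma> x c b"] dderiv_sym[OF assms(1,4,3,2)] dderiv_sym[OF assms(1,4,2,3)] assms
  by simp

text \<open>The term \<open>u' + \<Gamma> (c t) c' (u t)\<close> is the covariant derivative of
  \<open>u\<close> along the curve. In this form metric compatibility serves the constant speed of
  geodesics, the Clairaut condition and the Gauss equation alike.\<close>

lemma metric_curve_derivative:
  assumes c: "(c has_vector_derivative c') (at t)" "\<forall>\<^sub>F s in nhds t. c s \<in> S"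
    and u: "(u has_vector_derivative u') (at t)" "\<forall>\<^sub>F s in nhds t. u s \<in> E"
    and v: "(v has_vector_derivative v') (at t)" "\<forall>\<^sub>F s in nhds t. v s \<in> E"
  shows "((\<lambda>s. G (c s) (u s) (v s)) has_vector_derivative
     G (c t) (u' + \<Gamma> (c t) c' (u t)) (v t) + G (c t) (u t) (v' + \<Gamma> (c t) c' (v t))) (at t)"
proof -
  have at: "c t \<in> S" "u t \<in> E" "v t \<in> E"
    using c(2) u(2) v(2) eventually_nhds_x_imp_x by blast+
  have E: "u' \<in> E" "v' \<in> E" "c' \<in> E"
    using vector_derivative_in_subspace[OF subspace] u v c eventually_mono[OF c(2) ropen_subset[OF ropen]] by blast+
  show ?thesis
    using curve_derivative[OF assms] at E by (simp add: metric_compatible add_left add_right algebra_simps)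
qed

section \<open>Geodesics and the pointwise consequence of the Clairaut condition\<close>

lemma geodesic_exists:
  assumes x0: "x0 \<in> S" and v: "v \<in> E"
  obtains \<epsilon> c c' where "\<epsilon> > 0" "c 0 = x0" "c' 0 = v" "smooth_on UNIV {-\<epsilon><..<\<epsilon>} c"
    "\<And>t. t \<in> {-\<epsilon><..<\<epsilon>} \<Longrightarrow> c t \<in> S \<and> c' t \<in> E \<and> (c has_vector_derivative c' t) (at t) \<and>
      (c' has_vector_derivative - \<Gamma> (c t) (c' t) (c' t)) (at t)"
proof -
  \<comment> \<open>The geodesic spray: the second order equation becomes a first order system for
    position and velocity on the subset \<open>S \<times> E\<close> of the subspace
    \<open>E \<times> E\<close>.\<close>
  define \<Phi> where "\<Phi> z = (snd z, - \<Gamma> (fst z) (snd z) (snd z))" for z :: "'e \<times> 'e"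
  have EE: "ropen (E \<times> E) (S \<times> E)"
    using ropen by (auto simp: ropen_def intro!: subspace_Times openin_Times)
  have sm: "smooth_on (E \<times> E) (S \<times> E) \<Phi>" unfolding \<Phi>_def
    by (intro smooth_on_Pair[OF EE] smooth_on_minus[OF EE] \<Gamma>.smooth_compose[OF EE]
        smooth_on_bounded_linear[OF bounded_linear_fst EE] smooth_on_bounded_linear[OF bounded_linear_snd EE] smooth_on_id) auto
  have im: "\<Phi> ` (S \<times> E) \<subseteq> E \<times> E" by (auto simp: \<Phi>_def)
  have "Ck_on 1 (E \<times> E) (S \<times> E) \<Phi>" using sm unfolding smooth_on_def by blast
  moreover have "(x0, v) \<in> S \<times> E" using x0 v by simp
  ultimately obtain \<epsilon> z where z: "\<epsilon> > 0" "z 0 = (x0, v)"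
    "\<And>t. t \<in> {-\<epsilon><..<\<epsilon>} \<Longrightarrow> z t \<in> S \<times> E \<and> (z has_vector_derivative \<Phi> (z t)) (at t)"
    by (rule ode_local_solution[OF EE _ im, of "(x0, v)"]) blast
  have "smooth_on UNIV {-\<epsilon><..<\<epsilon>} z"
    by (rule ode_solution_smooth[OF EE sm _ z(3)]) auto
  hence "smooth_on UNIV {-\<epsilon><..<\<epsilon>} (\<lambda>t. fst (z t))"
    by (intro smooth_on_bounded_linear[OF bounded_linear_fst]) auto
  moreover have "((\<lambda>t. fst (z t)) has_vector_derivative snd (z t)) (at t)"
      "((\<lambda>t. snd (z t)) has_vector_derivative - \<Gamma> (fst (z t)) (snd (z t)) (snd (z t))) (at t)" if "t \<in> {-\<epsilon><..<\<epsilon>}" for t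
    using bounded_linear.has_vector_derivative[OF bounded_linear_fst, of z "\<Phi> (z t)" "at t"]
      bounded_linear.has_vector_derivative[OF bounded_linear_snd, of z "\<Phi> (z t)" "at t"] z(3)[OF that] by (auto simp: \<Phi>_def)
  ultimately show ?thesis
    using z by (intro that[of \<epsilon> "\<lambda>t. fst (z t)" "\<lambda>t. snd (z t)"]) (auto simp: mem_Times_iff)
qed

text \<open>A field \<open>W\<close> whose value at \<open>x0\<close> is the vertical part of \<open>v\<close> maximises at time 0 the lower bound
  \<open>2\<langle>c', W\<rangle> - \<langle>W, W\<rangle>\<close> for the squared vertical speed; this spares differentiating the vertical projection.\<close>

lemma clairaut_derivative:
  assumes W: "ropen E S'" "S' \<subseteq> S" "x0 \<in> S'" "W ` S' \<subseteq> E" "W differentiable (at x0 within S')"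
    and f: "f differentiable (at x0 within S)" and v: "v \<in> E"
    and \<epsilon>: "\<epsilon> > 0" and c0: "c 0 = x0" "c' 0 = v"
    and c: "\<And>t. t \<in> {-\<epsilon><..<\<epsilon>} \<Longrightarrow> c t \<in> S \<and> c' t \<in> E \<and> (c has_vector_derivative c' t) (at t) \<and>
      (c' has_vector_derivative - \<Gamma> (c t) (c' t) (c' t)) (at t)"
    and le: "\<And>t. t \<in> {-\<epsilon><..<\<epsilon>} \<Longrightarrow> c t \<in> S' \<Longrightarrow>
      exp (2 * f (c t)) * (2 * G (c t) (c' t) (W (c t)) - G (c t) (W (c t)) (W (c t)))
      \<le> exp (2 * f x0) * (2 * G x0 v (W x0) - G x0 (W x0) (W x0))"
  shows "dderiv f x0 v * (2 * G x0 v (W x0) - G x0 (W x0) (W x0))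
     + G x0 (v - W x0) (dderiv W x0 v + \<Gamma> x0 v (W x0)) = 0"
proof -
  have x0: "x0 \<in> S" using W by auto
  have cS: "\<forall>\<^sub>F t in nhds 0. t \<in> {-\<epsilon><..<\<epsilon>}"
    using \<epsilon> by (intro eventually_nhds_in_open) auto
  have c0': "(c has_vector_derivative v) (at 0)" "(c' has_vector_derivative - \<Gamma> x0 v v) (at 0)"
    using c[of 0] \<epsilon> c0 by auto
  have evS: "\<forall>\<^sub>F t in nhds 0. c t \<in> S" using cS by eventually_elim (use c in auto)
  have evE: "\<forall>\<^sub>F t in nhds 0. c' t \<in> E" using cS by eventually_elim (use c in auto)
  obtain U where U: "open U" "S' = E \<inter> U" using W(1) by (auto simp: ropen_def openin_open)
  have "isCont c 0" using has_vector_derivative_continuous[OF c0'(1)] .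
  hence "\<forall>\<^sub>F t in nhds 0. c t \<in> U"
    using U(1) W(3) c0 U(2) by (auto simp: continuous_at eventually_nhds_conv_at elim: topological_tendstoD)
  hence evS': "\<forall>\<^sub>F t in nhds 0. c t \<in> S'"
    using evS by eventually_elim (use U ropen_subset[OF ropen] in auto)
  have WD: "((\<lambda>t. W (c t)) has_vector_derivative dderiv W x0 v) (at 0)"
    using dderiv_chain[OF W(1) _ c0'(1) evS', of W] W(5) c0 by simp
  have evW: "\<forall>\<^sub>F t in nhds 0. W (c t) \<in> E" using evS' by eventually_elim (use W(4) in auto)
  have fD: "((\<lambda>t. f (c t)) has_vector_derivative dderiv f x0 v) (at 0)"
    using dderiv_chain[OF ropen _ c0'(1) evS, of f] f c0 by simp
  have W0: "W x0 \<in> E" using W by auto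
  have dW: "dderiv W x0 v \<in> E" by (rule dderiv_in_subspace[OF W(1,3) v W(5) subspace]) (use W(4) in auto)
  define \<phi> where "\<phi> t = exp (2 * f (c t)) * (2 * G (c t) (c' t) (W (c t)) - G (c t) (W (c t)) (W (c t)))" for t
  define A where "A = dderiv W x0 v + \<Gamma> x0 v (W x0)"
  have AE: "A \<in> E" using dW x0 v W0 by (simp add: A_def)
  \<comment> \<open>The velocity contributes nothing, since its covariant derivative along a
    geodesic is 0.\<close>
  have 1: "((\<lambda>t. G (c t) (c' t) (W (c t))) has_real_derivative G x0 v A) (at 0)"
    using metric_curve_derivative[OF c0'(1) evS c0'(2) evE WD evW] c0 x0 v W0
    by (simp add: A_def has_real_derivative_iff_has_vector_derivative zero_left)
  have 2: "((\<lambda>t. G (c t) (W (c t)) (W (c t))) has_real_derivative 2 * G x0 (W x0) A) (at 0)"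
    using metric_curve_derivative[OF c0'(1) evS WD evW WD evW] c0 sym[OF x0 W0 AE]
    by (simp add: A_def has_real_derivative_iff_has_vector_derivative)
  have 3: "((\<lambda>t. f (c t)) has_real_derivative dderiv f x0 v) (at 0)"
    using fD by (simp add: has_real_derivative_iff_has_vector_derivative)
  have "(\<phi> has_real_derivative exp (2 * f x0) * (2 * (dderiv f x0 v * (2 * G x0 v (W x0) - G x0 (W x0) (W x0))
     + (G x0 v A - G x0 (W x0) A)))) (at 0)"
    unfolding \<phi>_def using c0 by (auto intro!: derivative_eq_intros 1 2 3 simp: algebra_simps)
  moreover obtain d where "d > 0" "\<And>t. dist t 0 < d \<Longrightarrow> c t \<in> S' \<and> t \<in> {-\<epsilon><..<\<epsilon>}"
    using eventually_conj[OF evS' cS] unfolding eventually_nhds_metric by blast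
  moreover from this have "\<forall>t. \<bar>0 - t\<bar> < d \<longrightarrow> \<phi> t \<le> \<phi> 0"
    unfolding \<phi>_def using le c0 by (auto simp: dist_real_def)
  ultimately have "exp (2 * f x0) * (2 * (dderiv f x0 v * (2 * G x0 v (W x0) - G x0 (W x0) (W x0))
     + (G x0 v A - G x0 (W x0) A))) = 0"
    by (intro DERIV_local_max)
  thus ?thesis using x0 v W0 AE by (simp add: A_def[symmetric] diff_left)
qed

text \<open>As \<open>z\<close> is orthogonal to \<open>W x0\<close>, the factor
  \<open>2 * G x0 v (W x0) - G x0 (W x0) (W x0)\<close> equals \<open>G x0 (W x0) (W x0)\<close> for
  every \<open>s\<close>. The hypothesis \<open>eq\<close> is thus a quadratic polynomial in
  \<open>s\<close> that vanishes identically; the conclusions are its constant and its linear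
  coefficient.\<close>

lemma umbilic_at:
  assumes W: "ropen E S'" "S' \<subseteq> S" "x0 \<in> S'" "W ` S' \<subseteq> E" "W differentiable (at x0 within S')"
    and f: "f differentiable (at x0 within S)"
    and z: "z \<in> E" "G x0 z (W x0) = 0"
    and eq: "\<And>s. let v = W x0 + s *\<^sub>R z in dderiv f x0 v * (2 * G x0 v (W x0) - G x0 (W x0) (W x0))
     + G x0 (v - W x0) (dderiv W x0 v + \<Gamma> x0 v (W x0)) = 0"
  shows "dderiv f x0 (W x0) * G x0 (W x0) (W x0) = 0"
    "dderiv f x0 z * G x0 (W x0) (W x0) + G x0 z (dderiv W x0 (W x0) + \<Gamma> x0 (W x0) (W x0)) = 0"
proof -
  have x0: "x0 \<in> S" using W by auto
  define u where "u = W x0"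
  have u: "u \<in> E" using W by (auto simp: u_def)
  obtain L where L: "bounded_linear L" "\<And>v. v \<in> E \<Longrightarrow> dderiv f x0 v = L v"
    by (rule dderiv_linear[OF ropen x0 f]) auto
  obtain M where M: "bounded_linear M" "\<And>v. v \<in> E \<Longrightarrow> dderiv W x0 v = M v"
    by (rule dderiv_linear[OF W(1,3,5)]) auto
  note lL = bounded_linear.linear[OF L(1)] and lM = bounded_linear.linear[OF M(1)]
  have ME: "M a \<in> E" if "a \<in> E" for a
    using dderiv_in_subspace[OF W(1,3) that W(5) subspace] W(4) M(2)[OF that] by auto
  have "(L u + s * L z) * G x0 u u + s * (G x0 z (M u + \<Gamma> x0 u u) + s * G x0 z (M z + \<Gamma> x0 z u)) = 0" for s
    using eq[of s] x0 u z ME unfolding u_def[symmetric] Let_def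
    by (simp add: L(2) M(2) linear_add[OF lL] linear_add[OF lM] linear_scale[OF lL] linear_scale[OF lM]
        add_left scale_left add_right scale_right \<Gamma>.add_left \<Gamma>.scale_left algebra_simps)
  \<comment> \<open>The value at 0 is the constant coefficient, half the difference of the values at
    1 and -1 the linear one.\<close>
  from this[of 0] this[of 1] this[of "-1"]
  show "dderiv f x0 (W x0) * G x0 (W x0) (W x0) = 0"
    "dderiv f x0 z * G x0 (W x0) (W x0) + G x0 z (dderiv W x0 (W x0) + \<Gamma> x0 (W x0) (W x0)) = 0"
    unfolding u_def[symmetric] L(2)[OF u] L(2)[OF z(1)] M(2)[OF u] by (simp_all add: algebra_simps)
qed

end

section \<open>The Gauss equation\<close>

text \<open>Here \<open>i\<close> is an isometric immersion in coordinates, and \<open>W a b\<close>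
  in the proof is the ambient covariant derivative of the coordinate field of \<open>b\<close> in
  direction \<open>a\<close>. Its tangential part is the connection of \<open>H\<close>
  (\<open>tang\<close>), its normal part is \<open>- H y a b *\<^sub>R N\<close>
  (\<open>normal\<close>). Differentiating \<open>tang\<close> compares the two curvatures, with the
  products of normal parts as difference.\<close>

lemma gauss_equation:
  fixes i :: "'k::euclidean_space \<Rightarrow> 'e::euclidean_space"
  assumes M: "local_metric E S G" and F: "local_metric K T H"
    and i: "smooth_on K T i" "i ` T \<subseteq> S"
    and H: "\<And>y a b. y \<in> T \<Longrightarrow> a \<in> K \<Longrightarrow> b \<in> K \<Longrightarrow> H y a b = G (i y) (dderiv i y a) (dderiv i y b)"
    and y: "y \<in> T" and N: "N \<in> E" "\<And>a. a \<in> K \<Longrightarrow> G (i y) N (dderiv i y a) = 0"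
    and umb: "\<And>a z. a \<in> K \<Longrightarrow> z \<in> E \<Longrightarrow> (\<And>b. b \<in> K \<Longrightarrow> G (i y) z (dderiv i y b) = 0) \<Longrightarrow>
      G (i y) z (dderiv (\<lambda>y. dderiv i y a) y a + chris E G (i y) (dderiv i y a) (dderiv i y a))
      = - H y a a * G (i y) z N"
    and ab: "a \<in> K" "b \<in> K" "H y a a = 1" "H y b b = 1" "H y a b = 0"
  shows "G (i y) (curv E G (i y) (dderiv i y a) (dderiv i y b) (dderiv i y b)) (dderiv i y a)
    = H y (curv K H y a b b) a - G (i y) N N"
proof -
  interpret M: local_metric E S G by fact
  interpret F: local_metric K T H by fact
  note T = F.ropen
  define D where "D y a = dderiv i y a" for y a
  define W where "W a b y = dderiv (\<lambda>y. D y b) y a + M.\<Gamma> (i y) (D y a) (D y b)" for a b y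
  have iS: "i y \<in> S" if "y \<in> T" for y using that i by auto
  have di: "i differentiable (at y within T)" if "y \<in> T" for y
    using smooth_on_differentiable[OF i(1) that] .
  have DE: "D y a \<in> E" if "y \<in> T" "a \<in> K" for y a
    unfolding D_def by (rule dderiv_in_subspace[OF T that di[OF that(1)] M.subspace]) (use iS ropen_subset[OF M.ropen] in auto)
  have smD: "smooth_on K T (\<lambda>y. D y a)" if "a \<in> K" for a
    unfolding D_def by (rule smooth_on_dderiv[OF i(1) that])
  have smDD: "smooth_on K T (\<lambda>y. dderiv (\<lambda>y. D y b) y a)" if "a \<in> K" "b \<in> K" for a b
    by (rule smooth_on_dderiv[OF smD[OF that(2)] that(1)])
  have DDE: "dderiv (\<lambda>y. D y b) y a \<in> E" if "y \<in> T" "a \<in> K" "b \<in> K" for a b y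
    by (rule dderiv_in_subspace[OF T that(1,2) smooth_on_differentiable[OF smD[OF that(3)] that(1)] M.subspace])
       (use DE that in auto)
  have DDsym: "dderiv (\<lambda>y. D y b) y a = dderiv (\<lambda>y. D y a) y b" if "y \<in> T" "a \<in> K" "b \<in> K" for a b y
    unfolding D_def by (rule dderiv_commute[OF T that(3,2) i(1) that(1)])
  have linD: "D y (s *\<^sub>R a + t *\<^sub>R b) = s *\<^sub>R D y a + t *\<^sub>R D y b" if y: "y \<in> T" and "a \<in> K" "b \<in> K" for y a b s t
  proof -
    obtain L where L: "bounded_linear L" "\<And>v. v \<in> K \<Longrightarrow> dderiv i y v = L v"
      by (rule dderiv_linear[OF T y di[OF y]]) auto
    note lL = bounded_linear.linear[OF L(1)]
    show ?thesis using that by (simp add: D_def L(2) linear_add[OF lL] linear_scale[OF lL])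
  qed
  have Dadd: "D y (a + b) = D y a + D y b" if "y \<in> T" "a \<in> K" "b \<in> K" for y a b
    using linD[OF that, of 1 1] by simp
  have WE: "W a b y \<in> E" if "y \<in> T" "a \<in> K" "b \<in> K" for a b y
    unfolding W_def using that by (intro M.in_E DDE M.\<Gamma>_in DE iS)
  have Wsym: "W a b y = W b a y" if "y \<in> T" "a \<in> K" "b \<in> K" for a b y
    unfolding W_def using DDsym[OF that] M.\<Gamma>_sym[OF iS[OF that(1)] DE[OF that(1,2)] DE[OF that(1,3)]] by simp
  have smW: "smooth_on K T (W a b)" if "a \<in> K" "b \<in> K" for a b
    unfolding W_def[abs_def]
    by (intro smooth_on_add[OF T] smDD that M.\<Gamma>.smooth_compose[OF T i(2,1)] smD) (use DE that in auto)
  have ic: "((\<lambda>t. i (y + t *\<^sub>R c)) has_vector_derivative D y c) (at 0)" if "y \<in> T" "c \<in> K" for y c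
    unfolding D_def by (rule dderiv_line[OF T that di[OF that(1)]])
  have Dc: "((\<lambda>t. D (y + t *\<^sub>R c) a) has_vector_derivative dderiv (\<lambda>y. D y a) y c) (at 0)"
    if "y \<in> T" "c \<in> K" "a \<in> K" for y c a
    by (rule dderiv_line[OF T that(1,2) smooth_on_differentiable[OF smD[OF that(3)] that(1)]])
  have evT: "\<forall>\<^sub>F t in nhds (0::real). y + t *\<^sub>R c \<in> T" if "y \<in> T" "c \<in> K" for y c
    by (rule ropen_line[OF T that])
  have evS: "\<forall>\<^sub>F t in nhds (0::real). i (y + t *\<^sub>R c) \<in> S" if "y \<in> T" "c \<in> K" for y c
    using evT[OF that] by eventually_elim (rule iS)
  have evD: "\<forall>\<^sub>F t in nhds (0::real). D (y + t *\<^sub>R c) a \<in> E" if "y \<in> T" "c \<in> K" "a \<in> K" for y c a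
    using evT[OF that(1,2)] by eventually_elim (use DE that in auto)
  have dH: "dderiv (\<lambda>y. H y a b) y c = G (i y) (W c a y) (D y b) + G (i y) (D y a) (W c b y)"
    if "y \<in> T" "a \<in> K" "b \<in> K" "c \<in> K" for y a b c
  proof -
    have "((\<lambda>t. G (i (y + t *\<^sub>R c)) (D (y + t *\<^sub>R c) a) (D (y + t *\<^sub>R c) b)) has_vector_derivative
        G (i y) (W c a y) (D y b) + G (i y) (D y a) (W c b y)) (at 0)"
      using M.metric_curve_derivative[OF ic[OF that(1,4)] evS[OF that(1,4)] Dc[OF that(1,4,2)] evD[OF that(1,4,2)]
          Dc[OF that(1,4,3)] evD[OF that(1,4,3)]] by (simp add: W_def)
    hence "((\<lambda>t. H (y + t *\<^sub>R c) a b) has_vector_derivative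
        G (i y) (W c a y) (D y b) + G (i y) (D y a) (W c b y)) (at 0)"
      by (rule has_vector_derivative_eventually_eq)
         (use evT[OF that(1,4)] in eventually_elim, use H that in \<open>simp add: D_def\<close>)
    thus ?thesis unfolding dderiv_def by (rule vector_derivative_at)
  qed
  \<comment> \<open>Inserting \<open>dH\<close> three times into the Koszul formula of
    \<open>H\<close>, the symmetry of \<open>W\<close> leaves one term twice. The identity is proved
    on all of \<open>T\<close> because it is differentiated later, whereas \<open>normal\<close>
    concerns the point \<open>y\<close> alone.\<close>
  have tang: "G (i y) (W a b y) (D y e) = H y (F.\<Gamma> y a b) e" if "y \<in> T" "a \<in> K" "b \<in> K" "e \<in> K" for y a b e
  proof -
    have "2 * H y (F.\<Gamma> y a b) e = 2 * G (i y) (W a b y) (D y e)"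
      unfolding F.koszul[OF that] dH[OF that(1,3,4,2)] dH[OF that(1,2,4,3)] dH[OF that(1-4)]
      using Wsym[OF that(1,2,3)] Wsym[OF that(1,2,4)] Wsym[OF that(1,3,4)]
        M.sym[OF iS[OF that(1)] DE[OF that(1,3)] WE[OF that(1,2,4)]] by simp
    thus ?thesis by simp
  qed
  note iy = iS[OF y]
  have normal: "W a b y = D y (F.\<Gamma> y a b) - H y a b *\<^sub>R N" if "a \<in> K" "b \<in> K" for a b
  proof -
    \<comment> \<open>The defect of the claimed decomposition. It is orthogonal to all tangent
      vectors, so it may be put into the umbilicity hypothesis, which makes it orthogonal to
      itself.\<close>
    define z where "z = W a b y + H y a b *\<^sub>R N - D y (F.\<Gamma> y a b)"
    have \<Gamma>K: "F.\<Gamma> y a b \<in> K" by (rule F.\<Gamma>_in[OF y that])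
    have zE: "z \<in> E" unfolding z_def by (intro M.in_E WE y that N DE \<Gamma>K)
    have zn: "G (i y) z (D y e) = 0" if "e \<in> K" for e
      unfolding z_def using tang[OF y \<open>a \<in> K\<close> \<open>b \<in> K\<close> that] H[OF y \<Gamma>K that] N(2)[OF that] iy N(1) that
      by (simp add: D_def[symmetric] M.add_left M.scale_left M.diff_left WE y DE \<Gamma>K \<open>a \<in> K\<close> \<open>b \<in> K\<close>)
    have umb': "G (i y) z (W c c y) = - H y c c * G (i y) z N" if "c \<in> K" for c
      unfolding W_def using umb[OF that zE] zn by (simp add: D_def)
    \<comment> \<open>Umbilicity is assumed for equal arguments only; this prepares the
      polarisation.\<close>
    have Wadd: "W (a + b) (a + b) y = W a a y + W b b y + 2 *\<^sub>R W a b y"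
    proof -
      have ab: "a + b \<in> K" using that F.in_E by simp
      have 1: "dderiv (\<lambda>y. D y (a + b)) y (a + b) = dderiv (\<lambda>y. D y a) y (a + b) + dderiv (\<lambda>y. D y b) y (a + b)"
        by (subst dderiv_cong[OF T y ab, where g="\<lambda>y. D y a + D y b"])
           (use Dadd[OF _ that] dderiv_add[OF T y ab smooth_on_differentiable[OF smD[OF that(1)] y]
              smooth_on_differentiable[OF smD[OF that(2)] y]] in auto)
      have 2: "dderiv (\<lambda>y. D y c) y (a + b) = dderiv (\<lambda>y. D y c) y a + dderiv (\<lambda>y. D y c) y b" if c: "c \<in> K" for c
      proof -
        obtain L where L: "bounded_linear L" "\<And>v. v \<in> K \<Longrightarrow> dderiv (\<lambda>y. D y c) y v = L v"
          by (rule dderiv_linear[OF T y smooth_on_differentiable[OF smD[OF c] y]]) auto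
        show ?thesis using \<open>a \<in> K\<close> \<open>b \<in> K\<close> ab linear_add[OF bounded_linear.linear[OF L(1)]] by (simp add: L(2))
      qed
      have 3: "M.\<Gamma> (i y) (D y (a + b)) (D y (a + b)) = M.\<Gamma> (i y) (D y a) (D y a) + M.\<Gamma> (i y) (D y b) (D y b) + 2 *\<^sub>R M.\<Gamma> (i y) (D y a) (D y b)"
        using M.\<Gamma>_sym[OF iy DE[OF y that(1)] DE[OF y that(2)]] iy that y
        by (simp add: Dadd M.\<Gamma>.add_left M.\<Gamma>.add_right DE scaleR_2)
      show ?thesis unfolding W_def 1 2[OF that(1)] 2[OF that(2)] 3
        using DDsym[OF y that] by (simp add: scaleR_2 algebra_simps)
    qed
    have "G (i y) z (W a b y) = - H y a b * G (i y) z N"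
    proof -
      have ab: "a + b \<in> K" using that F.in_E by simp
      have Hab: "H y (a + b) (a + b) = H y a a + H y b b + 2 * H y a b"
        using F.sym[OF y that] y that by (simp add: F.add_left F.add_right)
      have "G (i y) z (W a a y) + G (i y) z (W b b y) + 2 * G (i y) z (W a b y) = - H y (a + b) (a + b) * G (i y) z N"
        using umb'[OF ab] unfolding Wadd using iy zE that y
        by (simp add: M.add_right M.scale_right WE)
      thus ?thesis unfolding Hab umb'[OF that(1)] umb'[OF that(2)] by (simp add: algebra_simps)
    qed
    hence "G (i y) z z = 0"
      using zn[OF \<Gamma>K] zE iy N(1) y that DE[OF y \<Gamma>K] WE[OF y that]
      by (subst (2) z_def) (simp add: M.add_right M.scale_right M.diff_right)
    hence "z = 0" using M.pos[OF iy zE] by force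
    thus ?thesis by (simp add: z_def algebra_simps)
  qed
  have GW: "G (i y) (W a b y) (W c e y) = H y (F.\<Gamma> y a b) (F.\<Gamma> y c e) + H y a b * H y c e * G (i y) N N"
    if "a \<in> K" "b \<in> K" "c \<in> K" "e \<in> K" for a b c e
  proof -
    note k = F.\<Gamma>_in[OF y that(1,2)] F.\<Gamma>_in[OF y that(3,4)]
    show ?thesis
      unfolding normal[OF that(1,2)] normal[OF that(3,4)]
      using H[OF y k] N iy k DE[OF y] M.sym[OF iy N(1) DE[OF y k(1)]] N(2)[OF k(1)] N(2)[OF k(2)]
      by (simp add: M.diff_left M.diff_right M.scale_left M.scale_right D_def[symmetric])
  qed
  \<comment> \<open>Both sides of \<open>tang\<close> are differentiated in direction
    \<open>c\<close> by metric compatibility; \<open>GW\<close> evaluates the product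
    \<open>G (i y) (W a b y) (W c e y)\<close> that appears.\<close>
  have main: "G (i y) (dderiv (W a b) y c + M.\<Gamma> (i y) (D y c) (W a b y)) (D y e)
      = H y (dderiv (\<lambda>y. F.\<Gamma> y a b) y c + F.\<Gamma> y c (F.\<Gamma> y a b)) e - H y a b * H y c e * G (i y) N N"
    if abce: "a \<in> K" "b \<in> K" "c \<in> K" "e \<in> K" for a b c e
  proof -
    have \<Gamma>K: "F.\<Gamma> y' a b \<in> K" if "y' \<in> T" for y' by (rule F.\<Gamma>_in[OF that abce(1,2)])
    have Wc: "((\<lambda>t. W a b (y + t *\<^sub>R c)) has_vector_derivative dderiv (W a b) y c) (at 0)"
      by (rule dderiv_line[OF T y abce(3) smooth_on_differentiable[OF smW[OF abce(1,2)] y]])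
    have evW: "\<forall>\<^sub>F t in nhds (0::real). W a b (y + t *\<^sub>R c) \<in> E"
      using evT[OF y abce(3)] by eventually_elim (rule WE[OF _ abce(1,2)])
    have 1: "((\<lambda>t. G (i (y + t *\<^sub>R c)) (W a b (y + t *\<^sub>R c)) (D (y + t *\<^sub>R c) e)) has_vector_derivative
        G (i y) (dderiv (W a b) y c + M.\<Gamma> (i y) (D y c) (W a b y)) (D y e) + G (i y) (W a b y) (W c e y)) (at 0)"
      using M.metric_curve_derivative[OF ic[OF y abce(3)] evS[OF y abce(3)] Wc evW Dc[OF y abce(3,4)] evD[OF y abce(3,4)]]
      by (simp add: W_def[of c e])
    have gc: "((\<lambda>t. F.\<Gamma> (y + t *\<^sub>R c) a b) has_vector_derivative dderiv (\<lambda>y. F.\<Gamma> y a b) y c) (at 0)"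
      by (rule dderiv_line[OF T y abce(3) F.\<Gamma>.differentiable[OF y abce(1,2)]])
    have evg: "\<forall>\<^sub>F t in nhds (0::real). F.\<Gamma> (y + t *\<^sub>R c) a b \<in> K"
      using evT[OF y abce(3)] by eventually_elim (rule \<Gamma>K)
    have 2: "((\<lambda>t. H (y + t *\<^sub>R c) (F.\<Gamma> (y + t *\<^sub>R c) a b) e) has_vector_derivative
        H y (dderiv (\<lambda>y. F.\<Gamma> y a b) y c + F.\<Gamma> y c (F.\<Gamma> y a b)) e + H y (F.\<Gamma> y a b) (F.\<Gamma> y c e)) (at 0)"
      using F.metric_curve_derivative[OF line_has_vector_derivative evT[OF y abce(3)] gc evg has_vector_derivative_const, of e]
        abce(4) by simp
    have "((\<lambda>t. H (y + t *\<^sub>R c) (F.\<Gamma> (y + t *\<^sub>R c) a b) e) has_vector_derivative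
        G (i y) (dderiv (W a b) y c + M.\<Gamma> (i y) (D y c) (W a b y)) (D y e) + G (i y) (W a b y) (W c e y)) (at 0)"
      by (rule has_vector_derivative_eventually_eq[OF 1])
         (use evT[OF y abce(3)] in eventually_elim, rule tang[OF _ abce(1,2,4)])
    from vector_derivative_unique_at[OF this 2] show ?thesis using GW[OF abce] by simp
  qed
  have dW: "dderiv (W a b) y c = dderiv (\<lambda>y. dderiv (\<lambda>y. D y b) y a) y c
      + (dderiv (\<lambda>x. M.\<Gamma> x (D y a) (D y b)) (i y) (D y c) + M.\<Gamma> (i y) (dderiv (\<lambda>y. D y a) y c) (D y b)
        + M.\<Gamma> (i y) (D y a) (dderiv (\<lambda>y. D y b) y c))"
    if abc: "a \<in> K" "b \<in> K" "c \<in> K" for a b c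
  proof -
    have "((\<lambda>t. M.\<Gamma> (i (y + t *\<^sub>R c)) (D (y + t *\<^sub>R c) a) (D (y + t *\<^sub>R c) b)) has_vector_derivative
       (dderiv (\<lambda>x. M.\<Gamma> x (D y a) (D y b)) (i y) (D y c) + M.\<Gamma> (i y) (dderiv (\<lambda>y. D y a) y c) (D y b)
        + M.\<Gamma> (i y) (D y a) (dderiv (\<lambda>y. D y b) y c))) (at 0)"
      using M.\<Gamma>.curve_derivative[OF ic[OF y abc(3)] evS[OF y abc(3)] Dc[OF y abc(3,1)] evD[OF y abc(3,1)]
          Dc[OF y abc(3,2)] evD[OF y abc(3,2)]] by simp
    moreover have "((\<lambda>t. dderiv (\<lambda>y. D y b) (y + t *\<^sub>R c) a) has_vector_derivative dderiv (\<lambda>y. dderiv (\<lambda>y. D y b) y a) y c) (at 0)"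
      by (rule dderiv_line[OF T y abc(3) smooth_on_differentiable[OF smDD[OF abc(1,2)] y]])
    ultimately show ?thesis
      unfolding dderiv_def[of "W a b"] W_def by (intro vector_derivative_at has_vector_derivative_add)
  qed
  have Wb: "W c b y = dderiv (\<lambda>y. D y b) y c + M.\<Gamma> (i y) (D y c) (D y b)" for c b by (simp add: W_def)
  note ab' = ab(1,2)
  \<comment> \<open>Third derivatives of \<open>i\<close> commute, so they cancel in the curvature
    expression; the second derivatives cancel by symmetry as well, and only the ambient curvature on
    the pushed forward vectors remains.\<close>
  have "dderiv (\<lambda>y. dderiv (\<lambda>y. D y b) y b) y a = dderiv (\<lambda>y. dderiv (\<lambda>y. D y b) y a) y b"
    by (rule dderiv_commute[OF T ab'(2,1) smD[OF ab'(2)] y])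
  hence R: "curv E G (i y) (D y a) (D y b) (D y b)
     = (dderiv (W b b) y a + M.\<Gamma> (i y) (D y a) (W b b y)) - (dderiv (W a b) y b + M.\<Gamma> (i y) (D y b) (W a b y))"
    unfolding curv_def dW[OF ab'(2,2,1)] dW[OF ab'(1,2,2)] Wb
    using DDsym[OF y ab'] M.\<Gamma>_sym[OF iy DE[OF y ab'(2)] DDE[OF y ab']] iy y ab'
    by (simp add: M.\<Gamma>.add_right DE DDE M.\<Gamma>_in algebra_simps)
  have dWE: "dderiv (W c b) y e \<in> E" if "c \<in> K" "b \<in> K" "e \<in> K" for b c e
    by (rule dderiv_in_subspace[OF T y that(3) smooth_on_differentiable[OF smW[OF that(1,2)] y] M.subspace])
       (rule WE[OF _ that(1,2)])
  have dGK: "dderiv (\<lambda>y. F.\<Gamma> y c b) y e \<in> K" if "c \<in> K" "b \<in> K" "e \<in> K" for b c e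
    by (rule dderiv_in_subspace[OF T y that(3) F.\<Gamma>.differentiable[OF y that(1,2)] F.subspace]) (rule F.\<Gamma>_in[OF _ that(1,2)])
  have "G (i y) (curv E G (i y) (D y a) (D y b) (D y b)) (D y a) =
    G (i y) (dderiv (W b b) y a + M.\<Gamma> (i y) (D y a) (W b b y)) (D y a) - G (i y) (dderiv (W a b) y b + M.\<Gamma> (i y) (D y b) (W a b y)) (D y a)"
    unfolding R by (rule M.diff_left) (use iy y ab' in \<open>auto intro!: M.in_E dWE M.\<Gamma>_in DE WE\<close>)
  \<comment> \<open>The first instance of \<open>main\<close> carries the factor
    \<open>H y b b * H y a a = 1\<close>, the second the factor \<open>H y a b = 0\<close>.\<close>
  also have "\<dots> = H y (dderiv (\<lambda>y. F.\<Gamma> y b b) y a + F.\<Gamma> y a (F.\<Gamma> y b b)) a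
      - H y (dderiv (\<lambda>y. F.\<Gamma> y a b) y b + F.\<Gamma> y b (F.\<Gamma> y a b)) a - G (i y) N N"
    unfolding main[OF ab'(2,2,1,1)] main[OF ab'(1,2,2,1)] using ab by simp
  also have "\<dots> = H y (curv K H y a b b) a - G (i y) N N"
    unfolding curv_def by (subst F.diff_left) (use y ab' in \<open>auto intro!: F.in_E dGK F.\<Gamma>_in\<close>)
  finally show ?thesis by (simp add: D_def)
qed

section \<open>Submersions\<close>

text \<open>Product rule for a derivative whose base point and direction both move, by expanding the
  direction in a fixed basis.\<close>

lemma dderiv_curve:
  fixes \<Phi> :: "'e::euclidean_space \<Rightarrow> 'f::euclidean_space"
  assumes S: "ropen E S" and \<Phi>: "smooth_on E S \<Phi>"
    and c: "(c has_vector_derivative c') (at t)" "\<forall>\<^sub>F s in nhds t. c s \<in> S"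
    and v: "(v has_vector_derivative v') (at t)" "\<forall>\<^sub>F s in nhds t. v s \<in> E"
  shows "((\<lambda>s. dderiv \<Phi> (c s) (v s)) has_vector_derivative
     dderiv (\<lambda>x. dderiv \<Phi> x (v t)) (c t) c' + dderiv \<Phi> (c t) v') (at t)"
proof -
  have E: "subspace E" using S by (simp add: ropen_def)
  have at: "c t \<in> S" "v t \<in> E" using c(2) v(2) eventually_nhds_x_imp_x by blast+
  have v'E: "v' \<in> E" by (rule vector_derivative_in_subspace[OF E v])
  let ?O = "obasis E"
  note O = obasis_in[OF E]
  have expand: "dderiv \<Phi> x a = (\<Sum>b\<in>?O. (a \<bullet> b) *\<^sub>R dderiv \<Phi> x b)" if x: "x \<in> S" and "a \<in> E" for x a
  proof -
    obtain L where L: "bounded_linear L" "\<And>v. v \<in> E \<Longrightarrow> dderiv \<Phi> x v = L v"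
      by (rule dderiv_linear[OF S x smooth_on_differentiable[OF \<Phi> x]]) auto
    note lL = bounded_linear.linear[OF L(1)]
    have "L a = L (\<Sum>b\<in>?O. (a \<bullet> b) *\<^sub>R b)" using subspace_expand[OF E that(2)] by simp
    thus ?thesis using that O by (simp add: L(2) linear_sum[OF lL] linear_scale[OF lL])
  qed
  have D: "((\<lambda>s. dderiv \<Phi> (c s) a) has_vector_derivative dderiv (\<lambda>x. dderiv \<Phi> x a) (c t) c') (at t)" if "a \<in> E" for a
    by (rule dderiv_chain[OF S smooth_on_differentiable[OF smooth_on_dderiv[OF \<Phi> that] at(1)] c])
  have lin: "((\<lambda>s. v s \<bullet> b) has_vector_derivative v' \<bullet> b) (at t)" for b
    using bounded_linear.has_vector_derivative[OF bounded_linear_inner_left v(1)] .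
  have main: "((\<lambda>s. \<Sum>b\<in>?O. (v s \<bullet> b) *\<^sub>R dderiv \<Phi> (c s) b) has_vector_derivative
      (\<Sum>b\<in>?O. (v t \<bullet> b) *\<^sub>R dderiv (\<lambda>x. dderiv \<Phi> x b) (c t) c' + (v' \<bullet> b) *\<^sub>R dderiv \<Phi> (c t) b)) (at t)"
    by (intro has_vector_derivative_sum bounded_bilinear.has_vector_derivative[OF bounded_bilinear_scaleR] lin D O)
  have "((\<lambda>s. \<Sum>b\<in>?O. (v t \<bullet> b) *\<^sub>R dderiv \<Phi> (c s) b) has_vector_derivative
      (\<Sum>b\<in>?O. (v t \<bullet> b) *\<^sub>R dderiv (\<lambda>x. dderiv \<Phi> x b) (c t) c' + 0 *\<^sub>R dderiv \<Phi> (c t) b)) (at t)"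
    by (intro has_vector_derivative_sum bounded_bilinear.has_vector_derivative[OF bounded_bilinear_scaleR]
        has_vector_derivative_const D O)
  moreover have "\<forall>\<^sub>F s in nhds t. (\<Sum>b\<in>?O. (v t \<bullet> b) *\<^sub>R dderiv \<Phi> (c s) b) = dderiv \<Phi> (c s) (v t)"
    using c(2) by eventually_elim (rule expand[OF _ at(2), symmetric])
  ultimately have "((\<lambda>s. dderiv \<Phi> (c s) (v t)) has_vector_derivative
      (\<Sum>b\<in>?O. (v t \<bullet> b) *\<^sub>R dderiv (\<lambda>x. dderiv \<Phi> x b) (c t) c' + 0 *\<^sub>R dderiv \<Phi> (c t) b)) (at t)"
    by (rule has_vector_derivative_eventually_eq)
  from vector_derivative_unique_at[OF D[OF at(2)] this]
  have 1: "dderiv (\<lambda>x. dderiv \<Phi> x (v t)) (c t) c' = (\<Sum>b\<in>?O. (v t \<bullet> b) *\<^sub>R dderiv (\<lambda>x. dderiv \<Phi> x b) (c t) c')" by simp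
  have "\<forall>\<^sub>F s in nhds t. (\<Sum>b\<in>?O. (v s \<bullet> b) *\<^sub>R dderiv \<Phi> (c s) b) = dderiv \<Phi> (c s) (v s)"
    using c(2) v(2) by eventually_elim (rule expand[symmetric])
  from has_vector_derivative_eventually_eq[OF main this] show ?thesis
    unfolding 1 expand[OF at(1) v'E] by (simp add: sum.distrib)
qed

text \<open>With \<open>A\<close> the derivative at \<open>x0\<close> and \<open>R\<close> a right
  inverse of it, \<open>\<theta> x = x + R (\<Phi> x - \<Phi> x0 - A (x - x0))\<close> moves the
  nonlinear remainder of \<Phi> into the point, so that \<open>A (\<theta> x)\<close> is
  \<open>\<Phi> x\<close> up to a constant. The remainder has derivative 0 at \<open>x0\<close>;
  hence \<theta> has derivative the identity there and \<open>local_inverse\<close> applies.\<close>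

lemma submersion_straighten:
  fixes \<Phi> :: "'e::euclidean_space \<Rightarrow> 'f::euclidean_space"
  assumes S: "ropen E S" and E': "subspace E'" and \<Phi>: "smooth_on E S \<Phi>" "\<Phi> ` S \<subseteq> E'" and x0: "x0 \<in> S"
    and surj: "\<And>b. b \<in> E' \<Longrightarrow> \<exists>a\<in>E. dderiv \<Phi> x0 a = b"
  obtains A \<theta> U V \<Psi> where "linear A" "\<And>a. a \<in> E \<Longrightarrow> A a = dderiv \<Phi> x0 a"
    "smooth_on E S \<theta>" "\<theta> ` S \<subseteq> E" "\<theta> x0 = x0" "\<And>v. v \<in> E \<Longrightarrow> dderiv \<theta> x0 v = v"
    "\<And>x. x \<in> S \<Longrightarrow> A (\<theta> x) = A x0 + \<Phi> x - \<Phi> x0"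
    "\<And>x v. x \<in> S \<Longrightarrow> v \<in> E \<Longrightarrow> A (dderiv \<theta> x v) = dderiv \<Phi> x v"
    "ropen E U" "U \<subseteq> S" "x0 \<in> U" "ropen E V" "homeomorphism U V \<theta> \<Psi>"
    "smooth_on E V \<Psi>" "\<And>x v. x \<in> U \<Longrightarrow> v \<in> E \<Longrightarrow> dderiv \<theta> x v = 0 \<Longrightarrow> v = 0"
proof -
  have E: "subspace E" using S by (simp add: ropen_def)
  have d\<Phi>: "\<Phi> differentiable (at x within S)" if "x \<in> S" for x by (rule smooth_on_differentiable[OF \<Phi>(1) that])
  obtain A where A: "bounded_linear A" "\<And>v. v \<in> E \<Longrightarrow> dderiv \<Phi> x0 v = A v"
    by (rule dderiv_linear[OF S x0 d\<Phi>[OF x0]]) auto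
  have lA: "linear A" using A(1) by (rule bounded_linear.linear)
  obtain R where R: "R ` UNIV \<subseteq> E" "linear R" "\<And>v. v \<in> A ` E \<Longrightarrow> A (R v) = v"
    using linear_exists_right_inverse_on[OF lA E] by blast
  have AR: "A (R b) = b" if "b \<in> E'" for b
    using R(3) surj[OF that] A(2) by (metis imageI)
  have bR: "bounded_linear R" using R(2) by (simp add: linear_conv_bounded_linear)
  define \<theta> where "\<theta> x = x + R (\<Phi> x - \<Phi> x0 - A (x - x0))" for x
  have xE: "x \<in> E" if "x \<in> S" for x using that by (rule ropen_subset[OF S])
  have sm: "smooth_on E S \<theta>" unfolding \<theta>_def
    by (intro smooth_on_add[OF S] smooth_on_id smooth_on_bounded_linear[OF bR S] smooth_on_diff[OF S] \<Phi>(1) smooth_on_const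
        smooth_on_bounded_linear[OF A(1) S])
  have im: "\<theta> ` S \<subseteq> E" unfolding \<theta>_def using xE R(1) E by (auto intro!: subspace_add)
  have "R 0 = 0" "A 0 = 0" using linear_0 R(2) lA by auto
  hence \<theta>0: "\<theta> x0 = x0" by (simp add: \<theta>_def)
  have d\<theta>: "dderiv \<theta> x v = v + R (dderiv \<Phi> x v - A v)" if "x \<in> S" "v \<in> E" for x v
  proof -
    have "((\<lambda>t. \<Phi> (x + t *\<^sub>R v)) has_vector_derivative dderiv \<Phi> x v) (at 0)"
      by (rule dderiv_line[OF S that d\<Phi>[OF that(1)]])
    moreover have "((\<lambda>t. A ((x + t *\<^sub>R v) - x0)) has_vector_derivative A (v - 0)) (at 0)"
      by (intro bounded_linear.has_vector_derivative[OF A(1)] has_vector_derivative_diff line_has_vector_derivative has_vector_derivative_const)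
    ultimately have "((\<lambda>t. \<theta> (x + t *\<^sub>R v)) has_vector_derivative v + R (dderiv \<Phi> x v - 0 - A (v - 0))) (at 0)"
      unfolding \<theta>_def
      by (intro has_vector_derivative_add line_has_vector_derivative bounded_linear.has_vector_derivative[OF bR]
          has_vector_derivative_diff has_vector_derivative_const)
    thus ?thesis unfolding dderiv_def[of \<theta>] by (simp add: vector_derivative_at)
  qed
  have id: "dderiv \<theta> x0 v = v" if "v \<in> E" for v using d\<theta>[OF x0 that] A(2)[OF that] \<open>R 0 = 0\<close> by simp
  have A\<theta>: "A (\<theta> x) = A x0 + \<Phi> x - \<Phi> x0" if "x \<in> S" for x
  proof -
    have "A (x - x0) \<in> E'" using dderiv_in_subspace[OF S x0 _ d\<Phi>[OF x0] E', of "x - x0"] \<Phi>(2) xE that x0 A(2)[of "x - x0"] E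
      by (auto intro: subspace_diff)
    hence "\<Phi> x - \<Phi> x0 - A (x - x0) \<in> E'" using \<Phi>(2) that x0 E' by (auto intro!: subspace_diff)
    thus ?thesis unfolding \<theta>_def using AR by (simp add: linear_add[OF lA] linear_diff[OF lA])
  qed
  have Ad: "A (dderiv \<theta> x v) = dderiv \<Phi> x v" if "x \<in> S" "v \<in> E" for x v
  proof -
    have "dderiv \<Phi> x v \<in> E'" "A v \<in> E'"
      using dderiv_in_subspace[OF S that d\<Phi>[OF that(1)] E'] dderiv_in_subspace[OF S x0 that(2) d\<Phi>[OF x0] E'] \<Phi>(2) A(2)[OF that(2)] by auto
    hence "dderiv \<Phi> x v - A v \<in> E'" using E' by (auto intro: subspace_diff)
    thus ?thesis unfolding d\<theta>[OF that] using AR by (simp add: linear_add[OF lA])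
  qed
  obtain U V \<Psi> where UV: "ropen E U" "U \<subseteq> S" "x0 \<in> U" "ropen E V" "homeomorphism U V \<theta> \<Psi>"
    "smooth_on E V \<Psi>" "\<And>x v. x \<in> U \<Longrightarrow> v \<in> E \<Longrightarrow> dderiv \<theta> x v = 0 \<Longrightarrow> v = 0"
    by (rule local_inverse[OF S x0 sm im id]) auto
  show ?thesis
    by (rule that[OF lA _ sm im \<theta>0 id A\<theta> Ad UV]) (use A(2) in auto)
qed

text \<open>The constant field \<open>u\<close> of the straightened coordinates is pulled back by
  \<theta>: then \<open>dderiv \<theta> x (W x) = u\<close>, and applying \<open>A\<close> gives
  \<open>dderiv \<Phi> x (W x) = A u\<close>, which is 0.\<close>

lemma vertical_extension:
  fixes \<Phi> :: "'e::euclidean_space \<Rightarrow> 'f::euclidean_space"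
  assumes S: "ropen E S" and E': "subspace E'" and \<Phi>: "smooth_on E S \<Phi>" "\<Phi> ` S \<subseteq> E'" and x0: "x0 \<in> S"
    and surj: "\<And>b. b \<in> E' \<Longrightarrow> \<exists>a\<in>E. dderiv \<Phi> x0 a = b"
    and u: "u \<in> E" "dderiv \<Phi> x0 u = 0"
  obtains U W where "ropen E U" "U \<subseteq> S" "x0 \<in> U" "W ` U \<subseteq> E" "smooth_on E U W" "W x0 = u"
    "\<And>x. x \<in> U \<Longrightarrow> dderiv \<Phi> x (W x) = 0"
proof -
  obtain A \<theta> U V \<Psi> where A: "linear A" "\<And>a. a \<in> E \<Longrightarrow> A a = dderiv \<Phi> x0 a"
    and \<theta>: "smooth_on E S \<theta>" "\<theta> ` S \<subseteq> E" "\<theta> x0 = x0" "\<And>v. v \<in> E \<Longrightarrow> dderiv \<theta> x0 v = v"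
    "\<And>x. x \<in> S \<Longrightarrow> A (\<theta> x) = A x0 + \<Phi> x - \<Phi> x0"
    "\<And>x v. x \<in> S \<Longrightarrow> v \<in> E \<Longrightarrow> A (dderiv \<theta> x v) = dderiv \<Phi> x v"
    and UV: "ropen E U" "U \<subseteq> S" "x0 \<in> U" "ropen E V" "homeomorphism U V \<theta> \<Psi>"
    "smooth_on E V \<Psi>" "\<And>x v. x \<in> U \<Longrightarrow> v \<in> E \<Longrightarrow> dderiv \<theta> x v = 0 \<Longrightarrow> v = 0"
    by (rule submersion_straighten[OF S E' \<Phi> x0 surj]) auto
  have h: "\<theta> ` U = V" "\<Psi> ` V = U" "\<And>x. x \<in> U \<Longrightarrow> \<Psi> (\<theta> x) = x" "\<And>y. y \<in> V \<Longrightarrow> \<theta> (\<Psi> y) = y"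
    using UV(5) by (auto simp: homeomorphism_def)
  define W where "W x = dderiv \<Psi> (\<theta> x) u" for x
  have \<theta>V: "\<theta> x \<in> V" if "x \<in> U" for x using h(1) that by auto
  have d\<Psi>: "\<Psi> differentiable (at y within V)" if "y \<in> V" for y by (rule smooth_on_differentiable[OF UV(6) that])
  have WE: "W x \<in> E" if "x \<in> U" for x unfolding W_def
    by (rule dderiv_in_subspace[OF UV(4) \<theta>V[OF that] u(1) d\<Psi>[OF \<theta>V[OF that]]])
       (use S h(2) ropen_subset[OF UV(1)] in \<open>auto simp: ropen_def\<close>)
  have d\<theta>W: "dderiv \<theta> x (W x) = u" if x: "x \<in> U" for x
  proof -
    have "dderiv (\<lambda>y. \<theta> (\<Psi> y)) (\<theta> x) u = dderiv \<theta> (\<Psi> (\<theta> x)) (dderiv \<Psi> (\<theta> x) u)"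
      by (rule dderiv_compose(1)[OF UV(4) \<theta>V[OF x] u(1) d\<Psi>[OF \<theta>V[OF x]] S])
         (use h UV(2) x smooth_on_differentiable[OF \<theta>(1)] in auto)
    moreover have "dderiv (\<lambda>y. \<theta> (\<Psi> y)) (\<theta> x) u = dderiv (\<lambda>y. y) (\<theta> x) u"
      by (rule dderiv_cong[OF UV(4) \<theta>V[OF x] u(1) h(4)])
    ultimately show ?thesis using h(3)[OF x] by (simp add: W_def)
  qed
  show ?thesis
  proof (rule that[OF UV(1-3)])
    show "W ` U \<subseteq> E" using WE by auto
    show "smooth_on E U W" unfolding W_def
      by (rule smooth_on_compose[OF UV(1,4) _ smooth_on_subset[OF \<theta>(1) UV(2)] smooth_on_dderiv[OF UV(6) u(1)]]) (use \<theta>V in auto)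
    show "W x0 = u" using d\<theta>W[OF UV(3)] \<theta>(4)[OF WE[OF UV(3)]] by simp
    show "dderiv \<Phi> x (W x) = 0" if "x \<in> U" for x
      using \<theta>(6)[of x "W x"] d\<theta>W[OF that] WE[OF that] UV(2) that A(2)[OF u(1)] u(2) by auto
  qed
qed

section \<open>Charts and tangent vectors\<close>

lemma chart_inv_in: "x \<in> chart_ran c \<Longrightarrow> chart_inv c x \<in> chart_dom c"
  by (rule inv_into_into)

lemma chart_map_inv: "x \<in> chart_ran c \<Longrightarrow> chart_map c (chart_inv c x) = x"
  by (rule f_inv_into_f)

lemma is_chart_ropen: "is_chart T E c \<Longrightarrow> subspace E \<Longrightarrow> ropen E (chart_ran c)"
  by (simp add: is_chart_def ropen_def)

lemma is_chart_dom_subset: "is_chart T E c \<Longrightarrow> chart_dom c \<subseteq> topspace T"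
  by (simp add: is_chart_def openin_subset)

lemma is_chart_topspace: "is_chart T E c \<Longrightarrow> topspace (subtopology T (chart_dom c)) = chart_dom c"
  using is_chart_dom_subset by (fastforce simp: topspace_subtopology)

lemma chart_inv_map: "is_chart T E c \<Longrightarrow> q \<in> chart_dom c \<Longrightarrow> chart_inv c (chart_map c q) = q"
  using homeomorphic_imp_injective_map[of "subtopology T (chart_dom c)" _ "chart_map c"] is_chart_topspace[of T E c]
  by (auto simp: is_chart_def intro!: inv_into_f_f)

lemma chart_continuous: "is_chart T E c \<Longrightarrow> continuous_map (subtopology T (chart_dom c)) (top_of_set (chart_ran c)) (chart_map c)"
  by (auto simp: is_chart_def homeomorphic_imp_continuous_map)

lemma chart_inv_continuous:
  assumes "is_chart T E c"
  shows "continuous_map (top_of_set (chart_ran c)) (subtopology T (chart_dom c)) (chart_inv c)"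
proof -
  obtain h where h: "homeomorphic_maps (subtopology T (chart_dom c)) (top_of_set (chart_ran c)) (chart_map c) h"
    using assms by (auto simp: is_chart_def homeomorphic_map_maps)
  hence "continuous_map (top_of_set (chart_ran c)) (subtopology T (chart_dom c)) h"
    by (simp add: homeomorphic_maps_def)
  moreover have "h x = chart_inv c x" if "x \<in> chart_ran c" for x
  proof -
    have "h (chart_map c (chart_inv c x)) = chart_inv c x"
      using h chart_inv_in[OF that] is_chart_topspace[OF assms] unfolding homeomorphic_maps_def by metis
    thus ?thesis using chart_map_inv[OF that] by simp
  qed
  ultimately show ?thesis by (rule continuous_map_eq) simp
qed

lemma chart_open_image:
  assumes c: "is_chart T E c" and U: "openin T U"
  shows "openin (top_of_set E) (chart_map c ` (chart_dom c \<inter> U))"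
proof -
  have "openin (subtopology T (chart_dom c)) (chart_dom c \<inter> U)"
    using U by (metis inf_commute openin_subtopology)
  hence "openin (top_of_set (chart_ran c)) (chart_map c ` (chart_dom c \<inter> U))"
    using c homeomorphic_imp_open_map unfolding is_chart_def open_map_def by blast
  thus ?thesis using c openin_trans unfolding is_chart_def by blast
qed

lemma chart_open_preimage:
  assumes c: "is_chart T E c" and W: "openin (top_of_set E) W"
  shows "openin T {q \<in> chart_dom c. chart_map c q \<in> W}"
proof -
  obtain U where U: "open U" "W = E \<inter> U" using W by (auto simp: openin_open)
  have "chart_ran c \<subseteq> E" using c by (auto simp: is_chart_def dest: openin_imp_subset)
  hence "W \<inter> chart_ran c = chart_ran c \<inter> U" using U by auto
  hence "openin (top_of_set (chart_ran c)) (W \<inter> chart_ran c)" using U by (auto simp: openin_open)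
  from openin_continuous_map_preimage[OF chart_continuous[OF c] this]
  have "openin (subtopology T (chart_dom c)) {q \<in> chart_dom c. chart_map c q \<in> W \<inter> chart_ran c}"
    unfolding is_chart_topspace[OF c] .
  moreover have "{q \<in> chart_dom c. chart_map c q \<in> W \<inter> chart_ran c} = {q \<in> chart_dom c. chart_map c q \<in> W}" by auto
  ultimately show ?thesis using c by (auto simp: is_chart_def openin_open_subtopology)
qed

lemma chart_ran_subset: "is_chart T E c \<Longrightarrow> chart_ran c \<subseteq> E"
  by (auto simp: is_chart_def dest: openin_imp_subset)

text \<open>Smoothness of the transition maps near each point is all that the tangent calculus needs; the atlas of
  a fibre satisfies it by the inverse function theorem.\<close>

definition smooth_atlas :: "('p, 'e::euclidean_space) manifold \<Rightarrow> bool" where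
  "smooth_atlas M \<longleftrightarrow> subspace (model M) \<and> (\<forall>c\<in>atlas M. is_chart (mtop M) (model M) c) \<and>
     (\<forall>p. \<forall>c\<in>charts_at M p. \<forall>d\<in>charts_at M p. \<exists>W. ropen (model M) W \<and> chart_map c p \<in> W \<and>
        W \<subseteq> chart_map c ` (chart_dom c \<inter> chart_dom d) \<and> smooth_on (model M) W (chart_map d \<circ> chart_inv c))"

lemma smooth_manifold_atlas:
  assumes "smooth_manifold M"
  shows "smooth_atlas M"
  unfolding smooth_atlas_def
proof (intro conjI ballI allI)
  show E: "subspace (model M)" using assms by (simp add: smooth_manifold_def)
  show ch: "is_chart (mtop M) (model M) c" if "c \<in> atlas M" for c
    using assms that by (simp add: smooth_manifold_def)
  fix p c d assume cd: "c \<in> charts_at M p" "d \<in> charts_at M p"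
  hence cd': "c \<in> atlas M" "d \<in> atlas M" "p \<in> chart_dom c" "p \<in> chart_dom d" by (auto simp: charts_at_def)
  have "ropen (model M) (chart_map c ` (chart_dom c \<inter> chart_dom d))"
    using chart_open_image[OF ch[OF cd'(1)], of "chart_dom d"] ch[OF cd'(2)] E cd' by (auto simp: ropen_def is_chart_def)
  moreover have "smooth_on (model M) (chart_map c ` (chart_dom c \<inter> chart_dom d)) (chart_map d \<circ> chart_inv c)"
    using assms cd' by (auto simp: smooth_manifold_def)
  ultimately show "\<exists>W. ropen (model M) W \<and> chart_map c p \<in> W \<and>
        W \<subseteq> chart_map c ` (chart_dom c \<inter> chart_dom d) \<and> smooth_on (model M) W (chart_map d \<circ> chart_inv c)"
    using cd' by blast
qed

context
  fixes M :: "('p, 'e::euclidean_space) manifold" and E :: "'e set"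
  assumes M: "smooth_atlas M" and E_def: "E = model M"
begin

lemma E_subspace: "subspace E" using M by (simp add: smooth_atlas_def E_def)

lemma charts_at_chart: "c \<in> charts_at M p \<Longrightarrow> is_chart (mtop M) E c"
  using M by (simp add: smooth_atlas_def charts_at_def E_def)

lemma atlas_chart: "c \<in> atlas M \<Longrightarrow> is_chart (mtop M) E c"
  using M by (simp add: smooth_atlas_def E_def)

lemma charts_at_ropen: "c \<in> charts_at M p \<Longrightarrow> ropen E (chart_ran c)"
  using is_chart_ropen[OF charts_at_chart E_subspace] .

lemma charts_at_dom: "c \<in> charts_at M p \<Longrightarrow> p \<in> chart_dom c"
  by (simp add: charts_at_def)

lemma charts_at_inv: "c \<in> charts_at M p \<Longrightarrow> chart_inv c (chart_map c p) = p"
  using chart_inv_map[OF charts_at_chart charts_at_dom] .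

text \<open>\<open>smooth_at\<close> asserts smoothness in one chart only; the transition map
  carries it to every chart at \<open>p\<close>.\<close>

lemma smooth_at_in_chart:
  assumes c: "c \<in> charts_at M p" and h: "smooth_at M p h"
  obtains W where "ropen E W" "chart_map c p \<in> W" "W \<subseteq> chart_ran c" "smooth_on E W (\<lambda>x. h (chart_inv c x))"
proof -
  obtain d W' where d: "d \<in> charts_at M p" and W': "ropen E W'" "chart_map d p \<in> W'" "W' \<subseteq> chart_ran d"
    "smooth_on E W' (h \<circ> chart_inv d)"
    using h E_subspace by (auto simp: smooth_at_def ropen_def E_def)
  obtain W where W: "ropen E W" "chart_map c p \<in> W" "W \<subseteq> chart_map c ` (chart_dom c \<inter> chart_dom d)"
    "smooth_on E W (chart_map d \<circ> chart_inv c)"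
    using M c d unfolding smooth_atlas_def E_def by meson
  let ?t = "chart_map d \<circ> chart_inv c"
  have inv: "chart_inv c x \<in> chart_dom d" if "x \<in> W" for x
    using W(3) that chart_inv_map[OF charts_at_chart[OF c]] by auto
  have tE: "?t ` W \<subseteq> E" using inv chart_ran_subset[OF charts_at_chart[OF d]] by auto
  have W2: "ropen E (W \<inter> ?t -` W')"
    by (rule ropen_preimage[OF W(1) smooth_on_continuous[OF W(4)] tE W'(1)])
  have "smooth_on E (W \<inter> ?t -` W') (\<lambda>x. (h \<circ> chart_inv d) (?t x))"
    by (rule smooth_on_compose[OF W2 W'(1) _ smooth_on_subset[OF W(4)] W'(4)]) auto
  hence "smooth_on E (W \<inter> ?t -` W') (\<lambda>x. h (chart_inv c x))"
    by (subst (asm) smooth_on_cong[OF W2, where g="\<lambda>x. h (chart_inv c x)"])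
       (use chart_inv_map[OF charts_at_chart[OF d]] inv in auto)
  moreover have "chart_map c p \<in> W \<inter> ?t -` W'" using W(2) W'(2) charts_at_inv[OF c] by simp
  moreover have "W \<inter> ?t -` W' \<subseteq> chart_ran c" using W(3) by auto
  ultimately show ?thesis using that W2 by blast
qed

lemma smooth_at_coordinate:
  assumes c: "c \<in> charts_at M p"
  shows "smooth_at M p (\<lambda>q. chart_map c q \<bullet> e)"
proof -
  note r = charts_at_ropen[OF c]
  have "smooth_on E (chart_ran c) (\<lambda>x. x \<bullet> e)"
    by (intro smooth_on_bounded_linear[OF bounded_linear_inner_left r] smooth_on_id)
  hence "smooth_on E (chart_ran c) ((\<lambda>q. chart_map c q \<bullet> e) \<circ> chart_inv c)"
    by (subst smooth_on_cong[OF r, where g="\<lambda>x. x \<bullet> e"]) (auto simp: chart_map_inv)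
  moreover have "chart_map c p \<in> chart_ran c" using charts_at_dom[OF c] by simp
  ultimately show ?thesis
    using c r unfolding smooth_at_def ropen_def E_def by blast
qed

lemma coord_vec_coordinate:
  assumes c: "c \<in> charts_at M p" and a: "a \<in> E"
  shows "coord_vec M c p a (\<lambda>q. chart_map c q \<bullet> e) = a \<bullet> e"
proof -
  have x: "chart_map c p \<in> chart_ran c" using charts_at_dom[OF c] by simp
  have "dderiv ((\<lambda>q. chart_map c q \<bullet> e) \<circ> chart_inv c) (chart_map c p) a = dderiv (\<lambda>x. x \<bullet> e) (chart_map c p) a"
    by (rule dderiv_cong[OF charts_at_ropen[OF c] x a]) (auto simp: chart_map_inv)
  also have "\<dots> = dderiv (\<lambda>x. x) (chart_map c p) a \<bullet> e"
    by (rule dderiv_bounded_linear[OF bounded_linear_inner_left charts_at_ropen[OF c] x a])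
       (rule smooth_on_differentiable[OF smooth_on_id x])
  finally show ?thesis using smooth_at_coordinate[OF c] by (simp add: coord_vec_def)
qed

text \<open>Coordinate functions of the chart are smooth near \<open>p\<close>, and a tangent vector
  applied to them returns its components.\<close>

lemma coord_vec_inj:
  assumes c: "c \<in> charts_at M p" and ab: "a \<in> E" "b \<in> E" "coord_vec M c p a = coord_vec M c p b"
  shows "a = b"
  using coord_vec_coordinate[OF c ab(1)] coord_vec_coordinate[OF c ab(2)] ab(3)
  by (metis euclidean_eqI)

lemma coord_vec_linear:
  assumes c: "c \<in> charts_at M p" and ab: "a \<in> E" "b \<in> E"
  shows "coord_vec M c p (s *\<^sub>R a + t *\<^sub>R b) = (\<lambda>h. s * coord_vec M c p a h + t * coord_vec M c p b h)"
proof
  fix h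
  show "coord_vec M c p (s *\<^sub>R a + t *\<^sub>R b) h = s * coord_vec M c p a h + t * coord_vec M c p b h"
  proof (cases "smooth_at M p h")
    case True
    obtain W where W: "ropen E W" "chart_map c p \<in> W" "smooth_on E W (\<lambda>x. h (chart_inv c x))"
      by (rule smooth_at_in_chart[OF c True]) auto
    obtain L where L: "bounded_linear L" "\<And>v. v \<in> E \<Longrightarrow> dderiv (\<lambda>x. h (chart_inv c x)) (chart_map c p) v = L v"
      by (rule dderiv_linear[OF W(1,2) smooth_on_differentiable[OF W(3,2)]]) auto
    note lL = bounded_linear.linear[OF L(1)]
    have "s *\<^sub>R a + t *\<^sub>R b \<in> E" using ab E_subspace by (auto intro: subspace_add subspace_scale)
    thus ?thesis using True ab by (simp add: coord_vec_def comp_def L(2) linear_add[OF lL] linear_scale[OF lL])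
  qed (simp add: coord_vec_def)
qed

lemma coord_vec_zero:
  assumes c: "c \<in> charts_at M p"
  shows "coord_vec M c p 0 = (\<lambda>h. 0)"
  using coord_vec_linear[OF c, of 0 0 0 0] subspace_0[OF E_subspace] by simp

lemma coord_vec_eq_zero:
  assumes c: "c \<in> charts_at M p" and a: "a \<in> E"
  shows "coord_vec M c p a = (\<lambda>h. 0) \<longleftrightarrow> a = 0"
  using coord_vec_inj[OF c a subspace_0[OF E_subspace]] coord_vec_zero[OF c] by metis

lemma coord_vec_diff:
  assumes c: "c \<in> charts_at M p" and ab: "a \<in> E" "b \<in> E"
  shows "coord_vec M c p (a - b) = (\<lambda>h. coord_vec M c p a h - coord_vec M c p b h)"
  using coord_vec_linear[OF c ab, of 1 "-1"] by simp

lemma coord_vec_in: "c \<in> charts_at M p \<Longrightarrow> a \<in> E \<Longrightarrow> coord_vec M c p a \<in> tangent_space M p"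
  unfolding tangent_space_def E_def by blast

lemma components_coord_vec:
  assumes "c \<in> charts_at M p" "a \<in> E"
  shows "components M c p (coord_vec M c p a) = a"
  unfolding components_def using coord_vec_inj[OF assms(1)] assms by (auto simp: E_def)

end

lemma smooth_at_compose:
  fixes \<phi> :: "'p \<Rightarrow> 'q" and M :: "('p, 'e::euclidean_space) manifold" and B :: "('q, 'b::euclidean_space) manifold"
  assumes M: "smooth_atlas M" and B: "smooth_atlas B"
    and c: "c \<in> charts_at M q" and d: "d \<in> charts_at B (\<phi> q)"
    and W: "ropen (model M) W" "chart_map c q \<in> W" "W \<subseteq> chart_ran c"
    and \<phi>: "\<And>x. x \<in> W \<Longrightarrow> \<phi> (chart_inv c x) \<in> chart_dom d" "smooth_on (model M) W (\<lambda>x. chart_map d (\<phi> (chart_inv c x)))"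
    and h: "smooth_at B (\<phi> q) h"
  shows "smooth_at M q (h \<circ> \<phi>)"
    "a \<in> model M \<Longrightarrow> dderiv (h \<circ> \<phi> \<circ> chart_inv c) (chart_map c q) a =
       dderiv (h \<circ> chart_inv d) (chart_map d (\<phi> q)) (dderiv (\<lambda>x. chart_map d (\<phi> (chart_inv c x))) (chart_map c q) a)"
proof -
  let ?t = "\<lambda>x. chart_map d (\<phi> (chart_inv c x))"
  obtain W' where W': "ropen (model B) W'" "chart_map d (\<phi> q) \<in> W'" "W' \<subseteq> chart_ran d"
    "smooth_on (model B) W' (\<lambda>x. h (chart_inv d x))"
    by (rule smooth_at_in_chart[OF B refl d h])
  have tE: "?t ` W \<subseteq> model B" using \<phi>(1) chart_ran_subset[OF charts_at_chart[OF B refl d]] by auto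
  have W2: "ropen (model M) (W \<inter> ?t -` W')"
    by (rule ropen_preimage[OF W(1) smooth_on_continuous[OF \<phi>(2)] tE W'(1)])
  have eq: "h (chart_inv d (?t x)) = (h \<circ> \<phi> \<circ> chart_inv c) x" if "x \<in> W" for x
    using chart_inv_map[OF charts_at_chart[OF B refl d] \<phi>(1)[OF that]] by simp
  have q: "chart_map c q \<in> W \<inter> ?t -` W'" using W(2) W'(2) charts_at_inv[OF M refl c] by simp
  note sm = smooth_on_subset[OF \<phi>(2), of "W \<inter> ?t -` W'"]
  have "smooth_on (model M) (W \<inter> ?t -` W') (\<lambda>x. h (chart_inv d (?t x)))"
    by (rule smooth_on_compose[OF W2 W'(1) _ sm W'(4)]) auto
  hence "smooth_on (model M) (W \<inter> ?t -` W') ((h \<circ> \<phi>) \<circ> chart_inv c)"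
    by (subst (asm) smooth_on_cong[OF W2, where g="(h \<circ> \<phi>) \<circ> chart_inv c"]) (use eq in auto)
  thus "smooth_at M q (h \<circ> \<phi>)"
    using c q W2 W(3) unfolding smooth_at_def ropen_def by blast
  assume a: "a \<in> model M"
  have "dderiv (h \<circ> \<phi> \<circ> chart_inv c) (chart_map c q) a = dderiv (\<lambda>x. h (chart_inv d (?t x))) (chart_map c q) a"
    by (rule dderiv_cong[OF W2 q a]) (use eq in auto)
  also have "\<dots> = dderiv (\<lambda>x. h (chart_inv d x)) (?t (chart_map c q)) (dderiv ?t (chart_map c q) a)"
    by (rule dderiv_compose(1)[OF W2 q a _ W'(1), where f="?t"])
       (use q smooth_on_differentiable[OF sm q] smooth_on_differentiable[OF W'(4)] in auto)
  finally show "dderiv (h \<circ> \<phi> \<circ> chart_inv c) (chart_map c q) a =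
       dderiv (h \<circ> chart_inv d) (chart_map d (\<phi> q)) (dderiv ?t (chart_map c q) a)"
    using charts_at_inv[OF M refl c] by (simp add: comp_def)
qed

text \<open>Used with three maps: the submersion, the identity between two charts of one manifold,
  and the inclusion of a fibre.\<close>

lemma differential_coord_vec:
  fixes \<phi> :: "'p \<Rightarrow> 'q" and M :: "('p, 'e::euclidean_space) manifold" and B :: "('q, 'b::euclidean_space) manifold"
  assumes M: "smooth_atlas M" and B: "smooth_atlas B"
    and c: "c \<in> charts_at M q" and d: "d \<in> charts_at B (\<phi> q)"
    and W: "ropen (model M) W" "chart_map c q \<in> W" "W \<subseteq> chart_ran c"
    and \<phi>: "\<And>x. x \<in> W \<Longrightarrow> \<phi> (chart_inv c x) \<in> chart_dom d" "smooth_on (model M) W (\<lambda>x. chart_map d (\<phi> (chart_inv c x)))"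
    and a: "a \<in> model M"
  shows "differential B \<phi> q (coord_vec M c q a) =
    coord_vec B d (\<phi> q) (dderiv (\<lambda>x. chart_map d (\<phi> (chart_inv c x))) (chart_map c q) a)"
proof
  fix h
  show "differential B \<phi> q (coord_vec M c q a) h =
    coord_vec B d (\<phi> q) (dderiv (\<lambda>x. chart_map d (\<phi> (chart_inv c x))) (chart_map c q) a) h"
    using smooth_at_compose[OF M B c d W \<phi>, of h] a
    by (auto simp: differential_def coord_vec_def)
qed

lemma differential_id_coord_vec:
  assumes "c \<in> charts_at M p"
  shows "differential M id p (coord_vec M c p a) = coord_vec M c p a"
  by (auto simp: differential_def coord_vec_def)

text \<open>Tangent vectors may be given in any chart at \<open>p\<close>. The differential of
  \<open>id\<close> fixes them, and its coordinate expression is the change of components.\<close>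

lemma tangent_space_chart:
  assumes M: "smooth_atlas M" and c: "c \<in> charts_at M p" and v: "v \<in> tangent_space M p"
  obtains a where "a \<in> model M" "v = coord_vec M c p a"
proof -
  obtain d b where d: "d \<in> charts_at M p" "b \<in> model M" "v = coord_vec M d p b"
    using v by (auto simp: tangent_space_def)
  obtain W where W: "ropen (model M) W" "chart_map d p \<in> W" "W \<subseteq> chart_map d ` (chart_dom d \<inter> chart_dom c)"
    "smooth_on (model M) W (chart_map c \<circ> chart_inv d)"
    using M c d(1) unfolding smooth_atlas_def by meson
  have inv: "chart_inv d x \<in> chart_dom c" if "x \<in> W" for x
    using W(3) that chart_inv_map[OF charts_at_chart[OF M refl d(1)]] by auto
  have "differential M id p (coord_vec M d p b) =
      coord_vec M c (id p) (dderiv (\<lambda>x. chart_map c (id (chart_inv d x))) (chart_map d p) b)"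
    by (rule differential_coord_vec[OF M M d(1) _ W(1,2) _ _ _ d(2)]) (use c inv W(3,4) in \<open>auto simp: comp_def\<close>)
  moreover have "dderiv (\<lambda>x. chart_map c (id (chart_inv d x))) (chart_map d p) b \<in> model M"
    by (rule dderiv_in_subspace[OF W(1,2) d(2) _ E_subspace[OF M refl]])
       (use W(4) smooth_on_differentiable[OF W(4,2)] inv chart_ran_subset[OF charts_at_chart[OF M refl c]] in \<open>auto simp: comp_def\<close>)
  ultimately show ?thesis using that d(3) differential_id_coord_vec[OF d(1)] by auto
qed

section \<open>Riemannian manifolds in charts\<close>

lemma metric_coord_at:
  assumes M: "smooth_atlas M" and c: "c \<in> charts_at M p"
  shows "metric_coord M g c (chart_map c p) a b = g p (coord_vec M c p a) (coord_vec M c p b)"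
  using charts_at_inv[OF M refl c] by (simp add: metric_coord_def)

lemma charts_at_chart_inv: "c \<in> atlas M \<Longrightarrow> x \<in> chart_ran c \<Longrightarrow> c \<in> charts_at M (chart_inv c x)"
  using chart_inv_in[of x c] by (simp add: charts_at_def)

lemma riemannian_local_metric:
  assumes "riemannian_manifold M g" and c: "c \<in> atlas M"
  shows "local_metric (model M) (chart_ran c) (metric_coord M g c)"
proof -
  have M: "smooth_atlas M" and g: "riemannian_metric M g"
    using assms(1) smooth_manifold_atlas by (auto simp: riemannian_manifold_def)
  note ca = charts_at_chart_inv[OF c]
  have p: "chart_inv c x \<in> points M" if "x \<in> chart_ran c" for x
    using chart_inv_in[OF that] is_chart_dom_subset[OF atlas_chart[OF M refl c]] by auto
  have sym: "metric_coord M g c x a b = metric_coord M g c x b a" if "x \<in> chart_ran c" "a \<in> model M" "b \<in> model M" for x a b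
    using g p[OF that(1)] coord_vec_in[OF M refl ca[OF that(1)]] that
    by (simp add: metric_coord_def Let_def riemannian_metric_def)
  have left: "metric_coord M g c x (s *\<^sub>R a + t *\<^sub>R b) d = s *\<^sub>R metric_coord M g c x a d + t *\<^sub>R metric_coord M g c x b d"
    if "x \<in> chart_ran c" "a \<in> model M" "b \<in> model M" "d \<in> model M" for x a b d s t
  proof -
    note tv = coord_vec_in[OF M refl ca[OF that(1)]]
    have "\<forall>u\<in>tangent_space M (chart_inv c x). \<forall>v\<in>tangent_space M (chart_inv c x). \<forall>w\<in>tangent_space M (chart_inv c x). \<forall>a b.
        g (chart_inv c x) (\<lambda>h. a * u h + b * v h) w = a * g (chart_inv c x) u w + b * g (chart_inv c x) v w"
      using g p[OF that(1)] unfolding riemannian_metric_def by blast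
    from this[rule_format, OF tv[OF that(2)] tv[OF that(3)] tv[OF that(4)], of s t]
    show ?thesis by (simp add: metric_coord_def Let_def coord_vec_linear[OF M refl ca[OF that(1)] that(2,3)])
  qed
  show ?thesis
  proof
    show "ropen (model M) (chart_ran c)" by (rule is_chart_ropen[OF atlas_chart[OF M refl c] E_subspace[OF M refl]])
    show "smooth_on (model M) (chart_ran c) (\<lambda>x. metric_coord M g c x a b)" if "a \<in> model M" "b \<in> model M" for a b
      using g c that by (auto simp: riemannian_metric_def)
    show "metric_coord M g c x d (s *\<^sub>R a + t *\<^sub>R b) = s *\<^sub>R metric_coord M g c x d a + t *\<^sub>R metric_coord M g c x d b"
      if "x \<in> chart_ran c" "a \<in> model M" "b \<in> model M" "d \<in> model M" for x a b d s t
      using left[OF that] sym[OF that(1)] that E_subspace[OF M refl] by (simp add: subspace_add subspace_scale)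
    show "metric_coord M g c x a a > 0" if "x \<in> chart_ran c" "a \<in> model M" "a \<noteq> 0" for x a
      using g p[OF that(1)] coord_vec_in[OF M refl ca[OF that(1)] that(2)] coord_vec_eq_zero[OF M refl ca[OF that(1)] that(2)] that
      by (simp add: metric_coord_def Let_def riemannian_metric_def)
  qed (use sym left in auto)
qed

lemma velocity_chart:
  assumes M: "smooth_atlas M" and c: "c \<in> atlas M"
    and x: "(x has_vector_derivative x') (at t)" "\<forall>\<^sub>F s in nhds t. x s \<in> chart_ran c"
  shows "velocity M (\<lambda>t. chart_inv c (x t)) t = coord_vec M c (chart_inv c (x t)) x'"
proof
  have xt: "x t \<in> chart_ran c" using eventually_nhds_x_imp_x[OF x(2)] .
  note ca = charts_at_chart_inv[OF c xt]
  fix h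
  show "velocity M (\<lambda>t. chart_inv c (x t)) t h = coord_vec M c (chart_inv c (x t)) x' h"
  proof (cases "smooth_at M (chart_inv c (x t)) h")
    case True
    obtain W where W: "ropen (model M) W" "chart_map c (chart_inv c (x t)) \<in> W" "W \<subseteq> chart_ran c"
      "smooth_on (model M) W (\<lambda>x. h (chart_inv c x))"
      by (rule smooth_at_in_chart[OF M refl ca True])
    have xW: "x t \<in> W" using W(2) chart_map_inv[OF xt] by simp
    obtain U where U: "open U" "W = model M \<inter> U" using W(1) by (auto simp: ropen_def openin_open)
    have "isCont x t" using has_vector_derivative_continuous[OF x(1)] .
    hence "\<forall>\<^sub>F s in nhds t. x s \<in> U"
      using U xW by (auto simp: continuous_at eventually_nhds_conv_at elim: topological_tendstoD)
    hence "\<forall>\<^sub>F s in nhds t. x s \<in> W"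
      using x(2) by eventually_elim (use U chart_ran_subset[OF atlas_chart[OF M refl c]] in auto)
    from dderiv_chain[OF W(1) smooth_on_differentiable[OF W(4) xW] x(1) this]
    show ?thesis using True chart_map_inv[OF xt] by (simp add: velocity_def coord_vec_def comp_def vector_derivative_at)
  qed (simp add: velocity_def coord_vec_def)
qed

text \<open>A geodesic asks at each time for the equation in some chart, for which \<open>c\<close>
  serves throughout. Smoothness is asked in every chart and comes from the transition maps.\<close>

lemma geodesic_lift:
  assumes M: "smooth_manifold M" and c: "c \<in> atlas M"
    and I: "open I" "is_interval I" and sm: "smooth_on UNIV I x"
    and x: "\<And>t. t \<in> I \<Longrightarrow> x t \<in> chart_ran c" "\<And>t. t \<in> I \<Longrightarrow> (x has_vector_derivative x' t) (at t)"
      "\<And>t. t \<in> I \<Longrightarrow> (x' has_vector_derivative - christoffel M g c (x t) (x' t) (x' t)) (at t)"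
  shows "geodesic M g I (\<lambda>t. chart_inv c (x t))"
proof -
  have A: "smooth_atlas M" by (rule smooth_manifold_atlas[OF M])
  note chc = atlas_chart[OF A refl c]
  let ?\<alpha> = "\<lambda>t. chart_inv c (x t)"
  have contx: "continuous_on I x" by (rule smooth_on_continuous[OF sm])
  have cont: "continuous_map (top_of_set I) (mtop M) ?\<alpha>"
  proof -
    have "continuous_map (top_of_set I) (top_of_set (chart_ran c)) x"
      using contx x(1) by (auto simp: continuous_map_in_subtopology)
    from continuous_map_compose[OF this chart_inv_continuous[OF chc]]
    show ?thesis by (simp add: comp_def continuous_map_in_subtopology)
  qed
  have "smooth_on UNIV {t \<in> I. ?\<alpha> t \<in> chart_dom d} (chart_map d \<circ> ?\<alpha>)" if d: "d \<in> atlas M" for d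
  proof -
    let ?J = "{t \<in> I. ?\<alpha> t \<in> chart_dom d}"
    note chd = atlas_chart[OF A refl d]
    have "openin (mtop M) (chart_dom d)" using chd by (simp add: is_chart_def)
    from openin_continuous_map_preimage[OF cont this] have "openin (top_of_set I) ?J" by simp
    hence J: "open ?J" using I(1) openin_open_trans by blast
    let ?S = "chart_map c ` (chart_dom c \<inter> chart_dom d)"
    have S: "ropen (model M) ?S"
      using chart_open_image[OF chc] chd E_subspace[OF A refl] by (simp add: ropen_def is_chart_def)
    have trans: "smooth_on (model M) ?S (chart_map d \<circ> chart_inv c)"
      using M c d by (auto simp: smooth_manifold_def)
    have "x t \<in> ?S" if "t \<in> ?J" for t
    proof -
      have tI: "t \<in> I" "?\<alpha> t \<in> chart_dom d" using that by auto
      have "chart_map c (?\<alpha> t) \<in> ?S" using chart_inv_in[OF x(1)[OF tI(1)]] tI(2) by (intro imageI) auto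
      thus ?thesis using chart_map_inv[OF x(1)[OF tI(1)]] by simp
    qed
    hence im: "x ` ?J \<subseteq> ?S" by blast
    have "ropen UNIV ?J" using J by simp
    from smooth_on_compose[OF this S im smooth_on_subset[OF sm] trans]
    have "smooth_on UNIV ?J (\<lambda>t. (chart_map d \<circ> chart_inv c) (x t))" by blast
    thus ?thesis by (simp add: comp_def)
  qed
  moreover have "let y = chart_map c \<circ> ?\<alpha>; y' = \<lambda>s. vector_derivative y (at s)
      in vector_derivative y' (at t) + christoffel M g c (y t) (y' t) (y' t) = 0" if t: "t \<in> I" for t
  proof -
    let ?y = "chart_map c \<circ> ?\<alpha>"
    have y: "?y s = x s" if "s \<in> I" for s using chart_map_inv[OF x(1)[OF that]] by simp
    have "(?y has_vector_derivative x' s) (at s)" if "s \<in> I" for s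
      by (rule has_vector_derivative_transform_within_open[OF x(2)[OF that] I(1) that]) (use y in simp)
    hence y': "vector_derivative ?y (at s) = x' s" if "s \<in> I" for s using that by (simp add: vector_derivative_at)
    have "((\<lambda>s. vector_derivative ?y (at s)) has_vector_derivative - christoffel M g c (x t) (x' t) (x' t)) (at t)"
      by (rule has_vector_derivative_transform_within_open[OF x(3)[OF t] I(1) t]) (use y' in simp)
    thus ?thesis using y[OF t] y'[OF t] by (simp add: vector_derivative_at Let_def)
  qed
  ultimately show ?thesis
    unfolding geodesic_def smooth_curve_def using I cont charts_at_chart_inv[OF c x(1)] by blast
qed

section \<open>The Clairaut condition in a chart\<close>

text \<open>Riesz representation on \<open>V\<close>, with \<open>G x\<close> restricted to
  \<open>V\<close> and viewed as a constant field of forms. It supplies the vertical part of a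
  vector.\<close>

lemma (in local_metric) orthogonal_decomposition:
  assumes x: "x \<in> S" and V: "subspace V" "V \<subseteq> E" and v: "v \<in> E"
  obtains w where "w \<in> V" "\<And>u. u \<in> V \<Longrightarrow> G x (v - w) u = 0"
proof -
  interpret V: local_metric V V "\<lambda>_. G x"
  proof
    show "ropen V V" using V(1) by (simp add: ropen_def)
    show "G x (s *\<^sub>R a + t *\<^sub>R b) c = s *\<^sub>R G x a c + t *\<^sub>R G x b c" if "a \<in> V" "b \<in> V" "c \<in> V" for a b c s t
      using that V x by (intro left) auto
    show "G x c (s *\<^sub>R a + t *\<^sub>R b) = s *\<^sub>R G x c a + t *\<^sub>R G x c b" if "a \<in> V" "b \<in> V" "c \<in> V" for a b c s t
      using that V x by (intro right) auto
    show "G x a b = G x b a" if "a \<in> V" "b \<in> V" for a b using that V x by (intro sym) auto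
    show "0 < G x a a" if "a \<in> V" "a \<noteq> 0" for a using that V x by (intro pos) auto
  qed (rule smooth_on_const)
  have "linear (\<lambda>z. G x v (proj V z))"
    using proj_in[OF V(1)] V(2) x v linear_proj[of V]
    by (intro linearI) (simp_all add: linear_add linear_scale add_right scale_right subset_iff)
  from V.riesz[OF subspace_0[OF V(1)] this] obtain w where
    w: "w \<in> V" "\<And>z. z \<in> V \<Longrightarrow> G x w z = G x v (proj V z)" by blast
  show ?thesis
  proof (rule that[OF w(1)])
    fix u assume u: "u \<in> V"
    have "w \<in> E" "u \<in> E" using w(1) u V(2) by auto
    thus "G x (v - w) u = 0" using w(2)[OF u] proj_id[OF V(1) u] x v by (simp add: diff_left)
  qed
qed

definition vcoord ::
  "('p, 'e::euclidean_space) manifold \<Rightarrow> ('q, 'b::euclidean_space) manifold \<Rightarrow> ('p \<Rightarrow> 'q) \<Rightarrow> ('p, 'e) chart \<Rightarrow> 'e \<Rightarrow> 'e set" where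
  "vcoord M B F c x = {a \<in> model M. coord_vec M c (chart_inv c x) a \<in> vertical M B F (chart_inv c x)}"

lemma vcoord_subspace:
  assumes M: "smooth_atlas M" and c: "c \<in> atlas M" and x: "x \<in> chart_ran c"
  shows "subspace (vcoord M B F c x)"
proof -
  note ca = charts_at_chart_inv[OF c x]
  note E = E_subspace[OF M refl]
  have lin: "s *\<^sub>R a + t *\<^sub>R b \<in> vcoord M B F c x" if "a \<in> vcoord M B F c x" "b \<in> vcoord M B F c x" for a b s t
  proof -
    have ab: "a \<in> model M" "b \<in> model M" using that by (auto simp: vcoord_def)
    have "differential B F (chart_inv c x) (coord_vec M c (chart_inv c x) a) = (\<lambda>h. 0)"
      "differential B F (chart_inv c x) (coord_vec M c (chart_inv c x) b) = (\<lambda>h. 0)"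
      using that by (auto simp: vcoord_def vertical_def)
    hence "differential B F (chart_inv c x) (coord_vec M c (chart_inv c x) (s *\<^sub>R a + t *\<^sub>R b)) = (\<lambda>h. 0)"
      unfolding coord_vec_linear[OF M refl ca ab] differential_def fun_eq_iff
      by (metis mult_zero_right add.right_neutral)
    moreover have "s *\<^sub>R a + t *\<^sub>R b \<in> model M" using ab E by (simp add: subspace_add subspace_scale)
    ultimately show ?thesis using coord_vec_in[OF M refl ca] by (simp add: vcoord_def vertical_def)
  qed
  have 0: "0 \<in> vcoord M B F c x"
    using subspace_0[OF E] coord_vec_in[OF M refl ca subspace_0[OF E]]
    by (auto simp: vcoord_def vertical_def coord_vec_zero[OF M refl ca] differential_def)
  show ?thesis unfolding subspace_def
    using 0 lin[of _ _ 1 1] lin[OF _ 0, of _ _ 0] by simp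
qed

lemma vertical_vcoord:
  assumes M: "smooth_atlas M" and c: "c \<in> atlas M" and x: "x \<in> chart_ran c"
    and v: "v \<in> vertical M B F (chart_inv c x)"
  obtains a where "a \<in> vcoord M B F c x" "v = coord_vec M c (chart_inv c x) a"
proof -
  have "v \<in> tangent_space M (chart_inv c x)" using v by (simp add: vertical_def)
  then obtain a where "a \<in> model M" "v = coord_vec M c (chart_inv c x) a"
    by (rule tangent_space_chart[OF M charts_at_chart_inv[OF c x]])
  thus ?thesis using that v by (simp add: vcoord_def)
qed

context
  fixes M :: "('p, 'e::euclidean_space) manifold" and g :: "'p metric_field" and c :: "('p, 'e) chart"
    and B :: "('q, 'b::euclidean_space) manifold" and F :: "'p \<Rightarrow> 'q"
  assumes Mg: "riemannian_manifold M g" and c: "c \<in> atlas M"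
begin

lemma M_atlas: "smooth_atlas M" using Mg smooth_manifold_atlas by (auto simp: riemannian_manifold_def)

interpretation G: local_metric "model M" "chart_ran c" "metric_coord M g c"
  by (rule riemannian_local_metric[OF Mg c])

lemma vcoord_subset: "a \<in> vcoord M B F c x \<Longrightarrow> a \<in> model M" by (simp add: vcoord_def)

lemma horizontal_coord:
  assumes x: "x \<in> chart_ran c" and b: "b \<in> model M"
  shows "coord_vec M c (chart_inv c x) b \<in> horizontal M g B F (chart_inv c x) \<longleftrightarrow>
    (\<forall>u\<in>vcoord M B F c x. metric_coord M g c x b u = 0)"
proof
  assume "coord_vec M c (chart_inv c x) b \<in> horizontal M g B F (chart_inv c x)"
  thus "\<forall>u\<in>vcoord M B F c x. metric_coord M g c x b u = 0"
    by (auto simp: horizontal_def vcoord_def metric_coord_def Let_def)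
next
  assume *: "\<forall>u\<in>vcoord M B F c x. metric_coord M g c x b u = 0"
  have "g (chart_inv c x) (coord_vec M c (chart_inv c x) b) w = 0" if "w \<in> vertical M B F (chart_inv c x)" for w
    by (rule vertical_vcoord[OF M_atlas c x that]) (use * in \<open>auto simp: metric_coord_def Let_def\<close>)
  thus "coord_vec M c (chart_inv c x) b \<in> horizontal M g B F (chart_inv c x)"
    using coord_vec_in[OF M_atlas refl charts_at_chart_inv[OF c x] b] by (simp add: horizontal_def)
qed

lemma horizontal_part_coord:
  assumes x: "x \<in> chart_ran c" and v: "v \<in> model M" and w: "w \<in> vcoord M B F c x"
    and orth: "\<And>u. u \<in> vcoord M B F c x \<Longrightarrow> metric_coord M g c x (v - w) u = 0"
  shows "horizontal_part M g B F (chart_inv c x) (coord_vec M c (chart_inv c x) v) = coord_vec M c (chart_inv c x) (v - w)"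
proof -
  let ?q = "chart_inv c x"
  note ca = charts_at_chart_inv[OF c x]
  note sub = vcoord_subspace[OF M_atlas c x, of B F]
  have wE: "w \<in> model M" "v - w \<in> model M" using vcoord_subset[OF w] v by auto
  show ?thesis unfolding horizontal_part_def
  proof (rule the_equality, intro conjI)
    show "coord_vec M c ?q (v - w) \<in> horizontal M g B F ?q"
      using horizontal_coord[OF x wE(2)] orth by simp
    have "(\<lambda>h. coord_vec M c ?q v h - coord_vec M c ?q (v - w) h) = coord_vec M c ?q w"
      using coord_vec_diff[OF M_atlas refl ca v wE(2)] by simp
    thus "(\<lambda>h. coord_vec M c ?q v h - coord_vec M c ?q (v - w) h) \<in> vertical M B F ?q"
      using w by (simp add: vcoord_def)
    fix y assume y: "y \<in> horizontal M g B F ?q \<and> (\<lambda>h. coord_vec M c ?q v h - y h) \<in> vertical M B F ?q"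
    have "y \<in> tangent_space M ?q" using y by (simp add: horizontal_def)
    then obtain b where b: "b \<in> model M" "y = coord_vec M c ?q b" by (rule tangent_space_chart[OF M_atlas ca])
    have bV: "v - b \<in> vcoord M B F c x"
      using y b v coord_vec_diff[OF M_atlas refl ca v b(1)] by (simp add: vcoord_def)
    have bo: "metric_coord M g c x b u = 0" if "u \<in> vcoord M B F c x" for u
      using y b horizontal_coord[OF x b(1)] that by simp
    \<comment> \<open>The difference of two candidates for the horizontal part is both vertical and
      orthogonal to all vertical vectors.\<close>
    define d where "d = b - (v - w)"
    have "d = w - (v - b)" by (simp add: d_def)
    hence dV: "d \<in> vcoord M B F c x" using subspace_diff[OF sub w bV] by simp
    have "metric_coord M g c x d d = 0"
      using G.diff_left[OF x b(1) wE(2) vcoord_subset[OF dV]] bo[OF dV] orth[OF dV] by (simp add: d_def)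
    hence "d = 0" using G.pos[OF x vcoord_subset[OF dV]] by force
    thus "y = coord_vec M c ?q (v - w)" using b by (simp add: d_def)
  qed
qed

text \<open>The cosine is the length of \<open>v - w\<close> over that of \<open>v\<close>; by
  Pythagoras the sine is the length of the vertical part \<open>w\<close> over that of
  \<open>v\<close>.\<close>

lemma sin_horizontal_angle:
  assumes x: "x \<in> chart_ran c" and v: "v \<in> model M" "v \<noteq> 0" and w: "w \<in> vcoord M B F c x"
    and orth: "\<And>u. u \<in> vcoord M B F c x \<Longrightarrow> metric_coord M g c x (v - w) u = 0"
  shows "sin (horizontal_angle M g B F (chart_inv c x) (coord_vec M c (chart_inv c x) v)) =
    sqrt (metric_coord M g c x w w / metric_coord M g c x v v)"
proof -
  let ?G = "metric_coord M g c x"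
  have wE: "w \<in> model M" "v - w \<in> model M" using vcoord_subset[OF w] v by auto
  have norm: "gnorm g (chart_inv c x) (coord_vec M c (chart_inv c x) a) = sqrt (?G a a)" for a
    by (simp add: gnorm_def metric_coord_def Let_def)
  have Gv: "?G v v > 0" by (rule G.pos[OF x v])
  have nonneg: "?G a a \<ge> 0" if "a \<in> model M" for a
    using G.pos[OF x that] G.zero_left[OF x that] by (cases "a = 0") auto
  have "?G v v = ?G (v - w + w) (v - w + w)" by simp
  also have "\<dots> = ?G (v - w) (v - w) + ?G w w"
    using G.add_left[OF x wE(2,1) v(1)] G.add_right[OF x wE(2,1,2)] G.add_right[OF x wE(2,1,1)] orth[OF w] G.sym[OF x wE]
    by simp
  finally have pyth: "?G v v = ?G (v - w) (v - w) + ?G w w" .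
  define r where "r = sqrt (?G (v - w) (v - w)) / sqrt (?G v v)"
  have r2: "r\<^sup>2 = ?G (v - w) (v - w) / ?G v v" using Gv nonneg[OF wE(2)] by (simp add: r_def power_divide)
  have r: "0 \<le> r" "r \<le> 1"
    using Gv nonneg[OF wE(2)] nonneg[OF wE(1)] pyth by (auto simp: r_def divide_le_eq_1)
  have "sin (arccos r) = sqrt (1 - r\<^sup>2)" using r by (intro sin_arccos) auto
  also have "1 - r\<^sup>2 = ?G w w / ?G v v" unfolding r2 using pyth Gv by (simp add: field_simps)
  finally show ?thesis
    using horizontal_part_coord[OF x v(1) w orth] by (simp add: horizontal_angle_def norm r_def)
qed

text \<open>The bound is \<open>k\<^sup>2 * e\<close>, with \<open>k\<close> from the Clairaut
  condition and \<open>e\<close> the constant squared speed. The vertical part \<open>w\<close> of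
  the velocity attains it, by the formula for the sine; any vertical \<open>W\<close> stays below
  because \<open>w - W\<close> has nonnegative square. This is the hypothesis \<open>le\<close> of
  \<open>clairaut_derivative\<close>.\<close>

lemma clairaut_geodesic:
  fixes f :: "'p \<Rightarrow> real"
  assumes cl: "clairaut_conformal_submersion M g B g' F dil (\<lambda>q. exp (f q))"
    and x0: "x0 \<in> chart_ran c" and v: "v \<in> model M" "v \<noteq> 0" and u: "u \<in> vcoord M B F c x0"
    and orth: "\<And>w. w \<in> vcoord M B F c x0 \<Longrightarrow> metric_coord M g c x0 (v - u) w = 0"
  obtains \<epsilon> x x' where "\<epsilon> > 0" "x 0 = x0" "x' 0 = v"
    "\<And>t. t \<in> {-\<epsilon><..<\<epsilon>} \<Longrightarrow> x t \<in> chart_ran c \<and> x' t \<in> model M \<and> (x has_vector_derivative x' t) (at t) \<and>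
      (x' has_vector_derivative - chris (model M) (metric_coord M g c) (x t) (x' t) (x' t)) (at t)"
    "\<And>t w. t \<in> {-\<epsilon><..<\<epsilon>} \<Longrightarrow> w \<in> vcoord M B F c (x t) \<Longrightarrow>
      exp (2 * f (chart_inv c (x t))) * (2 * metric_coord M g c (x t) (x' t) w - metric_coord M g c (x t) w w)
      \<le> exp (2 * f (chart_inv c x0)) * (2 * metric_coord M g c x0 v u - metric_coord M g c x0 u u)"
proof -
  let ?G = "metric_coord M g c"
  obtain \<epsilon> x x' where \<epsilon>: "\<epsilon> > 0" "x 0 = x0" "x' 0 = v" "smooth_on UNIV {-\<epsilon><..<\<epsilon>} x"
    and xx': "\<And>t. t \<in> {-\<epsilon><..<\<epsilon>} \<Longrightarrow> x t \<in> chart_ran c \<and> x' t \<in> model M \<and> (x has_vector_derivative x' t) (at t) \<and>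
      (x' has_vector_derivative - G.\<Gamma> (x t) (x' t) (x' t)) (at t)"
    using G.geodesic_exists[OF x0 v(1)] by metis
  let ?I = "{-\<epsilon><..<\<epsilon>}"
  have evI: "\<forall>\<^sub>F s in nhds t. s \<in> ?I" if "t \<in> ?I" for t
    using that by (intro eventually_nhds_in_open) auto
  have ev1: "\<forall>\<^sub>F s in nhds t. x s \<in> chart_ran c" if "t \<in> ?I" for t using evI[OF that] by eventually_elim (use xx' in blast)
  have ev2: "\<forall>\<^sub>F s in nhds t. x' s \<in> model M" if "t \<in> ?I" for t using evI[OF that] by eventually_elim (use xx' in blast)
  have "geodesic M g ?I (\<lambda>t. chart_inv c (x t))"
    by (rule geodesic_lift[OF _ c _ _ \<epsilon>(4), where x'=x'])
       (use Mg xx' in \<open>auto simp: riemannian_manifold_def christoffel_eq_chris is_interval_oo\<close>)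
  then obtain k where k: "\<And>t. t \<in> ?I \<Longrightarrow> exp (f (chart_inv c (x t))) *
      sin (horizontal_angle M g B F (chart_inv c (x t)) (velocity M (\<lambda>t. chart_inv c (x t)) t)) = k"
    using cl unfolding clairaut_conformal_submersion_def by meson
  have "((\<lambda>t. ?G (x t) (x' t) (x' t)) has_vector_derivative 0) (at t)" if "t \<in> ?I" for t
  proof -
    have xt: "x t \<in> chart_ran c" "x' t \<in> model M" using xx'[OF that] by auto
    show ?thesis
      using G.metric_curve_derivative[of x "x' t" t x' "- G.\<Gamma> (x t) (x' t) (x' t)" x' "- G.\<Gamma> (x t) (x' t) (x' t)"]
        xx'[OF that] ev1[OF that] ev2[OF that] G.zero_left[OF xt] G.zero_right[OF xt] by simp
  qed
  hence d0: "((\<lambda>t. ?G (x t) (x' t) (x' t)) has_derivative (\<lambda>h. 0)) (at t within ?I)" if "t \<in> ?I" for t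
    using that by (simp add: has_vector_derivative_def has_derivative_at_withinI)
  obtain e where e: "\<And>t. t \<in> ?I \<Longrightarrow> ?G (x t) (x' t) (x' t) = e"
    using has_derivative_zero_constant[OF _ d0] by auto
  have e0: "e = ?G x0 v v" using e[of 0] \<epsilon> by simp
  have epos: "e > 0" unfolding e0 by (rule G.pos[OF x0 v])
  have main: "exp (2 * f (chart_inv c (x t))) * ?G (x t) w w = k\<^sup>2 * e"
    if t: "t \<in> ?I" and w: "w \<in> vcoord M B F c (x t)" "\<And>u. u \<in> vcoord M B F c (x t) \<Longrightarrow> ?G (x t) (x' t - w) u = 0" for t w
  proof -
    have xt: "x t \<in> chart_ran c" "x' t \<in> model M" using xx'[OF t] by auto
    \<comment> \<open>The speed is a positive constant, so the angle is never that of the zero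
      vector with its conventional value.\<close>
    have nz: "x' t \<noteq> 0" using e[OF t] epos G.zero_left[OF xt] by auto
    have vel: "velocity M (\<lambda>t. chart_inv c (x t)) t = coord_vec M c (chart_inv c (x t)) (x' t)"
      by (rule velocity_chart[OF M_atlas c _ ev1[OF t]]) (use xx'[OF t] in blast)
    have wE: "w \<in> model M" by (rule vcoord_subset[OF w(1)])
    have nn: "?G (x t) w w \<ge> 0" using G.pos[OF xt(1) wE] G.zero_left[OF xt(1) wE] by (cases "w = 0") auto
    have "k\<^sup>2 = (exp (f (chart_inv c (x t))) * sqrt (?G (x t) w w / e))\<^sup>2"
      using k[OF t] sin_horizontal_angle[OF xt nz w] unfolding vel e[OF t] by simp
    also have "\<dots> = exp (2 * f (chart_inv c (x t))) * (?G (x t) w w / e)"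
      using nn epos by (simp add: power_mult_distrib exp_double)
    finally show ?thesis using epos by (simp add: field_simps)
  qed
  have uE: "u \<in> model M" by (rule vcoord_subset[OF u])
  have "?G x0 v u = ?G x0 u u" using orth[OF u] G.diff_left[OF x0 v(1) uE uE] by simp
  moreover have "exp (2 * f (chart_inv c x0)) * ?G x0 u u = k\<^sup>2 * e" using main[of 0 u] u orth \<epsilon> by simp
  ultimately have rhs: "exp (2 * f (chart_inv c x0)) * (2 * ?G x0 v u - ?G x0 u u) = k\<^sup>2 * e" by simp
  show ?thesis
  proof (rule that[OF \<epsilon>(1-3) xx'])
    fix t W assume t: "t \<in> ?I" and W: "W \<in> vcoord M B F c (x t)"
    have xt: "x t \<in> chart_ran c" "x' t \<in> model M" using xx'[OF t] by auto
    have sub: "subspace (vcoord M B F c (x t))" by (rule vcoord_subspace[OF M_atlas c xt(1)])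
    obtain w where w: "w \<in> vcoord M B F c (x t)" "\<And>u. u \<in> vcoord M B F c (x t) \<Longrightarrow> ?G (x t) (x' t - w) u = 0"
      using G.orthogonal_decomposition[OF xt(1) sub _ xt(2)] vcoord_subset by blast
    note wE = vcoord_subset[OF w(1)] and WE = vcoord_subset[OF W]
    have "w - W \<in> model M" using wE WE by auto
    hence "?G (x t) (w - W) (w - W) \<ge> 0"
      using G.pos[OF xt(1), of "w - W"] G.zero_left[OF xt(1), of 0] by (cases "w - W = 0") (auto intro: less_imp_le)
    moreover have "?G (x t) (w - W) (w - W) = ?G (x t) w w - 2 * ?G (x t) w W + ?G (x t) W W"
      using G.diff_left[OF xt(1) wE WE] G.diff_right[OF xt(1) wE WE] G.sym[OF xt(1) wE WE] wE WE by simp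
    moreover have "?G (x t) (x' t) W = ?G (x t) w W" using w(2)[OF W] G.diff_left[OF xt(1,2) wE WE] by simp
    ultimately have "2 * ?G (x t) (x' t) W - ?G (x t) W W \<le> ?G (x t) w w" by simp
    hence "exp (2 * f (chart_inv c (x t))) * (2 * ?G (x t) (x' t) W - ?G (x t) W W) \<le> k\<^sup>2 * e"
      using main[OF t w] by (metis exp_ge_zero mult_left_mono)
    thus "exp (2 * f (chart_inv c (x t))) * (2 * ?G (x t) (x' t) W - ?G (x t) W W)
      \<le> exp (2 * f (chart_inv c x0)) * (2 * ?G x0 v u - ?G x0 u u)" unfolding rhs .
  qed
qed

end

section \<open>Fibres of a submersion\<close>

lemma chart_transition_continuous:
  assumes c: "is_chart T E c" and d: "is_chart T E' d"
  shows "continuous_on (chart_map c ` (chart_dom c \<inter> chart_dom d)) (chart_map d \<circ> chart_inv c)"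
proof -
  let ?O = "chart_map c ` (chart_dom c \<inter> chart_dom d)"
  have inv: "chart_inv c x \<in> chart_dom d" if "x \<in> ?O" for x
    using that chart_inv_map[OF c] by auto
  have "continuous_map (top_of_set ?O) (subtopology T (chart_dom c)) (chart_inv c)"
    by (rule continuous_map_from_subtopology_mono[OF chart_inv_continuous[OF c]]) auto
  hence "continuous_map (top_of_set ?O) (subtopology T (chart_dom d)) (chart_inv c)"
    using inv by (simp add: continuous_map_in_subtopology image_subset_iff Pi_iff)
  from continuous_map_compose[OF this chart_continuous[OF d]]
  show ?thesis by (simp add: continuous_map_in_subtopology)
qed

lemma chart_image_ropen:
  assumes c: "is_chart T E c" and E: "subspace E" and U: "openin T U"
  shows "ropen E (chart_map c ` (chart_dom c \<inter> U))"
  using chart_open_image[OF c U] E by (simp add: ropen_def)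

text \<open>Chain rule for a left inverse up to an affine map: the derivative of \<rho> takes
  \<open>dderiv i y v\<close> to \<open>L v\<close>. It shows that the charts constructed on a fibre
  have immersions as inverses.\<close>

lemma dderiv_left_inverse:
  fixes i :: "'k::euclidean_space \<Rightarrow> 'e::euclidean_space" and \<rho> :: "'e \<Rightarrow> 'f::euclidean_space"
  assumes S: "ropen K S" and i: "smooth_on K S i" "i ` S \<subseteq> T" and T: "ropen E T" and \<rho>: "smooth_on E T \<rho>"
    and inv: "\<And>y. y \<in> S \<Longrightarrow> \<rho> (i y) = x0 + L y" and L: "linear L"
    and y: "y \<in> S" and v: "v \<in> K" "dderiv i y v = 0"
  shows "L v = 0"
proof -
  have bL: "bounded_linear L" using L by (simp add: linear_conv_bounded_linear)
  have iT: "i y \<in> T" using i(2) y by auto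
  note d\<rho> = smooth_on_differentiable[OF \<rho> iT]
  have "((\<lambda>t. x0 + L (y + t *\<^sub>R v)) has_vector_derivative 0 + L v) (at 0)"
    by (intro has_vector_derivative_add has_vector_derivative_const bounded_linear.has_vector_derivative[OF bL] line_has_vector_derivative)
  hence "L v = dderiv (\<lambda>y. x0 + L y) y v" unfolding dderiv_def by (simp add: vector_derivative_at)
  also have "\<dots> = dderiv (\<lambda>y. \<rho> (i y)) y v" by (rule dderiv_cong[OF S y v(1)]) (use inv in simp)
  also have "\<dots> = dderiv \<rho> (i y) (dderiv i y v)"
    by (rule dderiv_compose(1)[OF S y v(1) smooth_on_differentiable[OF i(1) y] T i(2) d\<rho>])
  also have "\<dots> = 0" unfolding v(2) by (simp add: dderiv_def)
  finally show ?thesis .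
qed

locale smooth_submersion =
  fixes M :: "('p, 'e::euclidean_space) manifold" and B :: "('q, 'b::euclidean_space) manifold" and F :: "'p \<Rightarrow> 'q"
  assumes M: "smooth_manifold M" and B: "smooth_manifold B" and F: "submersion M B F"
begin

abbreviation "E \<equiv> model M"

lemmas MA = smooth_manifold_atlas[OF M] and BA = smooth_manifold_atlas[OF B]
lemmas E_sub = E_subspace[OF MA refl] and EB_sub = E_subspace[OF BA refl]
lemmas M_chart = atlas_chart[OF MA refl] and B_chart = atlas_chart[OF BA refl]

lemma F_smooth: "smooth_map M B F" using F by (simp add: submersion_def)

lemma F_points: "p \<in> points M \<Longrightarrow> F p \<in> points B"
  using F_smooth by (auto simp: smooth_map_def continuous_map_def Pi_iff)

lemma M_chart_at: "p \<in> points M \<Longrightarrow> \<exists>c. c \<in> charts_at M p"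
  using M by (auto simp: smooth_manifold_def charts_at_def)

lemma B_chart_at: "p \<in> points B \<Longrightarrow> \<exists>c. c \<in> charts_at B p"
  using B by (auto simp: smooth_manifold_def charts_at_def)

section \<open>The submersion in coordinates\<close>

definition rep :: "('p, 'e) chart \<Rightarrow> ('q, 'b) chart \<Rightarrow> 'e \<Rightarrow> 'b" where
  "rep c d x = chart_map d (F (chart_inv c x))"

definition rep_dom :: "('p, 'e) chart \<Rightarrow> ('q, 'b) chart \<Rightarrow> 'e set" where
  "rep_dom c d = chart_map c ` {q \<in> chart_dom c. F q \<in> chart_dom d}"

context
  fixes c :: "('p, 'e) chart" and d :: "('q, 'b) chart"
  assumes c: "c \<in> atlas M" and d: "d \<in> atlas B"
begin

lemma rep_dom_D: "x \<in> rep_dom c d \<Longrightarrow> x \<in> chart_ran c \<and> F (chart_inv c x) \<in> chart_dom d"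
  using chart_inv_map[OF M_chart[OF c]] by (auto simp: rep_dom_def)

lemma rep_dom_I: "x \<in> chart_ran c \<Longrightarrow> F (chart_inv c x) \<in> chart_dom d \<Longrightarrow> x \<in> rep_dom c d"
proof -
  assume x: "x \<in> chart_ran c" and F: "F (chart_inv c x) \<in> chart_dom d"
  have "chart_map c (chart_inv c x) \<in> rep_dom c d"
    unfolding rep_dom_def using chart_inv_in[OF x] F by (intro imageI) simp
  thus ?thesis using chart_map_inv[OF x] by simp
qed

lemma rep_dom_ropen: "ropen E (rep_dom c d)"
proof -
  have "openin (mtop B) (chart_dom d)" using B_chart[OF d] by (simp add: is_chart_def)
  hence "openin (mtop M) {q \<in> points M. F q \<in> chart_dom d}"
    using F_smooth openin_continuous_map_preimage unfolding smooth_map_def by blast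
  from chart_image_ropen[OF M_chart[OF c] E_sub this]
  have "ropen E (chart_map c ` (chart_dom c \<inter> {q \<in> points M. F q \<in> chart_dom d}))" .
  moreover have "chart_dom c \<inter> {q \<in> points M. F q \<in> chart_dom d} = {q \<in> chart_dom c. F q \<in> chart_dom d}"
    using is_chart_dom_subset[OF M_chart[OF c]] by auto
  ultimately show ?thesis by (simp add: rep_dom_def)
qed

lemma rep_smooth: "smooth_on E (rep_dom c d) (rep c d)"
proof -
  have "smooth_on E (rep_dom c d) (chart_map d \<circ> F \<circ> chart_inv c)"
    using F_smooth c d by (simp add: smooth_map_def rep_dom_def)
  moreover have "chart_map d \<circ> F \<circ> chart_inv c = rep c d" by (auto simp: rep_def)
  ultimately show ?thesis by simp
qed

lemma rep_in: "rep c d ` rep_dom c d \<subseteq> model B"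
  using rep_dom_D chart_ran_subset[OF B_chart[OF d]] by (auto simp: rep_def)

lemma rep_differentiable: "x \<in> rep_dom c d \<Longrightarrow> rep c d differentiable (at x within rep_dom c d)"
  by (rule smooth_on_differentiable[OF rep_smooth])

lemma rep_dderiv_in: "x \<in> rep_dom c d \<Longrightarrow> a \<in> E \<Longrightarrow> dderiv (rep c d) x a \<in> model B"
  by (rule dderiv_in_subspace[OF rep_dom_ropen _ _ rep_differentiable EB_sub]) (use rep_in in auto)

lemma differential_rep:
  assumes x: "x \<in> rep_dom c d" and a: "a \<in> E"
  shows "differential B F (chart_inv c x) (coord_vec M c (chart_inv c x) a) =
    coord_vec B d (F (chart_inv c x)) (dderiv (rep c d) x a)"
proof -
  note D = rep_dom_D[OF x]
  have "differential B F (chart_inv c x) (coord_vec M c (chart_inv c x) a) =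
    coord_vec B d (F (chart_inv c x)) (dderiv (\<lambda>x. chart_map d (F (chart_inv c x))) (chart_map c (chart_inv c x)) a)"
    by (rule differential_coord_vec[OF MA BA charts_at_chart_inv[OF c] _ rep_dom_ropen])
       (use D x d a chart_map_inv[of x c] rep_smooth in \<open>auto simp: charts_at_def rep_def[abs_def] dest!: rep_dom_D\<close>)
  thus ?thesis using D chart_map_inv[of x c] by (simp add: rep_def[abs_def])
qed

lemma d_charts_at: "x \<in> rep_dom c d \<Longrightarrow> d \<in> charts_at B (F (chart_inv c x))"
  using d rep_dom_D by (simp add: charts_at_def)

lemma vcoord_rep:
  assumes x: "x \<in> rep_dom c d"
  shows "vcoord M B F c x = {a \<in> E. dderiv (rep c d) x a = 0}"
  using differential_rep[OF x] coord_vec_eq_zero[OF BA refl d_charts_at[OF x] rep_dderiv_in[OF x]]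
    coord_vec_in[OF MA refl charts_at_chart_inv[OF c]] coord_vec_zero[OF BA refl d_charts_at[OF x]] rep_dom_D[OF x]
  by (auto simp: vcoord_def vertical_def)

lemma rep_surj:
  assumes x: "x \<in> rep_dom c d" and b: "b \<in> model B"
  shows "\<exists>a\<in>E. dderiv (rep c d) x a = b"
proof -
  let ?q = "chart_inv c x"
  have q: "?q \<in> points M"
    using rep_dom_D[OF x] chart_inv_in[of x c] is_chart_dom_subset[OF M_chart[OF c]] by auto
  have "coord_vec B d (F ?q) b \<in> tangent_space B (F ?q)"
    by (rule coord_vec_in[OF BA refl d_charts_at[OF x] b])
  then obtain v where v: "v \<in> tangent_space M ?q" "differential B F ?q v = coord_vec B d (F ?q) b"
  proof -
    have "differential B F ?q ` tangent_space M ?q = tangent_space B (F ?q)"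
      using F q by (simp add: submersion_def)
    thus ?thesis using that \<open>coord_vec B d (F ?q) b \<in> tangent_space B (F ?q)\<close> by (metis (no_types, lifting) imageE)
  qed
  have ca: "c \<in> charts_at M ?q" using charts_at_chart_inv[OF c] rep_dom_D[OF x] by blast
  obtain a where a: "a \<in> E" "v = coord_vec M c ?q a" by (rule tangent_space_chart[OF MA ca v(1)])
  have "dderiv (rep c d) x a = b"
    using coord_vec_inj[OF BA refl d_charts_at[OF x] rep_dderiv_in[OF x a(1)] b] differential_rep[OF x a(1)] v(2) a(2) by simp
  thus ?thesis using a by blast
qed

text \<open>Rank and nullity: the derivative maps \<open>E\<close> onto \<open>model B\<close>, so
  \<open>E\<close> is the direct sum of its kernel and the image of a right inverse.\<close>

lemma kernel_dim:
  assumes x: "x \<in> rep_dom c d"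
  shows "dim {a \<in> E. dderiv (rep c d) x a = 0} + mdim B = mdim M"
proof -
  obtain L where L: "bounded_linear L" "\<And>v. v \<in> E \<Longrightarrow> dderiv (rep c d) x v = L v"
    by (rule dderiv_linear[OF rep_dom_ropen x rep_differentiable[OF x]]) auto
  note lL = bounded_linear.linear[OF L(1)]
  obtain R where R: "R ` UNIV \<subseteq> E" "linear R" "\<And>v. v \<in> L ` E \<Longrightarrow> L (R v) = v"
    using linear_exists_right_inverse_on[OF lL E_sub] by blast
  have LE: "L ` E = model B"
    using rep_surj[OF x] rep_dderiv_in[OF x] L(2) by (fastforce simp: image_iff)
  let ?N = "{a \<in> E. L a = 0}"
  have N: "subspace ?N"
    using E_sub by (auto simp: subspace_def linear_0[OF lL] linear_add[OF lL] linear_scale[OF lL])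
  have RB: "subspace (R ` model B)" by (rule linear_subspace_image[OF R(2) EB_sub])
  have "inj_on R (model B)" using R(3) LE by (metis inj_onI)
  hence dimR: "dim (R ` model B) = dim (model B)"
    using dim_image_eq[OF R(2), of "model B"] EB_sub by (simp add: span_eq_iff[THEN iffD2])
  have "?N \<inter> R ` model B = {0}"
  proof -
    have "y = 0" if y: "y \<in> ?N" "y \<in> R ` model B" for y
    proof -
      obtain z where z: "z \<in> model B" "y = R z" using y(2) by blast
      hence "L y = z" using R(3) LE by auto
      thus ?thesis using z y(1) linear_0[OF R(2)] by simp
    qed
    moreover have "0 \<in> ?N" "0 \<in> R ` model B" using subspace_0 N RB by blast+
    ultimately show ?thesis by blast
  qed
  moreover have "{y + z |y z. y \<in> ?N \<and> z \<in> R ` model B} = E"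
  proof -
    have "a = (a - R (L a)) + R (L a) \<and> a - R (L a) \<in> ?N \<and> R (L a) \<in> R ` model B" if "a \<in> E" for a
    proof -
      have "L a \<in> L ` E" using that by (rule imageI)
      thus ?thesis using R that LE E_sub by (auto intro: subspace_diff simp: linear_diff[OF lL] image_subset_iff)
    qed
    moreover have "y + z \<in> E" if "y \<in> ?N" "z \<in> R ` model B" for y z
      using that R(1) E_sub by (auto intro!: subspace_add)
    ultimately show ?thesis by blast
  qed
  ultimately have "dim E = dim ?N + dim (R ` model B)" using dim_sums_Int[OF N RB] by simp
  moreover have "{a \<in> E. dderiv (rep c d) x a = 0} = ?N" using L(2) by auto
  ultimately show ?thesis unfolding mdim_def dimR by simp
qed

end

text \<open>Makes the truncated subtraction \<open>mdim M - mdim B\<close> a genuine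
  difference.\<close>

lemma dim_le: "p \<in> points M \<Longrightarrow> mdim B \<le> mdim M"
proof -
  assume p: "p \<in> points M"
  obtain c d where c: "c \<in> charts_at M p" and d: "d \<in> charts_at B (F p)"
    using M_chart_at[OF p] B_chart_at[OF F_points[OF p]] by blast
  have "chart_map c p \<in> rep_dom c d"
    by (rule rep_dom_I) (use c d charts_at_inv[OF MA refl c] in \<open>auto simp: charts_at_def\<close>)
  from kernel_dim[OF _ _ this] c d show ?thesis by (auto simp: charts_at_def)
qed

section \<open>Charts of the fibres\<close>

abbreviation "K \<equiv> fibre_model M B"

lemma fibre_model:
  shows "subspace K" "K \<subseteq> E" "dim K = mdim M - mdim B"
proof -
  have "mdim M - mdim B \<le> dim E" by (simp add: mdim_def)
  then obtain K' where "subspace K'" "K' \<subseteq> span E" "dim K' = mdim M - mdim B"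
    by (rule choose_subspace_of_subspace)
  hence "\<exists>K. subspace K \<and> K \<subseteq> E \<and> dim K = mdim M - mdim B"
    using E_sub by (metis span_eq_iff)
  from someI_ex[OF this] show "subspace K" "K \<subseteq> E" "dim K = mdim M - mdim B"
    unfolding fibre_model_def by blast+
qed

abbreviation "fibre_top b \<equiv> subtopology (mtop M) {p \<in> points M. F p = b}"

lemma fibre_simps:
  "mtop (fibre M B F b) = fibre_top b" "model (fibre M B F b) = K"
  by (simp_all add: fibre_def Let_def)

lemma fibre_atlas: "d \<in> atlas (fibre M B F b) \<longleftrightarrow> is_chart (fibre_top b) K d \<and> (\<forall>c\<in>atlas M.
    smooth_on K (chart_map d ` (chart_dom d \<inter> chart_dom c)) (chart_map c \<circ> chart_inv d) \<and>
    (\<forall>x\<in>chart_map d ` (chart_dom d \<inter> chart_dom c). inj_on (dderiv (chart_map c \<circ> chart_inv d) x) K))"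
  by (simp add: fibre_def Let_def)

lemma transition_ropen: "c \<in> atlas M \<Longrightarrow> c' \<in> atlas M \<Longrightarrow> ropen E (chart_map c ` (chart_dom c \<inter> chart_dom c'))"
  using chart_image_ropen[OF M_chart E_sub] M_chart by (simp add: is_chart_def)

lemma transition_smooth:
  "c \<in> atlas M \<Longrightarrow> c' \<in> atlas M \<Longrightarrow> smooth_on E (chart_map c ` (chart_dom c \<inter> chart_dom c')) (\<lambda>x. chart_map c' (chart_inv c x))"
  using M by (simp add: smooth_manifold_def comp_def)

text \<open>In straightened coordinates the fibre is a piece of the affine space through
  \<open>chart_map c p\<close> parallel to the kernel \<open>N\<close> of the derivative there.
  \<open>N\<close> depends on the point, so a linear isomorphism \<open>J\<close> carries it to the
  common model \<open>K\<close>. The function \<eta> is the same formula on the open set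
  \<open>U\<close>, off the fibre too: its smoothness controls changes to other fibre charts, and
  the last conclusion says that \<eta> and \<open>rep c d\<close> together are an immersion.\<close>

lemma fibre_chart_exists:
  assumes p: "p \<in> points M" and c: "c \<in> charts_at M p" and d: "d \<in> charts_at B (F p)"
  obtains e \<eta> U where "e \<in> charts_at (fibre M B F (F p)) p" "chart_dom e \<subseteq> chart_dom c" "ropen E U"
    "U \<subseteq> rep_dom c d" "chart_map c ` chart_dom e \<subseteq> U" "smooth_on E U \<eta>"
    "\<And>q. q \<in> chart_dom e \<Longrightarrow> chart_map e q = \<eta> (chart_map c q)"
    "\<And>x v. x \<in> U \<Longrightarrow> v \<in> E \<Longrightarrow> dderiv (rep c d) x v = 0 \<Longrightarrow> dderiv \<eta> x v = 0 \<Longrightarrow> v = 0"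
proof -
  let ?b = "F p" and ?x0 = "chart_map c p" and ?S = "rep_dom c d" and ?\<Phi> = "rep c d"
  have ca: "c \<in> atlas M" "p \<in> chart_dom c" and da: "d \<in> atlas B" "F p \<in> chart_dom d"
    using c d by (auto simp: charts_at_def)
  note chc = M_chart[OF ca(1)] and chd = B_chart[OF da(1)]
  note pinv = charts_at_inv[OF MA refl c]
  have x0: "?x0 \<in> ?S" by (rule rep_dom_I) (use ca da pinv in auto)
  obtain A \<theta> U V \<Psi> where A: "linear A" "\<And>a. a \<in> E \<Longrightarrow> A a = dderiv ?\<Phi> ?x0 a"
    and \<theta>: "smooth_on E ?S \<theta>" "\<theta> ` ?S \<subseteq> E" "\<theta> ?x0 = ?x0"
    "\<And>x. x \<in> ?S \<Longrightarrow> A (\<theta> x) = A ?x0 + ?\<Phi> x - ?\<Phi> ?x0"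
    "\<And>x v. x \<in> ?S \<Longrightarrow> v \<in> E \<Longrightarrow> A (dderiv \<theta> x v) = dderiv ?\<Phi> x v"
    and UV: "ropen E U" "U \<subseteq> ?S" "?x0 \<in> U" "ropen E V" "homeomorphism U V \<theta> \<Psi>"
    "smooth_on E V \<Psi>" "\<And>x v. x \<in> U \<Longrightarrow> v \<in> E \<Longrightarrow> dderiv \<theta> x v = 0 \<Longrightarrow> v = 0"
    by (rule submersion_straighten[OF rep_dom_ropen[OF ca(1) da(1)] EB_sub rep_smooth[OF ca(1) da(1)] rep_in[OF ca(1) da(1)]
          x0 rep_surj[OF ca(1) da(1) x0]]) auto
  have h: "\<theta> ` U = V" "\<Psi> ` V = U" "\<And>x. x \<in> U \<Longrightarrow> \<Psi> (\<theta> x) = x" "\<And>y. y \<in> V \<Longrightarrow> \<theta> (\<Psi> y) = y"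
    using UV(5) by (auto simp: homeomorphism_def)
  have x0E: "?x0 \<in> E" using ropen_subset[OF UV(1,3)] .
  define N where "N = {a \<in> E. A a = 0}"
  have N: "subspace N"
    using E_sub by (auto simp: N_def subspace_def linear_0[OF A(1)] linear_add[OF A(1)] linear_scale[OF A(1)])
  have "N = {a \<in> E. dderiv ?\<Phi> ?x0 a = 0}" using A(2) by (auto simp: N_def)
  hence dimN: "dim N = dim K" using kernel_dim[OF ca(1) da(1) x0] fibre_model(3) by simp
  obtain J J' where J: "linear J" "linear J'" "J ` N = K" "J' ` K = N" "\<And>x. x \<in> N \<Longrightarrow> J' (J x) = x" "\<And>x. x \<in> K \<Longrightarrow> J (J' x) = x"
    using isometries_subspaces[OF N fibre_model(1) dimN] by metis
  have bJ: "bounded_linear J" "bounded_linear J'" using J by (auto simp: linear_conv_bounded_linear)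
  have NE: "N \<subseteq> E" by (auto simp: N_def)
  define \<eta> where "\<eta> x = J (\<theta> x - ?x0)" for x
  define j where "j k = \<Psi> (?x0 + J' k)" for k
  define D where "D = {q \<in> chart_dom c. chart_map c q \<in> U \<and> F q = ?b}"
  define R where "R = K \<inter> (\<lambda>k. ?x0 + J' k) -` V"
  define e where "e = (D, \<lambda>q. \<eta> (chart_map c q))"
  have e_simps: "chart_dom e = D" "\<And>q. chart_map e q = \<eta> (chart_map c q)" by (simp_all add: e_def)
  \<comment> \<open>On the fibre \<open>rep c d\<close> is constant, so \<open>A\<close> takes the
    same value at \<open>\<theta> x\<close> as at the base point.\<close>
  have \<theta>N: "\<theta> x - ?x0 \<in> N" if "x \<in> ?S" "F (chart_inv c x) = ?b" for x
    using \<theta>(4)[OF that(1)] that \<theta>(2) x0E E_sub pinv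
    by (auto simp: N_def rep_def linear_diff[OF A(1)] intro: subspace_diff)
  have D: "chart_map c q \<in> U" "chart_map c q \<in> ?S" "q \<in> chart_dom c" "F q = ?b" "chart_inv c (chart_map c q) = q"
    "\<theta> (chart_map c q) - ?x0 \<in> N" if "q \<in> D" for q
    using that UV(2) chart_inv_map[OF chc] \<theta>N[of "chart_map c q"] by (auto simp: D_def)
  have aff: "(\<lambda>k. ?x0 + J' k) ` K \<subseteq> E" using J(4) NE x0E E_sub by (auto intro: subspace_add)
  have contJ: "continuous_on X J" "continuous_on X J'" for X
    using bounded_linear.continuous_on[OF _ continuous_on_id] bJ by blast+
  have KK: "ropen K K" using fibre_model(1) by (simp add: ropen_def)
  have R: "ropen K R" unfolding R_def
    by (rule ropen_preimage[OF KK _ aff UV(4)]) (intro continuous_intros contJ)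
  have jU: "j k \<in> U" "\<theta> (j k) = ?x0 + J' k" "k \<in> K" if "k \<in> R" for k
    using that h by (auto simp: R_def j_def)
  \<comment> \<open>Conversely, if \<theta> sends a point into the affine space parallel to
    \<open>N\<close>, then \<open>rep c d\<close> has the same value there as at the base point, and
    injectivity of \<open>chart_map d\<close> puts the point on the fibre.\<close>
  have jD: "chart_inv c (j k) \<in> D" "chart_map c (chart_inv c (j k)) = j k" "\<eta> (j k) = k" if k: "k \<in> R" for k
  proof -
    have S: "j k \<in> ?S" using jU[OF k] UV(2) by auto
    hence r: "j k \<in> chart_ran c" "F (chart_inv c (j k)) \<in> chart_dom d" using rep_dom_D[OF ca(1) da(1)] by auto
    show cm: "chart_map c (chart_inv c (j k)) = j k" by (rule chart_map_inv[OF r(1)])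
    have "J' k \<in> N" using jU[OF k] J(4) by auto
    hence "?\<Phi> (j k) = ?\<Phi> ?x0" using \<theta>(4)[OF S] unfolding jU(2)[OF k] by (simp add: linear_add[OF A(1)] N_def)
    hence "chart_map d (F (chart_inv c (j k))) = chart_map d (F p)" using pinv by (simp add: rep_def)
    hence "F (chart_inv c (j k)) = F p" using chart_inv_map[OF chd] r(2) da(2) by metis
    thus "chart_inv c (j k) \<in> D" using chart_inv_in[OF r(1)] cm jU[OF k] by (simp add: D_def)
    show "\<eta> (j k) = k" using jU[OF k] J(6) by (simp add: \<eta>_def)
  qed
  have eR: "\<eta> (chart_map c q) \<in> R" "j (\<eta> (chart_map c q)) = chart_map c q" if q: "q \<in> D" for q
  proof -
    have 1: "?x0 + J' (\<eta> (chart_map c q)) = \<theta> (chart_map c q)" using J(5)[OF D(6)[OF q]] by (simp add: \<eta>_def)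
    have "\<eta> (chart_map c q) \<in> K" using D(6)[OF q] J(3) by (auto simp: \<eta>_def)
    moreover have "\<theta> (chart_map c q) \<in> V" using D(1)[OF q] h(1) by auto
    ultimately show "\<eta> (chart_map c q) \<in> R" "j (\<eta> (chart_map c q)) = chart_map c q"
      using 1 h(3)[OF D(1)[OF q]] by (auto simp: R_def j_def)
  qed
  have ran: "chart_ran e = R"
  proof
    show "chart_ran e \<subseteq> R" using eR(1) by (auto simp: e_simps)
    show "R \<subseteq> chart_ran e"
    proof
      fix k assume k: "k \<in> R"
      have "k = chart_map e (chart_inv c (j k))" using jD[OF k] by (simp add: e_simps)
      thus "k \<in> chart_ran e" using jD(1)[OF k] e_simps(1) by blast
    qed
  qed
  have Dsub: "D \<subseteq> {q \<in> points M. F q = ?b}" using D(3,4) is_chart_dom_subset[OF chc] by auto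
  have topD: "subtopology (fibre_top ?b) D = subtopology (mtop M) D"
    using Dsub by (simp add: subtopology_subtopology Int_absorb1)
  have sm\<eta>: "smooth_on E U \<eta>" unfolding \<eta>_def
    by (intro smooth_on_bounded_linear[OF bJ(1) UV(1)] smooth_on_diff[OF UV(1)] smooth_on_subset[OF \<theta>(1) UV(2)] smooth_on_const)
  have smj: "smooth_on K R j" unfolding j_def
    by (rule smooth_on_compose[OF R UV(4) _ _ UV(6)])
       (use R_def smooth_on_add[OF R smooth_on_const smooth_on_bounded_linear[OF bJ(2) R smooth_on_id]] in auto)
  have chart: "is_chart (fibre_top ?b) K e"
    unfolding is_chart_def
  proof (intro conjI)
    have "openin (mtop M) {q \<in> chart_dom c. chart_map c q \<in> U}"
      by (rule chart_open_preimage[OF chc]) (use UV(1) in \<open>simp add: ropen_def\<close>)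
    moreover have "D = {q \<in> chart_dom c. chart_map c q \<in> U} \<inter> {q \<in> points M. F q = ?b}"
      using is_chart_dom_subset[OF chc] by (auto simp: D_def)
    ultimately show "openin (fibre_top ?b) (chart_dom e)" by (auto simp: e_simps openin_subtopology)
    show "openin (top_of_set K) (chart_ran e)" using R ran by (simp add: ropen_def)
    have top: "topspace (subtopology (mtop M) D) = D" using Dsub by auto
    have "homeomorphic_maps (subtopology (mtop M) D) (top_of_set R) (chart_map e) (\<lambda>k. chart_inv c (j k))"
      unfolding homeomorphic_maps_def top
    proof (intro conjI ballI)
      have "continuous_map (subtopology (mtop M) D) (top_of_set (chart_ran c)) (chart_map c)"
        by (rule continuous_map_from_subtopology_mono[OF chart_continuous[OF chc]]) (use D(3) in auto)
      hence "continuous_map (subtopology (mtop M) D) (top_of_set U) (chart_map c)"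
        using D(1) by (auto simp: continuous_map_in_subtopology top)
      moreover have "continuous_map (top_of_set U) euclidean \<eta>" using smooth_on_continuous[OF sm\<eta>] by simp
      ultimately have "continuous_map (subtopology (mtop M) D) euclidean (\<eta> \<circ> chart_map c)" by (rule continuous_map_compose)
      hence "continuous_map (subtopology (mtop M) D) euclidean (chart_map e)" by (simp add: e_def comp_def)
      thus "continuous_map (subtopology (mtop M) D) (top_of_set R) (chart_map e)"
        using eR(1) by (auto simp: continuous_map_in_subtopology top e_simps)
      have "continuous_map (top_of_set R) (top_of_set (chart_ran c)) j"
        using smooth_on_continuous[OF smj] jU(1) UV(2) rep_dom_D[OF ca(1) da(1)]
        by (auto simp: continuous_map_in_subtopology)
      from continuous_map_compose[OF this chart_inv_continuous[OF chc]]
      show "continuous_map (top_of_set R) (subtopology (mtop M) D) (\<lambda>k. chart_inv c (j k))"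
        using jD(1) by (auto simp: continuous_map_in_subtopology comp_def)
      show "chart_inv c (j (chart_map e q)) = q" if "q \<in> D" for q using eR(2)[OF that] D(5)[OF that] by (simp add: e_simps)
      show "chart_map e (chart_inv c (j k)) = k" if "k \<in> topspace (top_of_set R)" for k using jD that by (simp add: e_simps)
    qed
    thus "homeomorphic_map (subtopology (fibre_top ?b) (chart_dom e)) (top_of_set (chart_ran e)) (chart_map e)"
      by (simp only: ran) (auto simp only: e_simps(1) topD homeomorphic_map_maps)
  qed
  have einv: "chart_inv e k = chart_inv c (j k)" if "k \<in> R" for k
    using chart_inv_map[OF chart, of "chart_inv c (j k)"] jD[OF that] by (simp add: e_simps)
  have "e \<in> atlas (fibre M B F ?b)"
    unfolding fibre_atlas
  proof (intro conjI ballI chart)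
    fix c' assume c': "c' \<in> atlas M"
    let ?S' = "chart_map e ` (chart_dom e \<inter> chart_dom c')" and ?W = "chart_map c ` (chart_dom c \<inter> chart_dom c')"
      and ?W' = "chart_map c' ` (chart_dom c' \<inter> chart_dom c)"
    have S'R: "?S' \<subseteq> R" using ran by auto
    have "openin (fibre_top ?b) (chart_dom c' \<inter> {q \<in> points M. F q = ?b})"
      using M_chart[OF c'] by (auto simp: openin_subtopology is_chart_def)
    from chart_image_ropen[OF chart fibre_model(1) this]
    have S': "ropen K ?S'" using Dsub by (simp add: e_simps Int_absorb2 inf.assoc[symmetric] inf_commute)
        (metis (no_types, lifting) Int_absorb2 inf.left_commute inf_commute)
    have jW: "j k \<in> ?W" "chart_inv c (j k) \<in> chart_dom c'" if "k \<in> ?S'" for k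
    proof -
      obtain q where q: "q \<in> D" "q \<in> chart_dom c'" "k = \<eta> (chart_map c q)" using \<open>k \<in> ?S'\<close> by (auto simp: e_simps)
      show "j k \<in> ?W" using eR(2)[OF q(1)] D(3)[OF q(1)] q by auto
      show "chart_inv c (j k) \<in> chart_dom c'" using eR(2)[OF q(1)] D(5)[OF q(1)] q by auto
    qed
    have "smooth_on K ?S' (\<lambda>k. chart_map c' (chart_inv c (j k)))"
      by (rule smooth_on_compose[OF S' transition_ropen[OF ca(1) c'] _ smooth_on_subset[OF smj S'R] transition_smooth[OF ca(1) c']])
         (use jW in auto)
    thus smi: "smooth_on K ?S' (chart_map c' \<circ> chart_inv e)"
      by (subst smooth_on_cong[OF S']) (use einv S'R in auto)
    fix k assume k: "k \<in> ?S'"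
    let ?i = "chart_map c' \<circ> chart_inv e"
    have inv: "chart_inv c' (?i k) = chart_inv c (j k)" "?i k \<in> ?W'" if "k \<in> ?S'" for k
    proof -
      have "k \<in> R" using \<open>k \<in> ?S'\<close> S'R by auto
      thus "chart_inv c' (?i k) = chart_inv c (j k)"
        using chart_inv_map[OF M_chart[OF c'] jW(2)[OF that]] einv by simp
      show "?i k \<in> ?W'" using \<open>k \<in> R\<close> einv jW(2)[OF that] D(3)[OF jD(1)] by auto
    qed
    have T: "ropen E (?W' \<inter> (\<lambda>x. chart_map c (chart_inv c' x)) -` ?S)"
      by (rule ropen_preimage[OF transition_ropen[OF c' ca(1)] smooth_on_continuous[OF transition_smooth[OF c' ca(1)]] _ rep_dom_ropen[OF ca(1) da(1)]])
         (use chart_ran_subset[OF chc] chart_inv_map[OF M_chart[OF c']] in auto)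
    have "v = 0" if v: "v \<in> K" "dderiv ?i k v = 0" for v
    proof -
      \<comment> \<open>\<theta> after the change to the chart \<open>c\<close> undoes the inclusion
        up to an affine map with linear part \<open>J'\<close>.\<close>
      have "J' v = 0"
      proof (rule dderiv_left_inverse[OF S' smi _ T, where \<rho>="\<lambda>x. \<theta> (chart_map c (chart_inv c' x))" and ?x0.0="?x0" and L=J'])
        show "?i ` ?S' \<subseteq> ?W' \<inter> (\<lambda>x. chart_map c (chart_inv c' x)) -` ?S"
        proof
          fix y assume "y \<in> ?i ` ?S'"
          then obtain k where k: "k \<in> ?S'" "y = ?i k" by blast
          hence "k \<in> R" using S'R by auto
          have "chart_map c (chart_inv c' y) = j k" using inv(1)[OF k(1)] k(2) jD(2)[OF \<open>k \<in> R\<close>] by simp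
          thus "y \<in> ?W' \<inter> (\<lambda>x. chart_map c (chart_inv c' x)) -` ?S"
            using inv(2)[OF k(1)] k(2) jU(1)[OF \<open>k \<in> R\<close>] UV(2) by auto
        qed
        show "smooth_on E (?W' \<inter> (\<lambda>x. chart_map c (chart_inv c' x)) -` ?S) (\<lambda>x. \<theta> (chart_map c (chart_inv c' x)))"
          by (rule smooth_on_compose[OF T rep_dom_ropen[OF ca(1) da(1)] _ smooth_on_subset[OF transition_smooth[OF c' ca(1)]] \<theta>(1)]) auto
        show "\<theta> (chart_map c (chart_inv c' (?i k))) = ?x0 + J' k" if "k \<in> ?S'" for k
        proof -
          have "k \<in> R" using that S'R by auto
          thus ?thesis using inv(1)[OF that] jD(2) jU(2) by simp
        qed
      qed (use J(2) k v in auto)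
      thus ?thesis using J(6)[OF v(1)] linear_0[OF J(1)] by simp
    qed
    moreover obtain L where L: "bounded_linear L" "\<And>v. v \<in> K \<Longrightarrow> dderiv ?i k v = L v"
      by (rule dderiv_linear[OF S' k smooth_on_differentiable[OF smi k]]) auto
    ultimately have "inj_on L K"
      using linear_inj_on_iff_eq_0[OF bounded_linear.linear[OF L(1)] fibre_model(1)] by auto
    thus "inj_on (dderiv ?i k) K" using L(2) by (simp cong: inj_on_cong)
  qed
  hence "e \<in> charts_at (fibre M B F ?b) p" using ca UV(3) by (simp add: charts_at_def e_simps D_def)
  \<comment> \<open>\<open>A\<close> sends \<open>dderiv \<theta> x v\<close> to
    \<open>dderiv (rep c d) x v = 0\<close>, so this vector lies in \<open>N\<close>, where
    \<open>J\<close> is injective.\<close>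
  moreover have "v = 0" if "x \<in> U" "v \<in> E" "dderiv ?\<Phi> x v = 0" "dderiv \<eta> x v = 0" for x v
  proof -
    have xS: "x \<in> ?S" using that UV(2) by auto
    have d\<theta>: "\<theta> differentiable (at x within U)" by (rule smooth_on_differentiable[OF smooth_on_subset[OF \<theta>(1) UV(2)] that(1)])
    have "((\<lambda>t. J (\<theta> (x + t *\<^sub>R v) - ?x0)) has_vector_derivative J (dderiv \<theta> x v - 0)) (at 0)"
      by (intro bounded_linear.has_vector_derivative[OF bJ(1)] has_vector_derivative_diff has_vector_derivative_const
          dderiv_line[OF UV(1) that(1,2) d\<theta>])
    hence "J (dderiv \<theta> x v) = 0" using that(4) unfolding dderiv_def[of \<eta>] \<eta>_def by (simp add: vector_derivative_at)
    moreover have "dderiv \<theta> x v \<in> N"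
      using \<theta>(5)[OF xS that(2)] that(3) dderiv_in_subspace[OF UV(1) that(1,2) d\<theta> E_sub] \<theta>(2) UV(2) by (auto simp: N_def)
    ultimately have "dderiv \<theta> x v = 0" using J(5) linear_0[OF J(2)] by metis
    thus ?thesis using UV(7) that by blast
  qed
  ultimately show ?thesis
    using UV(1,2) D(1,3) sm\<eta> by (intro that[of e U \<eta>]) (auto simp: e_simps)
qed

end

text \<open>The inclusion of a fibre into \<open>M\<close>, with \<open>d\<close> a chart of the
  fibre and \<open>c\<close> a chart of \<open>M\<close>.\<close>

definition incl :: "('p, 'e) chart \<Rightarrow> ('p, 'e) chart \<Rightarrow> 'e \<Rightarrow> 'e" where
  "incl c d y = chart_map c (chart_inv d y)"

definition incl_dom :: "('p, 'e) chart \<Rightarrow> ('p, 'e) chart \<Rightarrow> 'e set" where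
  "incl_dom c d = chart_map d ` (chart_dom d \<inter> chart_dom c)"

context smooth_submersion
begin

lemma fibre_chart_D:
  assumes "e \<in> atlas (fibre M B F b)" "q \<in> chart_dom e"
  shows "q \<in> points M" "F q = b"
  using assms is_chart_dom_subset[of "fibre_top b" K e] by (auto simp: fibre_atlas)

context
  fixes c :: "('p, 'e) chart" and d :: "('q, 'b) chart" and b :: 'q and e :: "('p, 'e) chart"
  assumes c: "c \<in> atlas M" and d: "d \<in> atlas B" and b: "b \<in> chart_dom d" and e: "e \<in> atlas (fibre M B F b)"
begin

lemma e_chart: "is_chart (fibre_top b) K e" using e by (simp add: fibre_atlas)

lemma incl_dom_ropen: "ropen K (incl_dom c e)"
proof -
  have "openin (fibre_top b) (chart_dom c \<inter> {q \<in> points M. F q = b})"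
    using M_chart[OF c] by (auto simp: openin_subtopology is_chart_def)
  from chart_image_ropen[OF e_chart fibre_model(1) this]
  have "ropen K (chart_map e ` (chart_dom e \<inter> (chart_dom c \<inter> {q \<in> points M. F q = b})))" .
  moreover have "chart_dom e \<inter> (chart_dom c \<inter> {q \<in> points M. F q = b}) = chart_dom e \<inter> chart_dom c"
    using fibre_chart_D[OF e] by auto
  ultimately show ?thesis by (simp add: incl_dom_def)
qed

lemma incl_dom_D:
  assumes "y \<in> incl_dom c e"
  shows "y \<in> chart_ran e" "chart_inv e y \<in> chart_dom e" "chart_inv e y \<in> chart_dom c" "F (chart_inv e y) = b"
    "chart_inv c (incl c e y) = chart_inv e y" "incl c e y \<in> chart_ran c"
proof -
  obtain q where q: "q \<in> chart_dom e" "q \<in> chart_dom c" "y = chart_map e q" using assms by (auto simp: incl_dom_def)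
  have inv: "chart_inv e y = q" using chart_inv_map[OF e_chart q(1)] q(3) by simp
  show "y \<in> chart_ran e" "chart_inv e y \<in> chart_dom e" "chart_inv e y \<in> chart_dom c" "F (chart_inv e y) = b"
    "chart_inv c (incl c e y) = chart_inv e y" "incl c e y \<in> chart_ran c"
    using q inv fibre_chart_D[OF e q(1)] chart_inv_map[OF M_chart[OF c] q(2)] by (auto simp: incl_def)
qed

lemma incl_smooth: "smooth_on K (incl_dom c e) (incl c e)"
  using e c by (simp add: fibre_atlas incl_dom_def incl_def[abs_def] comp_def Let_def)

lemma incl_inj: "y \<in> incl_dom c e \<Longrightarrow> inj_on (dderiv (incl c e) y) K"
proof -
  have "\<forall>y\<in>chart_map e ` (chart_dom e \<inter> chart_dom c). inj_on (dderiv (chart_map c \<circ> chart_inv e) y) K"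
    using e c unfolding fibre_atlas by blast
  thus "y \<in> incl_dom c e \<Longrightarrow> inj_on (dderiv (incl c e) y) K"
    unfolding incl_dom_def incl_def[abs_def] comp_def by blast
qed

lemma incl_rep_dom: "incl c e ` incl_dom c e \<subseteq> rep_dom c d"
  using incl_dom_D b by (auto intro!: rep_dom_I[OF c d])

lemma incl_diff: "y \<in> incl_dom c e \<Longrightarrow> incl c e differentiable (at y within incl_dom c e)"
  by (rule smooth_on_differentiable[OF incl_smooth])

lemma incl_dderiv_in: "y \<in> incl_dom c e \<Longrightarrow> a \<in> K \<Longrightarrow> dderiv (incl c e) y a \<in> E"
  by (rule dderiv_in_subspace[OF incl_dom_ropen _ _ incl_diff E_sub])
     (use incl_dom_D(6) chart_ran_subset[OF M_chart[OF c]] in auto)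

lemma incl_vertical:
  assumes y: "y \<in> incl_dom c e" and a: "a \<in> K"
  shows "dderiv (rep c d) (incl c e y) (dderiv (incl c e) y a) = 0"
proof -
  have iy: "incl c e y \<in> rep_dom c d" using y incl_rep_dom by auto
  have "dderiv (rep c d) (incl c e y) (dderiv (incl c e) y a) = dderiv (\<lambda>y. rep c d (incl c e y)) y a"
    by (rule dderiv_compose(1)[OF incl_dom_ropen y a incl_diff[OF y] rep_dom_ropen[OF c d] incl_rep_dom
          rep_differentiable[OF c d iy], symmetric])
  also have "\<dots> = dderiv (\<lambda>y. chart_map d b) y a"
    by (rule dderiv_cong[OF incl_dom_ropen y a]) (use incl_dom_D in \<open>simp add: rep_def\<close>)
  finally show ?thesis by simp
qed

lemma incl_dderiv_0:
  assumes "y \<in> incl_dom c e" "a \<in> K" "dderiv (incl c e) y a = 0"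
  shows "a = 0"
proof -
  have "dderiv (incl c e) y 0 = 0" by (simp add: dderiv_def)
  thus ?thesis using inj_onD[OF incl_inj[OF assms(1)], of a 0] assms subspace_0[OF fibre_model(1)] by simp
qed

text \<open>The image consists of vertical vectors and, the derivative being injective, has the
  dimension of the kernel; so it is the whole vertical space.\<close>

lemma incl_vcoord: "y \<in> incl_dom c e \<Longrightarrow> dderiv (incl c e) y ` K = vcoord M B F c (incl c e y)"
proof -
  assume y: "y \<in> incl_dom c e"
  have iy: "incl c e y \<in> rep_dom c d" using y incl_rep_dom by auto
  note V = vcoord_rep[OF c d iy]
  obtain L where L: "bounded_linear L" "\<And>v. v \<in> K \<Longrightarrow> dderiv (incl c e) y v = L v"
    by (rule dderiv_linear[OF incl_dom_ropen y incl_diff[OF y]]) auto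
  note lL = bounded_linear.linear[OF L(1)]
  have "inj_on L K" using incl_inj[OF y] L(2) by (simp cong: inj_on_cong)
  hence "dim (L ` K) = dim K" using dim_image_eq[OF lL, of K] fibre_model(1) by (simp add: span_eq_iff[THEN iffD2])
  also have "\<dots> = dim (vcoord M B F c (incl c e y))"
    using kernel_dim[OF c d iy] fibre_model(3) by (simp add: V)
  finally have dim: "dim (vcoord M B F c (incl c e y)) \<le> dim (L ` K)" by simp
  have "L ` K \<subseteq> vcoord M B F c (incl c e y)"
    using incl_vertical[OF y] incl_dderiv_in[OF y] L(2) by (auto simp: V)
  with dim have "L ` K = vcoord M B F c (incl c e y)"
    by (intro subspace_dim_equal linear_subspace_image[OF lL fibre_model(1)]
        vcoord_subspace[OF MA c] incl_dom_D(6)[OF y])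
  thus ?thesis using L(2) by simp
qed

end

text \<open>The atlas of a fibre is defined by a condition on each chart alone, so compatibility has
  to be proved. It goes through the chart \<open>e\<close> of \<open>fibre_chart_exists\<close>: the
  change from any chart \<open>c'\<close> to \<open>e\<close> is \<eta> after the inclusion, hence
  smooth, and its inverse is smooth by \<open>smooth_inverse\<close>. Two charts are then compared
  via \<open>e\<close>.\<close>

lemma fibre_smooth_atlas: "smooth_atlas (fibre M B F b)"
  unfolding smooth_atlas_def fibre_simps
proof (intro conjI ballI allI)
  show "subspace K" by (rule fibre_model(1))
  show "is_chart (fibre_top b) K e" if "e \<in> atlas (fibre M B F b)" for e using that by (simp add: fibre_atlas)
  fix p c1 c2 assume c1: "c1 \<in> charts_at (fibre M B F b) p" and c2: "c2 \<in> charts_at (fibre M B F b) p"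
  have a: "c1 \<in> atlas (fibre M B F b)" "c2 \<in> atlas (fibre M B F b)" "p \<in> chart_dom c1" "p \<in> chart_dom c2"
    using c1 c2 by (auto simp: charts_at_def)
  have p: "p \<in> points M" "F p = b" using fibre_chart_D[OF a(1,3)] by auto
  obtain c d where c: "c \<in> charts_at M p" and d: "d \<in> charts_at B (F p)"
    using M_chart_at[OF p(1)] B_chart_at[OF F_points[OF p(1)]] by blast
  have ca: "c \<in> atlas M" and da: "d \<in> atlas B" "b \<in> chart_dom d" using c d p by (auto simp: charts_at_def)
  obtain e \<eta> U where e: "e \<in> charts_at (fibre M B F b) p" "chart_dom e \<subseteq> chart_dom c" and U: "ropen E U"
    "U \<subseteq> rep_dom c d" "chart_map c ` chart_dom e \<subseteq> U" and \<eta>: "smooth_on E U \<eta>"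
    "\<And>q. q \<in> chart_dom e \<Longrightarrow> chart_map e q = \<eta> (chart_map c q)"
    "\<And>x v. x \<in> U \<Longrightarrow> v \<in> E \<Longrightarrow> dderiv (rep c d) x v = 0 \<Longrightarrow> dderiv \<eta> x v = 0 \<Longrightarrow> v = 0"
    using fibre_chart_exists[OF p(1) c d] unfolding p(2) by metis
  have ea: "e \<in> atlas (fibre M B F b)" "p \<in> chart_dom e" using e by (auto simp: charts_at_def)
  note che = e_chart[OF ca da ea(1)]
  have to_e: "smooth_on K (chart_map c' ` (chart_dom c' \<inter> chart_dom e)) (\<lambda>y. chart_map e (chart_inv c' y))"
    and from_e: "smooth_on K (chart_map e ` (chart_dom e \<inter> chart_dom c')) (\<lambda>y. chart_map c' (chart_inv e y))"
    and to_ropen: "ropen K (chart_map c' ` (chart_dom c' \<inter> chart_dom e))"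
    if c': "c' \<in> atlas (fibre M B F b)" for c'
  proof -
    note ch = e_chart[OF ca da c']
    let ?S = "chart_map c' ` (chart_dom c' \<inter> chart_dom e)" and ?O = "chart_map e ` (chart_dom e \<inter> chart_dom c')"
    show S: "ropen K ?S"
      using chart_image_ropen[OF ch fibre_model(1), of "chart_dom e"] che by (simp add: is_chart_def)
    have O: "ropen K ?O"
      using chart_image_ropen[OF che fibre_model(1), of "chart_dom c'"] ch by (simp add: is_chart_def)
    have S_in: "?S \<subseteq> incl_dom c c'" using e(2) by (auto simp: incl_dom_def)
    have sD: "chart_inv c' y \<in> chart_dom e" "incl c c' y \<in> U" "chart_map e (chart_inv c' y) = \<eta> (incl c c' y)"
      if "y \<in> ?S" for y
    proof -
      show 1: "chart_inv c' y \<in> chart_dom e" using that chart_inv_map[OF ch] by auto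
      show "incl c c' y \<in> U" using 1 U(3) by (auto simp: incl_def)
      show "chart_map e (chart_inv c' y) = \<eta> (incl c c' y)" using \<eta>(2)[OF 1] by (simp add: incl_def)
    qed
    have smi: "smooth_on K ?S (incl c c')" by (rule smooth_on_subset[OF incl_smooth[OF ca da c'] S_in])
    have im: "incl c c' ` ?S \<subseteq> U" using sD(2) by auto
    have "smooth_on K ?S (\<lambda>y. \<eta> (incl c c' y))" by (rule smooth_on_compose[OF S U(1) im smi \<eta>(1)])
    thus to: "smooth_on K ?S (\<lambda>y. chart_map e (chart_inv c' y))"
      by (subst smooth_on_cong[OF S]) (use sD(3) in auto)
    \<comment> \<open>The image of \<open>v\<close> under the inclusion is vertical and annihilated
      by the derivative of \<eta>, hence 0 by the last property of
      \<open>fibre_chart_exists\<close>.\<close>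
    have inj: "v = 0" if y: "y \<in> ?S" and v: "v \<in> K" "dderiv (\<lambda>y. chart_map e (chart_inv c' y)) y v = 0" for y v
    proof -
      have yi: "y \<in> incl_dom c c'" using y S_in by auto
      have iU: "incl c c' y \<in> U" by (rule sD(2)[OF y])
      note di = smooth_on_differentiable[OF smi y]
      have "dderiv (incl c c') y v \<in> E" by (rule incl_dderiv_in[OF ca da c' yi v(1)])
      moreover have "dderiv (rep c d) (incl c c' y) (dderiv (incl c c') y v) = 0" by (rule incl_vertical[OF ca da c' yi v(1)])
      moreover have "dderiv \<eta> (incl c c' y) (dderiv (incl c c') y v) = dderiv (\<lambda>y. \<eta> (incl c c' y)) y v"
        by (rule dderiv_compose(1)[OF S y v(1) di U(1) im smooth_on_differentiable[OF \<eta>(1) iU], symmetric])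
      moreover have "\<dots> = dderiv (\<lambda>y. chart_map e (chart_inv c' y)) y v"
        by (rule dderiv_cong[OF S y v(1)]) (use sD(3) in simp)
      ultimately have "dderiv (incl c c') y v = 0" using \<eta>(3)[OF iU] v(2) by simp
      thus ?thesis by (rule incl_dderiv_0[OF ca da c' yi v(1)])
    qed
    show "smooth_on K ?O (\<lambda>y. chart_map c' (chart_inv e y))"
    proof (rule smooth_inverse[OF S O to _ inj])
      show "(\<lambda>y. chart_map e (chart_inv c' y)) ` ?S \<subseteq> K" using sD(1) chart_ran_subset[OF che] by auto
      show "continuous_on ?O (\<lambda>y. chart_map c' (chart_inv e y))"
        using chart_transition_continuous[OF che ch] by (simp add: comp_def)
      show "(\<lambda>y. chart_map c' (chart_inv e y)) ` ?O \<subseteq> ?S" using chart_inv_map[OF che] by auto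
      show "chart_map e (chart_inv c' (chart_map c' (chart_inv e y))) = y" if "y \<in> ?O" for y
        using that chart_inv_map[OF che] chart_inv_map[OF ch] by auto
    qed
  qed
  note ch1 = e_chart[OF ca da a(1)]
  let ?S1 = "chart_map c1 ` (chart_dom c1 \<inter> chart_dom e)" and ?O2 = "chart_map e ` (chart_dom e \<inter> chart_dom c2)"
  let ?t = "\<lambda>y. chart_map e (chart_inv c1 y)"
  have O2: "ropen K ?O2"
    using chart_image_ropen[OF che fibre_model(1), of "chart_dom c2"] e_chart[OF ca da a(2)] by (simp add: is_chart_def)
  have W: "ropen K (?S1 \<inter> ?t -` ?O2)"
    by (rule ropen_preimage[OF to_ropen[OF a(1)] smooth_on_continuous[OF to_e[OF a(1)]] _ O2])
       (use chart_ran_subset[OF che] chart_inv_map[OF ch1] in auto)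
  have inv: "chart_inv c1 y \<in> chart_dom c2 \<and> chart_inv e (?t y) = chart_inv c1 y" if y: "y \<in> ?S1 \<inter> ?t -` ?O2" for y
  proof -
    obtain q q' where q: "q \<in> chart_dom c1" "q \<in> chart_dom e" "y = chart_map c1 q"
      and q': "q' \<in> chart_dom e" "q' \<in> chart_dom c2" "?t y = chart_map e q'" using y by blast
    have 1: "chart_inv c1 y = q" using q chart_inv_map[OF ch1] by simp
    have 2: "chart_inv e (?t y) = q'" using q'(3) chart_inv_map[OF che q'(1)] by simp
    have "chart_inv e (?t y) = q" using 1 chart_inv_map[OF che q(2)] by simp
    thus ?thesis using 1 2 q' by simp
  qed
  have "smooth_on K (?S1 \<inter> ?t -` ?O2) (\<lambda>y. chart_map c2 (chart_inv e (?t y)))"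
    by (rule smooth_on_compose[OF W O2 _ smooth_on_subset[OF to_e[OF a(1)]] from_e[OF a(2)]]) auto
  hence "smooth_on K (?S1 \<inter> ?t -` ?O2) (chart_map c2 \<circ> chart_inv c1)"
    by (subst smooth_on_cong[OF W, where g="\<lambda>y. chart_map c2 (chart_inv e (?t y))"]) (use inv in auto)
  moreover have "chart_map c1 p \<in> ?S1 \<inter> ?t -` ?O2" using a ea chart_inv_map[OF ch1 a(3)] by auto
  moreover have "?S1 \<inter> ?t -` ?O2 \<subseteq> chart_map c1 ` (chart_dom c1 \<inter> chart_dom c2)"
  proof
    fix y assume y: "y \<in> ?S1 \<inter> ?t -` ?O2"
    then obtain q where q: "q \<in> chart_dom c1" "y = chart_map c1 q" by auto
    thus "y \<in> chart_map c1 ` (chart_dom c1 \<inter> chart_dom c2)"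
      using inv[OF y] chart_inv_map[OF ch1 q(1)] by auto
  qed
  ultimately show "\<exists>W. ropen K W \<and> chart_map c1 p \<in> W \<and> W \<subseteq> chart_map c1 ` (chart_dom c1 \<inter> chart_dom c2) \<and>
      smooth_on K W (chart_map c2 \<circ> chart_inv c1)" using W by blast
qed

end

section \<open>Sectional curvatures of a Clairaut submersion\<close>

text \<open>\<open>c_some\<close> and \<open>e_some\<close> fix the charts to those chosen inside
  \<open>sec_curv\<close> on \<open>M\<close> and on the fibre, so the curvatures are computed there
  without changing charts.\<close>

locale clairaut_point = smooth_submersion M B F
  for M :: "('p, 'e::euclidean_space) manifold" and B :: "('q, 'b::euclidean_space) manifold" and F :: "'p \<Rightarrow> 'q" +
  fixes g :: "'p metric_field" and g' :: "'q metric_field" and dil f :: "'p \<Rightarrow> real" and p :: 'p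
    and c :: "('p, 'e) chart" and d :: "('q, 'b) chart" and e :: "('p, 'e) chart"
  assumes Mg: "riemannian_manifold M g" and f: "smooth_fun M f"
    and cl: "clairaut_conformal_submersion M g B g' F dil (\<lambda>q. exp (f q))"
    and c_at: "c \<in> charts_at M p" and d_at: "d \<in> charts_at B (F p)"
    and e_at: "e \<in> charts_at (fibre M B F (F p)) p"
    and c_some: "c = (SOME c. c \<in> charts_at M p)" and e_some: "e = (SOME e. e \<in> charts_at (fibre M B F (F p)) p)"
begin

lemma ca: "c \<in> atlas M" and da: "d \<in> atlas B" "F p \<in> chart_dom d" and ea: "e \<in> atlas (fibre M B F (F p))"
  using c_at d_at e_at by (auto simp: charts_at_def)

abbreviation "G \<equiv> metric_coord M g c"
abbreviation "H \<equiv> metric_coord (fibre M B F (F p)) (fibre_metric M g) e"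
abbreviation "x0 \<equiv> chart_map c p"
abbreviation "y0 \<equiv> chart_map e p"
abbreviation "\<iota> \<equiv> incl c e"
abbreviation "T \<equiv> incl_dom c e"
abbreviation "f0 \<equiv> \<lambda>x. f (chart_inv c x)"

lemmas T_ropen = incl_dom_ropen[OF ca da ea]
lemmas T_D = incl_dom_D[OF ca da ea]
lemmas \<iota>_smooth = incl_smooth[OF ca da ea]
lemmas \<iota>_diff = incl_diff[OF ca da ea]
lemmas D\<iota>_in = incl_dderiv_in[OF ca da ea]
lemmas D\<iota>_0 = incl_dderiv_0[OF ca da ea]
lemmas FA = fibre_smooth_atlas[of "F p"]

lemma p_inv: "chart_inv c x0 = p" "chart_inv e y0 = p"
  using charts_at_inv[OF MA refl c_at] charts_at_inv[OF FA refl e_at] by auto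

lemma \<iota>_y0: "\<iota> y0 = x0" using p_inv by (simp add: incl_def)

lemma y0_T: "y0 \<in> T" using c_at e_at by (auto simp: incl_dom_def charts_at_def)

lemma x0_ran: "x0 \<in> chart_ran c" using c_at by (auto simp: charts_at_def)

lemma x0_rep: "x0 \<in> rep_dom c d" using rep_dom_I[OF ca da(1) x0_ran] p_inv da(2) by simp

sublocale G: local_metric E "chart_ran c" G
  by (rule riemannian_local_metric[OF Mg ca])

lemma differential_incl:
  assumes y: "y \<in> T" and a: "a \<in> K"
  shows "differential M id (chart_inv e y) (coord_vec (fibre M B F (F p)) e (chart_inv e y) a) =
    coord_vec M c (chart_inv e y) (dderiv \<iota> y a)"
proof -
  have e': "e \<in> charts_at (fibre M B F (F p)) (chart_inv e y)" using ea T_D(2)[OF y] by (simp add: charts_at_def)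
  have "differential M id (chart_inv e y) (coord_vec (fibre M B F (F p)) e (chart_inv e y) a) =
    coord_vec M c (id (chart_inv e y)) (dderiv (\<lambda>x. chart_map c (id (chart_inv e x))) (chart_map e (chart_inv e y)) a)"
    by (rule differential_coord_vec[OF FA MA e', where W=T])
       (use T_D[OF y] T_D ca y a chart_map_inv[OF T_D(1)[OF y]] T_ropen \<iota>_smooth in
         \<open>auto simp: fibre_simps charts_at_def incl_def[abs_def]\<close>)
  thus ?thesis using chart_map_inv[OF T_D(1)[OF y]] by (simp add: incl_def[abs_def])
qed

lemma H_eq:
  assumes y: "y \<in> T" and ab: "a \<in> K" "b \<in> K"
  shows "H y a b = G (\<iota> y) (dderiv \<iota> y a) (dderiv \<iota> y b)"
  using differential_incl[OF y ab(1)] differential_incl[OF y ab(2)] T_D(5)[OF y]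
  by (simp add: metric_coord_def Let_def fibre_metric_def)

lemma D\<iota>_lin:
  assumes y: "y \<in> T" and ab: "a \<in> K" "b \<in> K"
  shows "dderiv \<iota> y (s *\<^sub>R a + t *\<^sub>R b) = s *\<^sub>R dderiv \<iota> y a + t *\<^sub>R dderiv \<iota> y b"
proof -
  obtain L where L: "bounded_linear L" "\<And>a. a \<in> K \<Longrightarrow> dderiv \<iota> y a = L a"
    by (rule dderiv_linear[OF T_ropen y \<iota>_diff[OF y]]) auto
  note lL = bounded_linear.linear[OF L(1)]
  have "s *\<^sub>R a + t *\<^sub>R b \<in> K" using ab fibre_model(1) by (simp add: subspace_add subspace_scale)
  thus ?thesis using ab by (simp add: L(2) linear_add[OF lL] linear_scale[OF lL])
qed

text \<open>Inherited from \<open>G\<close> by pullback under \<iota>; positivity rests on the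
  injectivity of its derivative.\<close>

sublocale H: local_metric K T H
proof
  show "ropen K T" by (rule T_ropen)
  have K_lin: "s *\<^sub>R a + t *\<^sub>R b \<in> K" if "a \<in> K" "b \<in> K" for a b s t
    using that fibre_model(1) by (simp add: subspace_add subspace_scale)
  show "H y (s *\<^sub>R a + t *\<^sub>R b) u = s *\<^sub>R H y a u + t *\<^sub>R H y b u" if "y \<in> T" "a \<in> K" "b \<in> K" "u \<in> K" for y a b u s t
    using that K_lin T_D(6)[OF that(1)] D\<iota>_in[OF that(1)] D\<iota>_lin[OF that(1-3)] by (simp add: H_eq G.left[simplified])
  show "H y u (s *\<^sub>R a + t *\<^sub>R b) = s *\<^sub>R H y u a + t *\<^sub>R H y u b" if "y \<in> T" "a \<in> K" "b \<in> K" "u \<in> K" for y a b u s t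
    using that K_lin T_D(6)[OF that(1)] D\<iota>_in[OF that(1)] D\<iota>_lin[OF that(1-3)] by (simp add: H_eq G.right[simplified])
  show "smooth_on K T (\<lambda>y. H y a b)" if "a \<in> K" "b \<in> K" for a b
  proof -
    have "smooth_on K T (\<lambda>y. G (\<iota> y) (dderiv \<iota> y a) (dderiv \<iota> y b))"
      by (rule G.smooth_compose[OF T_ropen _ \<iota>_smooth _ smooth_on_dderiv[OF \<iota>_smooth that(1)] _ smooth_on_dderiv[OF \<iota>_smooth that(2)]])
         (use T_D(6) D\<iota>_in that in auto)
    thus ?thesis by (subst smooth_on_cong[OF T_ropen]) (use H_eq that in auto)
  qed
  show "H y a b = H y b a" if "y \<in> T" "a \<in> K" "b \<in> K" for y a b
    using that G.sym[OF T_D(6)[OF that(1)] D\<iota>_in[OF that(1,2)] D\<iota>_in[OF that(1,3)]] by (simp add: H_eq)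
  show "0 < H y a a" if "y \<in> T" "a \<in> K" "a \<noteq> 0" for y a
    using that G.pos[OF T_D(6)[OF that(1)] D\<iota>_in[OF that(1,2)]] D\<iota>_0[OF that(1,2)] by (auto simp: H_eq)
qed

section \<open>The second fundamental form of the fibre and the gradient\<close>

lemma f0_smooth: "smooth_on E (chart_ran c) f0"
  using f ca by (simp add: smooth_fun_def comp_def)

text \<open>For each \<open>s\<close> another geodesic is used: it starts at \<open>x0\<close> with
  vertical part \<open>u\<close> and horizontal part \<open>s *\<^sub>R z\<close>. The same field
  \<open>W\<close> serves all of them.\<close>

lemma clairaut_critical:
  assumes u: "u \<in> vcoord M B F c x0" "u \<noteq> 0" and z: "z \<in> E" "\<And>w. w \<in> vcoord M B F c x0 \<Longrightarrow> G x0 z w = 0"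
    and W: "ropen E U" "U \<subseteq> rep_dom c d" "x0 \<in> U" "W ` U \<subseteq> E" "smooth_on E U W" "W x0 = u"
      "\<And>x. x \<in> U \<Longrightarrow> dderiv (rep c d) x (W x) = 0"
  shows "let v = W x0 + s *\<^sub>R z in dderiv f0 x0 v * (2 * G x0 v (W x0) - G x0 (W x0) (W x0))
     + G x0 (v - W x0) (dderiv W x0 v + G.\<Gamma> x0 v (W x0)) = 0"
proof -
  let ?V = "vcoord M B F c"
  have uE: "u \<in> E" using u(1) by (simp add: vcoord_def)
  define v where "v = u + s *\<^sub>R z"
  have vE: "v \<in> E" using uE z(1) by (simp add: v_def)
  have orth: "G x0 (v - u) w = 0" if "w \<in> ?V x0" for w
  proof -
    have "w \<in> E" using that by (simp add: vcoord_def)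
    thus ?thesis using G.scale_left[OF x0_ran z(1)] z(2)[OF that] by (simp add: v_def)
  qed
  \<comment> \<open>As \<open>u\<close> is nonzero this product is positive, which makes the initial
    velocity \<open>v\<close> nonzero for every \<open>s\<close>.\<close>
  have "G x0 v u = G x0 u u" using orth[OF u(1)] G.diff_left[OF x0_ran vE uE uE] by simp
  hence v0: "v \<noteq> 0" using G.pos[OF x0_ran uE u(2)] G.zero_left[OF x0_ran uE] by auto
  have UV: "W x \<in> ?V x" if "x \<in> U" for x
    using vcoord_rep[OF ca da(1), of x] W(2,4,7) that by auto
  have Ur: "U \<subseteq> chart_ran c" using W(2) rep_dom_D[OF ca da(1)] by auto
  obtain \<epsilon> x x' where \<epsilon>: "\<epsilon> > 0" "x 0 = x0" "x' 0 = v"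
    and xx': "\<And>t. t \<in> {-\<epsilon><..<\<epsilon>} \<Longrightarrow> x t \<in> chart_ran c \<and> x' t \<in> E \<and> (x has_vector_derivative x' t) (at t) \<and>
      (x' has_vector_derivative - G.\<Gamma> (x t) (x' t) (x' t)) (at t)"
    and le: "\<And>t w. t \<in> {-\<epsilon><..<\<epsilon>} \<Longrightarrow> w \<in> ?V (x t) \<Longrightarrow>
      exp (2 * f0 (x t)) * (2 * G (x t) (x' t) w - G (x t) w w) \<le> exp (2 * f0 x0) * (2 * G x0 v u - G x0 u u)"
    using clairaut_geodesic[OF Mg ca cl x0_ran vE v0 u(1) orth] by blast
  have "dderiv f0 x0 v * (2 * G x0 v (W x0) - G x0 (W x0) (W x0))
     + G x0 (v - W x0) (dderiv W x0 v + G.\<Gamma> x0 v (W x0)) = 0"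
    by (rule G.clairaut_derivative[OF W(1) Ur W(3,4) smooth_on_differentiable[OF W(5,3)]
          smooth_on_differentiable[OF f0_smooth x0_ran] vE \<epsilon> xx'])
       (use le UV in \<open>auto simp: W(6)\<close>)
  thus ?thesis by (simp add: v_def W(6) Let_def)
qed

text \<open>\<open>umbilic_at\<close> involves the derivative of a vertical field \<open>W\<close>,
  the Gauss equation the second derivative of \<iota>. Along the line through \<open>x0\<close> and
  along the fibre, \<open>W\<close> and \<open>dderiv \<iota>\<close> give vertical vectors that
  start at the same \<open>u\<close>, with base velocity \<open>u\<close> in both cases.
  Differentiating their verticality shows that the two derivatives have the same image under the
  derivative of \<open>rep c d\<close>. They differ by a vertical vector, which \<open>z\<close>
  does not see.\<close>

lemma umbilic_fibre:
  assumes a: "a \<in> K" and z: "z \<in> E" "\<And>b. b \<in> K \<Longrightarrow> G x0 z (dderiv \<iota> y0 b) = 0"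
  shows "dderiv f0 x0 (dderiv \<iota> y0 a) = 0"
    "dderiv f0 x0 z * H y0 a a + G x0 z (dderiv (\<lambda>y. dderiv \<iota> y a) y0 a + G.\<Gamma> x0 (dderiv \<iota> y0 a) (dderiv \<iota> y0 a)) = 0"
proof -
  define u where "u = dderiv \<iota> y0 a"
  note V = incl_vcoord[OF ca da ea y0_T, unfolded \<iota>_y0]
  have uV: "u \<in> vcoord M B F c x0" using a V by (auto simp: u_def)
  have uE: "u \<in> E" using uV by (simp add: vcoord_def)
  have du: "dderiv (rep c d) x0 u = 0" using uV vcoord_rep[OF ca da(1) x0_rep] by simp
  have zV: "G x0 z w = 0" if "w \<in> vcoord M B F c x0" for w using that z(2) unfolding V[symmetric] by auto
  have Hu: "H y0 a a = G x0 u u" using H_eq[OF y0_T a a] by (simp add: \<iota>_y0 u_def)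
  have D2in: "dderiv (\<lambda>y. dderiv \<iota> y a) y0 a \<in> E"
    by (rule dderiv_in_subspace[OF T_ropen y0_T a smooth_on_differentiable[OF smooth_on_dderiv[OF \<iota>_smooth a] y0_T] E_sub D\<iota>_in[OF _ a]])
  have "dderiv f0 x0 u = 0 \<and> dderiv f0 x0 z * H y0 a a + G x0 z (dderiv (\<lambda>y. dderiv \<iota> y a) y0 a + G.\<Gamma> x0 u u) = 0"
  proof (cases "u = 0")
    \<comment> \<open>Since \<iota> is an immersion, \<open>a = 0\<close> and every term vanishes.
      In the other case \<open>u \<noteq> 0\<close> gives nonconstant geodesics and allows division
      by \<open>G x0 u u\<close>.\<close>
    case True
    have "a = 0" using D\<iota>_0[OF y0_T a] True by (simp add: u_def)
    hence "dderiv (\<lambda>y. dderiv \<iota> y a) y0 a = 0" by (simp add: dderiv_def)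
    thus ?thesis
      using True Hu x0_ran z(1) by (simp_all add: dderiv_def G.zero_left G.zero_right G.\<Gamma>.zero_left)
  next
    case False
    obtain U W where W: "ropen E U" "U \<subseteq> rep_dom c d" "x0 \<in> U" "W ` U \<subseteq> E" "smooth_on E U W" "W x0 = u"
      "\<And>x. x \<in> U \<Longrightarrow> dderiv (rep c d) x (W x) = 0"
      by (rule vertical_extension[OF rep_dom_ropen[OF ca da(1)] EB_sub rep_smooth[OF ca da(1)] rep_in[OF ca da(1)]
            x0_rep rep_surj[OF ca da(1) x0_rep] uE du]) auto
    have Ur: "U \<subseteq> chart_ran c" using W(2) rep_dom_D[OF ca da(1)] by auto
    have zu: "G x0 z (W x0) = 0" using zV[OF uV] W(6) by simp
    note dW = smooth_on_differentiable[OF W(5,3)]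
    note umb = G.umbilic_at[OF W(1) Ur W(3,4) dW smooth_on_differentiable[OF f0_smooth x0_ran] z(1) zu
        clairaut_critical[OF uV False z(1) zV W], unfolded W(6)]
    have "dderiv f0 x0 u = 0" using umb(1) G.pos[OF x0_ran uE False] by simp
    have dWE: "dderiv W x0 u \<in> E" by (rule dderiv_in_subspace[OF W(1,3) uE dW E_sub]) (use W(4) in auto)
    let ?\<Phi> = "rep c d"
    have WD: "((\<lambda>t. W (x0 + t *\<^sub>R u)) has_vector_derivative dderiv W x0 u) (at 0)" by (rule dderiv_line[OF W(1,3) uE dW])
    have evU: "\<forall>\<^sub>F t in nhds (0::real). x0 + t *\<^sub>R u \<in> U" by (rule ropen_line[OF W(1,3) uE])
    have "((\<lambda>t. dderiv ?\<Phi> (x0 + t *\<^sub>R u) (W (x0 + t *\<^sub>R u))) has_vector_derivative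
      dderiv (\<lambda>x. dderiv ?\<Phi> x u) x0 u + dderiv ?\<Phi> x0 (dderiv W x0 u)) (at 0)"
      using dderiv_curve[OF rep_dom_ropen[OF ca da(1)] rep_smooth[OF ca da(1)] line_has_vector_derivative _ WD] W(6)
        eventually_mono[OF evU, of "\<lambda>t. x0 + t *\<^sub>R u \<in> rep_dom c d"] eventually_mono[OF evU, of "\<lambda>t. W (x0 + t *\<^sub>R u) \<in> E"] W(2,4)
      by (auto simp: subset_iff image_subset_iff)
    moreover have "((\<lambda>t. dderiv ?\<Phi> (x0 + t *\<^sub>R u) (W (x0 + t *\<^sub>R u))) has_vector_derivative 0) (at 0)"
      by (rule has_vector_derivative_eventually_eq[OF has_vector_derivative_const])
         (use evU in eventually_elim, use W(7) in simp)
    ultimately have 1: "dderiv (\<lambda>x. dderiv ?\<Phi> x u) x0 u + dderiv ?\<Phi> x0 (dderiv W x0 u) = 0"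
      by (rule vector_derivative_unique_at)
    have \<iota>D: "((\<lambda>t. \<iota> (y0 + t *\<^sub>R a)) has_vector_derivative u) (at 0)"
      unfolding u_def by (rule dderiv_line[OF T_ropen y0_T a \<iota>_diff[OF y0_T]])
    have \<iota>DD: "((\<lambda>t. dderiv \<iota> (y0 + t *\<^sub>R a) a) has_vector_derivative dderiv (\<lambda>y. dderiv \<iota> y a) y0 a) (at 0)"
      by (rule dderiv_line[OF T_ropen y0_T a smooth_on_differentiable[OF smooth_on_dderiv[OF \<iota>_smooth a] y0_T]])
    have evT: "\<forall>\<^sub>F t in nhds (0::real). y0 + t *\<^sub>R a \<in> T" by (rule ropen_line[OF T_ropen y0_T a])
    have ev1: "\<forall>\<^sub>F t in nhds (0::real). \<iota> (y0 + t *\<^sub>R a) \<in> rep_dom c d"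
      using evT by eventually_elim (use incl_rep_dom[OF ca da ea] in auto)
    have ev2: "\<forall>\<^sub>F t in nhds (0::real). dderiv \<iota> (y0 + t *\<^sub>R a) a \<in> E"
      using evT by eventually_elim (rule D\<iota>_in[OF _ a])
    have "((\<lambda>t. dderiv ?\<Phi> (\<iota> (y0 + t *\<^sub>R a)) (dderiv \<iota> (y0 + t *\<^sub>R a) a)) has_vector_derivative
      dderiv (\<lambda>x. dderiv ?\<Phi> x u) x0 u + dderiv ?\<Phi> x0 (dderiv (\<lambda>y. dderiv \<iota> y a) y0 a)) (at 0)"
      using dderiv_curve[OF rep_dom_ropen[OF ca da(1)] rep_smooth[OF ca da(1)] \<iota>D ev1 \<iota>DD ev2] by (simp add: \<iota>_y0 u_def)
    moreover have "((\<lambda>t. dderiv ?\<Phi> (\<iota> (y0 + t *\<^sub>R a)) (dderiv \<iota> (y0 + t *\<^sub>R a) a)) has_vector_derivative 0) (at 0)"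
      by (rule has_vector_derivative_eventually_eq[OF has_vector_derivative_const])
         (use evT in eventually_elim, use incl_vertical[OF ca da ea _ a] in simp)
    ultimately have 2: "dderiv (\<lambda>x. dderiv ?\<Phi> x u) x0 u + dderiv ?\<Phi> x0 (dderiv (\<lambda>y. dderiv \<iota> y a) y0 a) = 0"
      by (rule vector_derivative_unique_at)
    have "dderiv ?\<Phi> x0 (dderiv W x0 u - dderiv (\<lambda>y. dderiv \<iota> y a) y0 a) = 0"
    proof -
      obtain L where L: "bounded_linear L" "\<And>v. v \<in> E \<Longrightarrow> dderiv ?\<Phi> x0 v = L v"
        by (rule dderiv_linear[OF rep_dom_ropen[OF ca da(1)] x0_rep rep_differentiable[OF ca da(1) x0_rep]]) auto
      have "dderiv ?\<Phi> x0 (dderiv W x0 u) = dderiv ?\<Phi> x0 (dderiv (\<lambda>y. dderiv \<iota> y a) y0 a)"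
        using 1 2 by (metis add_left_cancel)
      thus ?thesis using dWE D2in by (simp add: L(2) linear_diff[OF bounded_linear.linear[OF L(1)]])
    qed
    hence "dderiv W x0 u - dderiv (\<lambda>y. dderiv \<iota> y a) y0 a \<in> vcoord M B F c x0"
      using vcoord_rep[OF ca da(1) x0_rep] dWE D2in by simp
    from zV[OF this] have "G x0 z (dderiv W x0 u) = G x0 z (dderiv (\<lambda>y. dderiv \<iota> y a) y0 a)"
      using G.diff_right[OF x0_ran dWE D2in z(1)] by simp
    thus ?thesis
      using \<open>dderiv f0 x0 u = 0\<close> umb(2) Hu x0_ran z(1) uE dWE D2in by (simp add: G.add_right)
  qed
  thus "dderiv f0 x0 (dderiv \<iota> y0 a) = 0"
    "dderiv f0 x0 z * H y0 a a + G x0 z (dderiv (\<lambda>y. dderiv \<iota> y a) y0 a + G.\<Gamma> x0 (dderiv \<iota> y0 a) (dderiv \<iota> y0 a)) = 0"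
    by (simp_all add: u_def)
qed

text \<open>The Riesz representative of the differential of \<open>f\<close> in the chart; its
  uniqueness resolves the definite description in \<open>gradient\<close>.\<close>

lemma gradient_coord:
  obtains N where "N \<in> E" "gradient M g f p = coord_vec M c p N" "\<And>z. z \<in> E \<Longrightarrow> G x0 N z = dderiv f0 x0 z"
proof -
  obtain L where L: "bounded_linear L" "\<And>v. v \<in> E \<Longrightarrow> dderiv f0 x0 v = L v"
    by (rule dderiv_linear[OF G.ropen x0_ran smooth_on_differentiable[OF f0_smooth x0_ran]]) auto
  obtain N where N: "N \<in> E" "\<And>z. z \<in> E \<Longrightarrow> G x0 N z = dderiv f0 x0 z"
    using G.riesz[OF x0_ran bounded_linear.linear[OF L(1)]] L(2) by auto
  have sf: "smooth_at M p f"
    unfolding smooth_at_def using c_at x0_ran G.ropen f0_smooth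
    by (intro bexI[OF _ c_at] exI[of _ "chart_ran c"]) (auto simp: ropen_def comp_def)
  have ev: "coord_vec M c p z f = dderiv f0 x0 z" for z using sf by (simp add: coord_vec_def comp_def)
  have Gg: "g p (coord_vec M c p a) (coord_vec M c p b) = G x0 a b" for a b
    using metric_coord_at[OF MA c_at] by simp
  have "gradient M g f p = coord_vec M c p N"
    unfolding gradient_def
  proof (rule the_equality, intro conjI ballI)
    show "coord_vec M c p N \<in> tangent_space M p" by (rule coord_vec_in[OF MA refl c_at N(1)])
    show "g p (coord_vec M c p N) v = v f" if v: "v \<in> tangent_space M p" for v
      by (rule tangent_space_chart[OF MA c_at v]) (use Gg N(2) ev in auto)
    fix w assume w: "w \<in> tangent_space M p \<and> (\<forall>v\<in>tangent_space M p. g p w v = v f)"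
    obtain b where b: "b \<in> E" "w = coord_vec M c p b" using tangent_space_chart[OF MA c_at] w by blast
    have "G x0 b z = G x0 N z" if "z \<in> E" for z
    proof -
      have "g p (coord_vec M c p b) (coord_vec M c p z) = coord_vec M c p z f"
        using w b coord_vec_in[OF MA refl c_at that] by blast
      thus ?thesis by (simp add: Gg ev N(2)[OF that])
    qed
    hence "b = N" by (rule G.eq_by_metric[OF x0_ran b(1) N(1)])
    thus "w = coord_vec M c p N" using b by simp
  qed
  thus ?thesis using that N by blast
qed

lemma to_fibre_coord:
  assumes a: "a \<in> K"
  shows "to_fibre M B F p (coord_vec M c p (dderiv \<iota> y0 a)) = coord_vec (fibre M B F (F p)) e p a"
  unfolding to_fibre_def
proof (rule the_equality, intro conjI)
  note D = differential_incl[OF y0_T, unfolded p_inv]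
  show "coord_vec (fibre M B F (F p)) e p a \<in> tangent_space (fibre M B F (F p)) p"
    by (rule coord_vec_in[OF FA refl e_at]) (simp add: fibre_simps a)
  show "differential M id p (coord_vec (fibre M B F (F p)) e p a) = coord_vec M c p (dderiv \<iota> y0 a)" by (rule D[OF a])
  fix u assume u: "u \<in> tangent_space (fibre M B F (F p)) p \<and> differential M id p u = coord_vec M c p (dderiv \<iota> y0 a)"
  then obtain a' where a': "a' \<in> K" "u = coord_vec (fibre M B F (F p)) e p a'"
    using tangent_space_chart[OF FA e_at] unfolding fibre_simps by blast
  have "dderiv \<iota> y0 a' = dderiv \<iota> y0 a"
    using coord_vec_inj[OF MA refl c_at D\<iota>_in[OF y0_T a'(1)] D\<iota>_in[OF y0_T a]] u D[OF a'(1)] a'(2) by simp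
  hence "a' = a" using inj_onD[OF incl_inj[OF ca da ea y0_T]] a a'(1) by blast
  thus "u = coord_vec (fibre M B F (F p)) e p a" using a' by simp
qed

text \<open>For an orthonormal pair the denominators of both sectional curvatures are 1, so the
  claim is the Gauss equation in the chosen charts with the gradient of \<open>f\<close> as normal
  vector \<open>N\<close>.\<close>

lemma sec_curv_vertical:
  assumes u: "u \<in> vertical M B F p" and v: "v \<in> vertical M B F p"
    and on: "g p u u = 1" "g p v v = 1" "g p u v = 0"
  shows "sec_curv M g p u v = fibre_sec_curv M g B F p u v - (gnorm g p (gradient M g f p))\<^sup>2"
proof -
  let ?Fb = "fibre M B F (F p)" and ?D = "dderiv \<iota> y0"
  have V: "\<exists>a\<in>K. w = coord_vec M c p (?D a)" if w: "w \<in> vertical M B F p" for w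
  proof -
    have "w \<in> vertical M B F (chart_inv c x0)" using w p_inv by simp
    then obtain b where "b \<in> vcoord M B F c x0" "w = coord_vec M c (chart_inv c x0) b"
      by (rule vertical_vcoord[OF MA ca x0_ran])
    thus ?thesis unfolding p_inv incl_vcoord[OF ca da ea y0_T, unfolded \<iota>_y0, symmetric] by blast
  qed
  obtain a where a: "a \<in> K" "u = coord_vec M c p (?D a)" using V[OF u] by blast
  obtain b where b: "b \<in> K" "v = coord_vec M c p (?D b)" using V[OF v] by blast
  note DE = D\<iota>_in[OF y0_T]
  have Gg: "g p (coord_vec M c p a) (coord_vec M c p b) = G x0 a b" for a b
    using metric_coord_at[OF MA c_at] by simp
  have Hy: "H y0 s t = G x0 (?D s) (?D t)" if "s \<in> K" "t \<in> K" for s t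
    using H_eq[OF y0_T that] by (simp add: \<iota>_y0)
  have Hon: "H y0 a a = 1" "H y0 b b = 1" "H y0 a b = 0"
    using on a b Gg by (simp_all add: Hy)
  obtain N where N: "N \<in> E" "gradient M g f p = coord_vec M c p N" "\<And>z. z \<in> E \<Longrightarrow> G x0 N z = dderiv f0 x0 z"
    by (rule gradient_coord) blast
  have z0: "G x0 0 w = 0" if "w \<in> E" for w by (rule G.zero_left[OF x0_ran that])
  have gauss: "G x0 (curv E G x0 (?D a) (?D b) (?D b)) (?D a) = H y0 (curv K H y0 a b b) a - G x0 N N"
  proof -
    \<comment> \<open>The gradient is horizontal by the first conclusion of
      \<open>umbilic_fibre\<close>, in which \<open>z\<close> does not occur; it is taken with
      \<open>z = 0\<close>.\<close>
    have tan: "G (\<iota> y0) N (?D s) = 0" if s: "s \<in> K" for s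
      unfolding \<iota>_y0 using N(3)[OF DE[OF s]] umbilic_fibre(1)[OF s G.in_E(4)] z0[OF DE] by simp
    have umb: "G (\<iota> y0) z (dderiv (\<lambda>y. dderiv \<iota> y s) y0 s + G.\<Gamma> (\<iota> y0) (?D s) (?D s)) = - H y0 s s * G (\<iota> y0) z N"
      if s: "s \<in> K" and z: "z \<in> E" "\<And>t. t \<in> K \<Longrightarrow> G (\<iota> y0) z (?D t) = 0" for s z
      using umbilic_fibre(2)[OF s z(1)] z(2) N(3)[OF z(1)] G.sym[OF x0_ran N(1) z(1)] unfolding \<iota>_y0
      by (simp add: mult.commute)
    have im: "\<iota> ` T \<subseteq> chart_ran c" using T_D(6) by auto
    have "G (\<iota> y0) (curv E G (\<iota> y0) (?D a) (?D b) (?D b)) (?D a) = H y0 (curv K H y0 a b b) a - G (\<iota> y0) N N"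
      by (rule gauss_equation[OF G.local_metric_axioms H.local_metric_axioms \<iota>_smooth im _ y0_T N(1) _ _ a(1) b(1) Hon])
        (fact H_eq tan umb)+
    thus ?thesis unfolding \<iota>_y0 .
  qed
  have "sec_curv M g p u v = G x0 (curv E G x0 (?D a) (?D b) (?D b)) (?D a)"
    using on a b components_coord_vec[OF MA refl c_at DE[OF a(1)]] components_coord_vec[OF MA refl c_at DE[OF b(1)]]
    by (simp add: sec_curv_def c_some[symmetric] curvature_eq_curv Let_def)
  moreover have "fibre_sec_curv M g B F p u v = H y0 (curv K H y0 a b b) a"
  proof -
    have Hf: "fibre_metric M g p (coord_vec ?Fb e p s) (coord_vec ?Fb e p t) = H y0 s t" for s t
      using metric_coord_at[OF FA e_at] by simp
    have comp: "components ?Fb e p (coord_vec ?Fb e p s) = s" if "s \<in> K" for s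
      by (rule components_coord_vec[OF FA refl e_at]) (simp add: fibre_simps that)
    show ?thesis
      unfolding fibre_sec_curv_def a(2) b(2) to_fibre_coord[OF a(1)] to_fibre_coord[OF b(1)]
      using Hon comp[OF a(1)] comp[OF b(1)]
      by (simp add: sec_curv_def e_some[symmetric] curvature_eq_curv Hf fibre_simps Let_def)
  qed
  moreover have "(gnorm g p (gradient M g f p))\<^sup>2 = G x0 N N"
  proof -
    have "G x0 N N \<ge> 0" using G.pos[OF x0_ran N(1)] z0[OF N(1)] by (cases "N = 0") auto
    thus ?thesis by (simp add: gnorm_def N(2) Gg)
  qed
  ultimately show ?thesis using gauss by simp
qed

end

theorem theorem11:
  fixes M :: "('p, 'e::euclidean_space) manifold" and g :: "'p metric_field"
    and B :: "('q, 'b::euclidean_space) manifold" and g' :: "'q metric_field"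
    and F :: "'p \<Rightarrow> 'q" and dil f :: "'p \<Rightarrow> real" and m n :: nat
    and p :: 'p and U :: "nat \<Rightarrow> 'p tangent"
  assumes "riemannian_manifold M g" and "mdim M = m"
    and "riemannian_manifold B g'" and "mdim B = n"
    and "smooth_fun M f"
    and "clairaut_conformal_submersion M g B g' F dil (\<lambda>q. exp (f q))"
    and "p \<in> points M"
    and "vertical_orthonormal_basis M g B F p U"
  shows "vertical_scalar_curv M g B p U =
           fibre_scalar_curv M g B F p U
             - (real m - real n) * (real m - real n - 1) * (gnorm g p (gradient M g f p))\<^sup>2"
proof -
  interpret smooth_submersion M B F
    using assms by unfold_locales
      (auto simp: riemannian_manifold_def clairaut_conformal_submersion_def conformal_submersion_def)
  obtain c d where cd: "c \<in> charts_at M p" "d \<in> charts_at B (F p)"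
    using M_chart_at[OF assms(7)] B_chart_at[OF F_points[OF assms(7)]] by blast
  \<comment> \<open>Guarantees that the \<open>SOME\<close> in the sectional curvature of the fibre
    picks an actual chart.\<close>
  have "\<exists>e. e \<in> charts_at (fibre M B F (F p)) p" by (rule fibre_chart_exists[OF assms(7) cd]) blast
  then interpret clairaut_point M B F g g' dil f p "SOME c. c \<in> charts_at M p" d "SOME e. e \<in> charts_at (fibre M B F (F p)) p"
    using assms cd by unfold_locales (auto intro: someI)
  define k where "k = m - n"
  have nm: "n \<le> m" using dim_le[OF assms(7)] assms(2,4) by simp
  let ?N = "(gnorm g p (gradient M g f p))\<^sup>2"
  have basis: "\<And>i. i < k \<Longrightarrow> U i \<in> vertical M B F p"
    "\<And>i j. i < k \<Longrightarrow> j < k \<Longrightarrow> g p (U i) (U j) = (if i = j then 1 else 0)"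
    using assms(8) unfolding vertical_orthonormal_basis_def Let_def assms(2,4) k_def by blast+
  have "vertical_scalar_curv M g B p U = (\<Sum>i<k. \<Sum>j\<in>{..<k} - {i}. sec_curv M g p (U i) (U j))"
    by (simp add: vertical_scalar_curv_def assms(2,4) k_def Let_def)
  also have "\<dots> = (\<Sum>i<k. \<Sum>j\<in>{..<k} - {i}. fibre_sec_curv M g B F p (U i) (U j) - ?N)"
    by (intro sum.cong refl sec_curv_vertical) (auto simp: basis)
  also have "\<dots> = fibre_scalar_curv M g B F p U - (\<Sum>i<k. \<Sum>j\<in>{..<k} - {i}. ?N)"
    by (simp add: sum_subtractf fibre_scalar_curv_def assms(2,4) k_def Let_def)
  \<comment> \<open>Counts ordered pairs of distinct indices; the case \<open>k = 0\<close>, where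
    \<open>real k - 1\<close> is negative and not a cardinality, is treated apart.\<close>
  also have "(\<Sum>i<k. \<Sum>j\<in>{..<k} - {i}. ?N) = real k * (real k - 1) * ?N"
    by (cases k) auto
  also have "real k = real m - real n" using nm by (simp add: k_def)
  finally show ?thesis .
qed

end
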